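(* Let $\mu\in(0,1)$ and $c_J=-1-2\sqrt{\mu(1-\mu)}$. (i) If $\mu<1/2$, then there exists $\varepsilon>0$ such that for every $c\in(c_J-\varepsilon,c_J)$ the regularized Earth component $\overline{\Sigma_c^E}\subset T^*S^2$ is not fiberwise convex. (ii) If $\mu=1/2$, then for every $c<c_J=-2$ both regularized compact components $\overline{\Sigma_c^E}$ and $\overline{\Sigma_c^M}$ are fiberwise convex.
   Context: Euler problem of two fixed centers: $E=(0,0)$, $M=(1,0)$, $\mu\in(0,1)$, and $H(q,p)=\frac12|p|^2+U(q)$ with $U(q)=-\frac{1-\mu}{|q-E|}-\frac{\mu}{|q-M|}$. The critical Jacobi energy is $c_J=-1-2\sqrt{\mu(1-\mu)}$, the unique critical value of $H$. For $c<c_J$, $H^{-1}(c)$ has two bounded components $\Sigma_c^E$, $\Sigma_c^M$ (Earth and Moon components), projecting near $E$ and near $M$ respectively. Moser regularization (described for the Earth component; the Moon component is treated likewise with $M$ in place of $E$): exchanging roles, regard $p\in\mathbb{R}^2$ as base variable and $q$ as fiber variable, so $\Sigma_c^E\subset T^*\mathbb{R}^2\subset T^*S^2$ where $S^2=\mathbb{R}^2\cup\{\infty\}$ by stereographic projection. The regularized Earth component is the closure $\overline{\Sigma_c^E}\subset T^*S^2$; it is a subbundle over $S^2$ whose fibers are diffeomorphic to circles, and the fiber over $\infty$ is a (round) circle. It is called fiberwise convex if every fiber bounds a strictly convex domain (closed planar curve with nowhere vanishing curvature). Since the fiber over $\infty$ is a circle and chart transitions are linear on fibers, this is equivalent to: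 for every $p\in\mathbb{R}^2$ the closed curve $\{q:(q,p)\in\Sigma_c^E\}$, i.e. the component of $\{q:U(q)=c-\frac12|p|^2\}$ around $E$, bounds a strictly convex domain in $\mathbb{R}^2$. *)

theory Defs
  imports "HOL-Analysis.Analysis"
begin

section \<open>The Euler problem of two fixed centers\<close>

definition Earth :: "real^2" where "Earth = vector [0, 0]"

definition Moon :: "real^2" where "Moon = vector [1, 0]"

definition potential :: "real \<Rightarrow> real^2 \<Rightarrow> real" where
  "potential \<mu> q = - (1 - \<mu>) / norm (q - Earth) - \<mu> / norm (q - Moon)"

definition hamiltonian :: "real \<Rightarrow> (real^2) \<times> (real^2) \<Rightarrow> real" where
  "hamiltonian \<mu> = (\<lambda>(q, p). (norm p)\<^sup>2 / 2 + potential \<mu> q)"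

text \<open>The centers are removed explicitly, because division by zero gives \<^const>\<open>potential\<close>
  a finite value there.\<close>
definition energy_surface :: "real \<Rightarrow> real \<Rightarrow> ((real^2) \<times> (real^2)) set" where
  "energy_surface \<mu> c =
     {(q, p). q \<noteq> Earth \<and> q \<noteq> Moon \<and> hamiltonian \<mu> (q, p) = c}"

definition critical_energy :: "real \<Rightarrow> real" where
  "critical_energy \<mu> = - 1 - 2 * sqrt (\<mu> * (1 - \<mu>))"

text \<open>The component of the energy surface lying over a punctured neighborhood of the center
  \<open>a\<close>.  For \<open>0 < \<mu> < 1\<close> and \<open>c\<close> below the critical energy, exactly one connected component
  has \<open>a\<close> in the closure of its projection to the \<open>q\<close>-plane, so the union has a single
  member.\<close>
definition energy_component ::
    "real \<Rightarrow> real \<Rightarrow> real^2 \<Rightarrow> ((real^2) \<times> (real^2)) set" where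
  "energy_component \<mu> c a = \<Union>{C \<in> components (energy_surface \<mu> c). a \<in> closure (fst ` C)}"

section \<open>Moser regularization\<close>

text \<open>\<open>T\<^sup>*S\<^sup>2\<close> is realized, through the round metric, as the set of pairs \<open>(\<xi>, \<eta>)\<close> with \<open>\<xi>\<close> in the
  unit sphere of \<open>\<real>\<^sup>2 \<times> \<real>\<close> and \<open>\<eta>\<close> tangent to the sphere at \<open>\<xi>\<close>.\<close>
definition cotangent_space :: "(real^2) \<times> real \<Rightarrow> ((real^2) \<times> real) set" where
  "cotangent_space \<xi> = {\<eta>. \<xi> \<bullet> \<eta> = 0}"

definition cotangent_sphere :: "(((real^2) \<times> real) \<times> ((real^2) \<times> real)) set" where
  "cotangent_sphere = Sigma (sphere 0 1) cotangent_space"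

text \<open>Inverse stereographic projection; the point at infinity is the north pole \<open>(0, 1)\<close>.\<close>
definition inv_stereo :: "real^2 \<Rightarrow> (real^2) \<times> real" where
  "inv_stereo p = ((2 / (1 + (norm p)\<^sup>2)) *\<^sub>R p, ((norm p)\<^sup>2 - 1) / (1 + (norm p)\<^sup>2))"

text \<open>The covector \<open>q\<close> at \<open>p\<close>, transported to the sphere by the cotangent lift of
  \<^const>\<open>inv_stereo\<close>; see the lemma \<open>stereo_covector_pairing\<close> below.\<close>
definition stereo_covector :: "real^2 \<Rightarrow> real^2 \<Rightarrow> (real^2) \<times> real" where
  "stereo_covector p q = (((1 + (norm p)\<^sup>2) / 2) *\<^sub>R q - (p \<bullet> q) *\<^sub>R p, p \<bullet> q)"

text \<open>The momentum \<open>p\<close> is the base point, the position relative to the center \<open>a\<close> the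
  covector.\<close>
definition moser_map ::
    "real^2 \<Rightarrow> (real^2) \<times> (real^2) \<Rightarrow> ((real^2) \<times> real) \<times> ((real^2) \<times> real)" where
  "moser_map a = (\<lambda>(q, p). (inv_stereo p, stereo_covector p (q - a)))"

text \<open>The closure is taken in the subspace \<open>T\<^sup>*S\<^sup>2\<close>.\<close>
definition regularized_component ::
    "real \<Rightarrow> real \<Rightarrow> real^2 \<Rightarrow> (((real^2) \<times> real) \<times> ((real^2) \<times> real)) set" where
  "regularized_component \<mu> c a =
     cotangent_sphere \<inter> closure (moser_map a ` energy_component \<mu> c a)"

section \<open>Fiberwise convexity\<close>

definition velocity :: "(real \<Rightarrow> 'a::euclidean_space) \<Rightarrow> real \<Rightarrow> 'a" where
  "velocity \<gamma> t = vector_derivative \<gamma> (at t)"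

definition acceleration :: "(real \<Rightarrow> 'a::euclidean_space) \<Rightarrow> real \<Rightarrow> 'a" where
  "acceleration \<gamma> = velocity (velocity \<gamma>)"

text \<open>The numerator is the area of the parallelogram spanned by velocity and acceleration; for a
  curve in a plane this is the absolute value of the signed curvature.\<close>
definition curvature :: "(real \<Rightarrow> 'a::euclidean_space) \<Rightarrow> real \<Rightarrow> real" where
  "curvature \<gamma> t =
     sqrt ((norm (velocity \<gamma> t))\<^sup>2 * (norm (acceleration \<gamma> t))\<^sup>2
           - (velocity \<gamma> t \<bullet> acceleration \<gamma> t)\<^sup>2)
     / (norm (velocity \<gamma> t)) ^ 3"

text \<open>Simple closed regular curves of class \<open>C\<^sup>2\<close>, as maps of period 1.\<close>
definition regular_closed_curve :: "(real \<Rightarrow> 'a::euclidean_space) \<Rightarrow> bool" where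
  "regular_closed_curve \<gamma> \<longleftrightarrow>
     (\<forall>t. \<gamma> (t + 1) = \<gamma> t) \<and> inj_on \<gamma> {0..<1} \<and>
     \<gamma> C1_differentiable_on UNIV \<and> velocity \<gamma> C1_differentiable_on UNIV \<and>
     (\<forall>t. velocity \<gamma> t \<noteq> 0)"

text \<open>\<open>D\<close> is a bounded domain of the plane \<open>P\<close>: interior and boundary are relative to \<open>P\<close>.\<close>
definition strictly_convex_domain :: "'a::euclidean_space set \<Rightarrow> 'a set \<Rightarrow> bool" where
  "strictly_convex_domain P D \<longleftrightarrow>
     D \<noteq> {} \<and> bounded D \<and> openin (top_of_set P) D \<and>
     (\<forall>x \<in> closure D. \<forall>y \<in> closure D. x \<noteq> y \<longrightarrow> open_segment x y \<subseteq> D)"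

definition bounds_strictly_convex_domain :: "'a::euclidean_space set \<Rightarrow> 'a set \<Rightarrow> bool" where
  "bounds_strictly_convex_domain P F \<longleftrightarrow>
     (\<exists>D. strictly_convex_domain P D \<and> F = closure D - D) \<and>
     (\<exists>\<gamma>. regular_closed_curve \<gamma> \<and> range \<gamma> = F \<and> (\<forall>t. curvature \<gamma> t \<noteq> 0))"

definition fiberwise_convex :: "(((real^2) \<times> real) \<times> ((real^2) \<times> real)) set \<Rightarrow> bool" where
  "fiberwise_convex K \<longleftrightarrow>
     (\<forall>\<xi> \<in> sphere 0 1. bounds_strictly_convex_domain (cotangent_space \<xi>) {\<eta>. (\<xi>, \<eta>) \<in> K})"

section \<open>The cotangent lift\<close>

lemma inv_stereo_in_sphere: "inv_stereo p \<in> sphere 0 1"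
proof -
  define s where "s = (norm p)\<^sup>2"
  have s: "1 + s > 0" by (simp add: s_def add_pos_nonneg)
  have pp: "p \<bullet> p = s" by (simp add: s_def power2_norm_eq_inner)
  have "inv_stereo p \<bullet> inv_stereo p = (2 / (1 + s))\<^sup>2 * s + ((s - 1) / (1 + s))\<^sup>2"
    unfolding inv_stereo_def s_def[symmetric] by (simp add: inner_prod_def pp power2_eq_square)
  also have "\<dots> = (4 * s + (s - 1)\<^sup>2) / (1 + s)\<^sup>2"
    by (simp add: power_divide add_divide_distrib)
  also have "4 * s + (s - 1)\<^sup>2 = (1 + s)\<^sup>2"
    by (simp add: power2_eq_square algebra_simps)
  finally have "inv_stereo p \<bullet> inv_stereo p = 1" using s by simp
  then show ?thesis by (simp add: norm_eq_sqrt_inner)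
qed

lemma stereo_covector_in_cotangent_space:
  "stereo_covector p q \<in> cotangent_space (inv_stereo p)"
proof -
  define u where "u = 1 + (norm p)\<^sup>2"
  have u: "u > 0" by (simp add: u_def add_pos_nonneg)
  have pp: "p \<bullet> p = u - 1" "(norm p)\<^sup>2 - 1 = u - 2"
    by (simp_all add: u_def power2_norm_eq_inner)
  define k h m where "k = 2 / u" and "h = (u - 2) / u" and "m = u / 2"
  have "inv_stereo p = (k *\<^sub>R p, h)" "stereo_covector p q = (m *\<^sub>R q - (p \<bullet> q) *\<^sub>R p, p \<bullet> q)"
    unfolding inv_stereo_def stereo_covector_def u_def[symmetric] pp(2) k_def h_def m_def
    by (rule refl)+
  then have "inv_stereo p \<bullet> stereo_covector p q = (k * m - k * (u - 1) + h) * (p \<bullet> q)"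
    by (simp add: inner_prod_def inner_diff_right pp(1) algebra_simps)
  also have "k * m - k * (u - 1) + h = 0"
    using u by (simp add: k_def h_def m_def field_simps)
  finally show ?thesis by (simp add: cotangent_space_def)
qed

lemma stereo_covector_pairing:
  "\<exists>D. (inv_stereo has_derivative D) (at p) \<and> (\<forall>v. stereo_covector p q \<bullet> D v = q \<bullet> v)"
proof -
  define u where "u = 1 + p \<bullet> p"
  have u: "u > 0" by (simp add: u_def add_pos_nonneg)
  define r where "r x = inverse (1 + x \<bullet> x)" for x :: "real^2"
  define r' where "r' v = - (2 * (p \<bullet> v)) / u\<^sup>2" for v
  have r: "(r has_derivative r') (at p)"
  proof -
    have "((\<lambda>x. 1 + x \<bullet> x) has_derivative (\<lambda>v. 2 * (p \<bullet> v))) (at p)"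
      by (auto intro!: derivative_eq_intros simp: inner_commute)
    from Deriv.has_derivative_inverse[OF _ this] u show ?thesis
      by (simp add: r_def[abs_def] r'_def[abs_def] u_def field_simps power2_eq_square)
  qed
  have eq: "inv_stereo = (\<lambda>x. ((2 * r x) *\<^sub>R x, 1 - 2 * r x))"
  proof
    fix x :: "real^2"
    have "1 + x \<bullet> x > 0" by (simp add: add_pos_nonneg)
    then show "inv_stereo x = ((2 * r x) *\<^sub>R x, 1 - 2 * r x)"
      by (simp add: inv_stereo_def r_def power2_norm_eq_inner field_simps)
  qed
  define D where "D v = ((2 * r p) *\<^sub>R v + (2 * r' v) *\<^sub>R p, - 2 * r' v)" for v
  have "((\<lambda>x. (2 * r x) *\<^sub>R x) has_derivative (\<lambda>v. (2 * r p) *\<^sub>R v + (2 * r' v) *\<^sub>R p)) (at p)"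
    by (intro has_derivative_scaleR has_derivative_mult_right r has_derivative_ident)
  moreover have "((\<lambda>x. 1 - 2 * r x) has_derivative (\<lambda>v. - 2 * r' v)) (at p)"
    using has_derivative_diff[OF has_derivative_const[of 1] has_derivative_mult_right[OF r, of 2]]
    by simp
  ultimately have "(inv_stereo has_derivative D) (at p)"
    unfolding eq D_def by (rule has_derivative_Pair)
  moreover have "stereo_covector p q \<bullet> D v = q \<bullet> v" for v
  proof -
    define a b where "a = p \<bullet> q" and "b = p \<bullet> v"
    have pp: "p \<bullet> p = u - 1" by (simp add: u_def)
    have cov: "stereo_covector p q = ((u / 2) *\<^sub>R q - a *\<^sub>R p, a)"
      by (simp add: stereo_covector_def a_def u_def power2_norm_eq_inner)
    define k h where "k = 2 / u" and "h = 4 * b / u\<^sup>2"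
    have D: "D v = (k *\<^sub>R v - h *\<^sub>R p, h)"
      by (simp add: D_def r_def r'_def b_def u_def k_def h_def divide_inverse)
    have "stereo_covector p q \<bullet> D v =
       (u / 2) * (k * (q \<bullet> v) - h * a) - a * (k * b - h * (u - 1)) + a * h"
      unfolding cov D
      by (simp add: inner_prod_def inner_diff_left inner_diff_right inner_commute[of q p]
          pp algebra_simps flip: a_def b_def)
    also have "\<dots> = q \<bullet> v"
      using u by (simp add: k_def h_def field_simps power2_eq_square)
    finally show ?thesis .
  qed
  ultimately show ?thesis by blast
qed

end

theory Submission
  imports Defs "HOL-Real_Asymp.Real_Asymp"
begin

text \<open>Let \<open>a\<close> be one center, \<open>b\<close> the other, and \<open>V = \<alpha> / |q - a| + \<beta> / |q - b|\<close> the negative of the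
  potential, with saddle \<open>S\<close> and critical value \<open>V(S)\<close>. On the circle around \<open>a\<close> through \<open>S\<close> one has
  \<open>V \<le> V(S)\<close>, and inside this circle \<open>V\<close> decreases strictly along rays from \<open>a\<close>. So the component
  of the energy surface at \<open>a\<close> is the part over this disc, and the fiber over \<open>p\<close> is a linear image
  of the level curve \<open>V = |p|\<^sup>2 / 2 - c\<close> in the disc.

  For \<open>\<beta> < \<alpha>\<close> the critical level curve leaves \<open>S\<close> with slope \<open>\<surd>2\<close> and, by the third-order term
  of \<open>V\<close>, bends to the non-convex side. Hence a line close to the tangent meets the nearby level
  curves in at least three points.

  For \<open>\<alpha> = \<beta>\<close> the Hessian of \<open>V\<close> is negative on the tangent of every level curve above the critical
  value; in terms of the inverse distances \<open>u\<close>, \<open>v\<close> this is a polynomial inequality under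
  \<open>u + v > 4\<close>. So \<open>V\<close> has no interior local minimum on a segment, and a segment between points of a
  superlevel set stays inside, by shrinking it towards \<open>a\<close>.\<close>

section \<open>Curves and strictly convex domains\<close>

text \<open>Convexity of a fiber is asked for in two forms: it bounds a domain that contains the
  interiors of all chords, and it has a regular \<open>C^2\<close> parametrization with nonvanishing
  curvature. Negativity of the Hessian therefore serves twice. Along chords it forbids an interior
  minimum of \<open>V\<close>. Along the curve, differentiating \<open>V(\<gamma>) = k\<close> twice
  shows that an acceleration parallel to the velocity would make the Hessian vanish on the tangent.
  The parametrization itself has to be constructed, in polar coordinates at \<open>a\<close>. Both
  centers lie on one line through the saddle, so each contributes a positive multiple of
  \<open>2 x^2 - y^2\<close> to the quadratic part of \<open>V\<close> there. Hence the slope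
  \<open>sqrt 2\<close> for every mass ratio; the cubic term is the first that distinguishes the
  masses. Non-convexity is detected in the single fiber over \<open>p = 0\<close>. It is witnessed
  by strict inequalities at three points, which persist at nearby levels; this yields \<epsilon>.
  The fiber over infinity comes from no level curve. It is a limit: in rescaled variables the energy
  equation tends to \<open>|\<eta>| = \<alpha>\<close>, as for the Kepler problem of the near
  center.\<close>

lemma velocity_eqI:
  assumes "\<And>t. (\<gamma> has_vector_derivative \<gamma>' t) (at t)"
  shows "velocity \<gamma> = \<gamma>'"
  using assms by (auto simp: velocity_def fun_eq_iff intro: vector_derivative_at)

lemma regular_closed_curve_derivatives:
  assumes "regular_closed_curve \<gamma>"
  shows "(\<gamma> has_vector_derivative velocity \<gamma> t) (at t)"
    and "(velocity \<gamma> has_vector_derivative acceleration \<gamma> t) (at t)"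
    and "continuous_on UNIV (acceleration \<gamma>)"
proof -
  from assms have 1: "\<gamma> C1_differentiable_on UNIV" "velocity \<gamma> C1_differentiable_on UNIV"
    by (auto simp: regular_closed_curve_def)
  then show "(\<gamma> has_vector_derivative velocity \<gamma> t) (at t)"
    by (metis C1_differentiable_on_def UNIV_I velocity_eqI)
  from 1(2) obtain D where D: "\<And>t. (velocity \<gamma> has_vector_derivative D t) (at t)" "continuous_on UNIV D"
    by (auto simp: C1_differentiable_on_def)
  then have "acceleration \<gamma> = D" unfolding acceleration_def by (intro velocity_eqI)
  with D show "(velocity \<gamma> has_vector_derivative acceleration \<gamma> t) (at t)"
    "continuous_on UNIV (acceleration \<gamma>)" by auto
qed

lemma regular_closed_curveI:
  assumes d1: "\<And>t. (\<gamma> has_vector_derivative \<gamma>1 t) (at t)"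
    and d2: "\<And>t. (\<gamma>1 has_vector_derivative \<gamma>2 t) (at t)"
    and c2: "continuous_on UNIV \<gamma>2"
    and per: "\<And>t. \<gamma> (t + 1) = \<gamma> t" and inj: "inj_on \<gamma> {0..<1}"
    and reg: "\<And>t. \<gamma>1 t \<noteq> 0"
  shows "regular_closed_curve \<gamma>" "velocity \<gamma> = \<gamma>1" "acceleration \<gamma> = \<gamma>2"
proof -
  show v: "velocity \<gamma> = \<gamma>1" using d1 by (rule velocity_eqI)
  show "acceleration \<gamma> = \<gamma>2" unfolding acceleration_def v using d2 by (rule velocity_eqI)
  have "continuous_on UNIV \<gamma>1"
    by (meson continuous_at_imp_continuous_on d2 has_vector_derivative_continuous)
  then have "\<gamma> C1_differentiable_on UNIV" "velocity \<gamma> C1_differentiable_on UNIV"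
    using d1 d2 c2 unfolding v C1_differentiable_on_def by blast+
  with per inj reg show "regular_closed_curve \<gamma>" by (simp add: regular_closed_curve_def v)
qed

text \<open>The numerator is the Gram determinant of velocity and acceleration, which vanishes
  exactly in the equality case of Cauchy-Schwarz. In this form the condition is free of the metric
  and passes through injective linear maps.\<close>

lemma curvature_nonzero_iff:
  "curvature \<gamma> t \<noteq> 0 \<longleftrightarrow>
     velocity \<gamma> t \<noteq> 0 \<and> (\<forall>k. acceleration \<gamma> t \<noteq> k *\<^sub>R velocity \<gamma> t)"
proof (cases "velocity \<gamma> t = 0")
  case False
  let ?v = "velocity \<gamma> t" and ?w = "acceleration \<gamma> t"
  have "curvature \<gamma> t = 0 \<longleftrightarrow> (?v \<bullet> ?w)\<^sup>2 = (norm ?v * norm ?w)\<^sup>2"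
    using False by (auto simp: curvature_def power_mult_distrib)
  also have "\<dots> \<longleftrightarrow> \<bar>?v \<bullet> ?w\<bar> = norm ?v * norm ?w"
    by (metis abs_mult abs_norm_cancel power2_abs power2_eq_iff_nonneg abs_ge_zero)
  also have "\<dots> \<longleftrightarrow> (\<exists>k. ?w = k *\<^sub>R ?v)"
    unfolding norm_cauchy_schwarz_equal collinear_lemma using False by (metis scaleR_zero_left)
  finally show ?thesis using False by blast
qed (simp add: curvature_def)

text \<open>Carries planar convexity to a cotangent plane in 3-space. The left inverse exhibits the
  image of \<open>D\<close> as the trace of an open set on \<open>range L\<close>, which gives
  relative openness. The value of the curvature may change, but velocity and acceleration stay
  linearly independent.\<close>

lemma bounds_strictly_convex_domain_linear_image:
  fixes L :: "'a::euclidean_space \<Rightarrow> 'b::euclidean_space"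
  assumes L: "linear L" and L': "linear L'" and inv: "\<And>x. L' (L x) = x"
    and F: "bounds_strictly_convex_domain UNIV F"
  shows "bounds_strictly_convex_domain (range L) (L ` F)"
proof -
  have inj: "inj L" using inv by (metis injI)
  have bl: "bounded_linear L" using L by (simp add: linear_conv_bounded_linear)
  obtain D where D: "strictly_convex_domain UNIV D" "F = closure D - D"
    using F by (auto simp: bounds_strictly_convex_domain_def)
  have cl: "closure (L ` D) = L ` closure D"
    using L inj by (simp add: closure_injective_linear_image)
  have "L ` D = range L \<inter> L' -` D" using inv by force
  moreover have "open D" using D(1) by (simp add: strictly_convex_domain_def)
  then have "open (L' -` D)"
    by (simp add: L' continuous_open_vimage linear_continuous_at linear_linear)
  ultimately have op: "openin (top_of_set (range L)) (L ` D)" by (auto simp: openin_open)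
  have "strictly_convex_domain (range L) (L ` D)"
    unfolding strictly_convex_domain_def cl
  proof (intro conjI ballI impI op)
    show "L ` D \<noteq> {}" "bounded (L ` D)"
      using D(1) bounded_linear_image bl by (auto simp: strictly_convex_domain_def)
    fix x y assume "x \<in> L ` closure D" "y \<in> L ` closure D" "x \<noteq> y"
    then obtain x' y' where "x = L x'" "y = L y'" "x' \<in> closure D" "y' \<in> closure D" "x' \<noteq> y'" by auto
    then show "open_segment x y \<subseteq> L ` D"
      using D(1)
      by (simp add: open_segment_linear_image[OF L inj] image_mono strictly_convex_domain_def)
  qed
  moreover have "L ` F = closure (L ` D) - L ` D" using cl D(2) inj by (simp add: image_set_diff)
  ultimately have sc: "\<exists>D. strictly_convex_domain (range L) D \<and> L ` F = closure D - D" by blast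
  obtain \<gamma> where g: "regular_closed_curve \<gamma>" "range \<gamma> = F" "\<And>t. curvature \<gamma> t \<noteq> 0"
    using F by (auto simp: bounds_strictly_convex_domain_def)
  note d = regular_closed_curve_derivatives[OF g(1)]
  have "((L \<circ> \<gamma>) has_vector_derivative (L \<circ> velocity \<gamma>) t) (at t)"
    "((L \<circ> velocity \<gamma>) has_vector_derivative (L \<circ> acceleration \<gamma>) t) (at t)" for t
    using bounded_linear.has_vector_derivative[OF bl d(1)]
      bounded_linear.has_vector_derivative[OF bl d(2)] by (simp_all add: o_def)
  moreover have "continuous_on UNIV (L \<circ> acceleration \<gamma>)"
    using d(3) linear_continuous_on[OF bl]
    by (intro continuous_on_compose) (auto intro: continuous_on_subset)
  moreover have "(L \<circ> \<gamma>) (t + 1) = (L \<circ> \<gamma>) t" for t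
    using g(1) by (simp add: regular_closed_curve_def)
  moreover have "inj_on (L \<circ> \<gamma>) {0..<1}"
    using g(1) inj
    by (intro comp_inj_on) (auto simp: regular_closed_curve_def intro: inj_on_subset)
  moreover have "(L \<circ> velocity \<gamma>) t \<noteq> 0" for t
    using g(1) inv[of "velocity \<gamma> t"] linear_0[OF L'] by (auto simp: regular_closed_curve_def)
  ultimately have r: "regular_closed_curve (L \<circ> \<gamma>)" "velocity (L \<circ> \<gamma>) = L \<circ> velocity \<gamma>"
    "acceleration (L \<circ> \<gamma>) = L \<circ> acceleration \<gamma>"
    by (rule regular_closed_curveI)+
  have "curvature (L \<circ> \<gamma>) t \<noteq> 0" for t
    using g(3)[of t] inj unfolding curvature_nonzero_iff r
    by (simp add: linear_cmul[OF L, symmetric] inj_eq) (metis L linear_0 inj_eq)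
  with sc r(1) show ?thesis
    unfolding bounds_strictly_convex_domain_def using g(2) by (metis image_comp)
qed

section \<open>The potential of two centers\<close>

locale two_centers =
  fixes a b :: "real^2" and \<alpha> \<beta> :: real
  assumes dist_centers: "norm (b - a) = 1"
    and \<alpha>_pos: "0 < \<alpha>" and \<beta>_pos: "0 < \<beta>" and mass: "\<alpha> + \<beta> = 1"
begin

definition V :: "real^2 \<Rightarrow> real" where
  "V q = \<alpha> / norm (q - a) + \<beta> / norm (q - b)"

text \<open>The reciprocal of \<open>V\<close>, extended continuously by 0 to the two centers, where \<open>V\<close> itself has a
  meaningless finite value.\<close>
definition W :: "real^2 \<Rightarrow> real" where
  "W q = norm (q - a) * norm (q - b) / (\<alpha> * norm (q - b) + \<beta> * norm (q - a))"

text \<open>The distance from \<open>a\<close> to the saddle of \<open>V\<close>, where the attractions of the two centers balance.\<close>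
definition critical_radius :: real where
  "critical_radius = sqrt \<alpha> / (sqrt \<alpha> + sqrt \<beta>)"

definition critical_value :: real where
  "critical_value = (sqrt \<alpha> + sqrt \<beta>)\<^sup>2"

lemma a_neq_b: "a \<noteq> b"
  using dist_centers by auto

lemma W_denominator_pos: "0 < \<alpha> * norm (q - b) + \<beta> * norm (q - a)"
proof (cases "q = a")
  case False
  then show ?thesis using \<alpha>_pos \<beta>_pos by (simp add: add_nonneg_pos)
qed (use \<alpha>_pos a_neq_b in simp)

lemma continuous_on_W: "continuous_on S W"
proof -
  have "\<alpha> * norm (q - b) + \<beta> * norm (q - a) \<noteq> 0" for q
    using W_denominator_pos[of q] by simp
  then show ?thesis unfolding W_def by (intro continuous_intros) auto
qed

lemma W_at_a [simp]: "W a = 0" and W_at_b [simp]: "W b = 0"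
  by (simp_all add: W_def)

lemma W_nonneg: "0 \<le> W q"
  using W_denominator_pos[of q] by (simp add: W_def)

lemma V_pos: "q \<noteq> a \<Longrightarrow> 0 < V q"
  unfolding V_def using \<alpha>_pos \<beta>_pos by (intro add_pos_nonneg) auto

lemma W_eq_inverse_V:
  assumes "q \<noteq> a" "q \<noteq> b"
  shows "W q = 1 / V q"
  using assms W_denominator_pos[of q] by (simp add: W_def V_def field_simps)

lemma critical_radius_pos: "0 < critical_radius"
  and critical_radius_less_1: "critical_radius < 1"
  and one_minus_critical_radius: "1 - critical_radius = sqrt \<beta> / (sqrt \<alpha> + sqrt \<beta>)"
proof -
  have s: "0 < sqrt \<alpha>" "0 < sqrt \<beta>" using \<alpha>_pos \<beta>_pos by auto
  then have "0 < sqrt \<alpha> + sqrt \<beta>" by linarith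
  with s show "0 < critical_radius" "critical_radius < 1" unfolding critical_radius_def
    by (simp_all add: divide_less_eq zero_less_divide_iff del: real_sqrt_gt_0_iff)
  show "1 - critical_radius = sqrt \<beta> / (sqrt \<alpha> + sqrt \<beta>)"
    using \<open>0 < sqrt \<alpha> + sqrt \<beta>\<close> unfolding critical_radius_def by (simp add: diff_divide_eq_iff)
qed

lemma critical_radius_balance: "\<alpha> * (1 - critical_radius)\<^sup>2 = \<beta> * critical_radius\<^sup>2"
  unfolding one_minus_critical_radius unfolding critical_radius_def
  using \<alpha>_pos \<beta>_pos by (simp add: power_divide)

lemma critical_value_eq: "critical_value = 1 + 2 * sqrt (\<alpha> * \<beta>)"
  using \<alpha>_pos \<beta>_pos mass by (simp add: critical_value_def power2_sum real_sqrt_mult)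

lemma critical_value_eq': "critical_value = \<alpha> / critical_radius + \<beta> / (1 - critical_radius)"
proof -
  have s: "0 < sqrt \<alpha>" "0 < sqrt \<beta>" using \<alpha>_pos \<beta>_pos by auto
  have "\<alpha> / critical_radius = sqrt \<alpha> * (sqrt \<alpha> + sqrt \<beta>)"
    using s \<alpha>_pos unfolding critical_radius_def by (simp add: field_simps)
  moreover have "\<beta> / (1 - critical_radius) = sqrt \<beta> * (sqrt \<alpha> + sqrt \<beta>)"
    using s \<beta>_pos unfolding one_minus_critical_radius by (simp add: field_simps)
  ultimately show ?thesis by (simp add: critical_value_def power2_eq_square algebra_simps)
qed

lemma critical_value_ge_1: "1 \<le> critical_value"
  using \<alpha>_pos \<beta>_pos by (simp add: critical_value_eq)

lemma norm_diff_b_ge: "1 - norm (q - a) \<le> norm (q - b)"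
  using norm_triangle_ineq4[of "q - a" "q - b"] dist_centers by simp

lemma norm_diff_b_le: "norm (q - b) \<le> 1 + norm (q - a)"
  using norm_triangle_ineq4[of "q - a" "b - a"] dist_centers by simp

lemma in_disc_neq_b: "norm (q - a) \<le> critical_radius \<Longrightarrow> q \<noteq> b"
  using critical_radius_less_1 dist_centers by auto

text \<open>By the triangle inequality, a point of this circle is at distance at least
  \<open>1 - critical_radius\<close> from \<open>b\<close>, the distance attained at the
  saddle.\<close>

lemma V_critical_circle:
  assumes "norm (q - a) = critical_radius"
  shows "V q \<le> critical_value"
  unfolding V_def critical_value_eq' assms
  using norm_diff_b_ge[of q] assms critical_radius_less_1 \<beta>_pos
  by (auto intro!: divide_left_mono mult_pos_pos)

lemma W_pos: "q \<noteq> a \<Longrightarrow> norm (q - a) \<le> critical_radius \<Longrightarrow> 0 < W q"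
  using W_eq_inverse_V V_pos in_disc_neq_b by simp

text \<open>Moving inward from \<open>q\<close> to \<open>m\<close> gains
  \<open>\<alpha> (1 - s) / (s r)\<close> from the near center. The distance to \<open>b\<close>
  grows by at most \<open>(1 - s) r\<close>, so the loss is at most
  \<open>\<beta> (1 - s) r / (|q - b| |m - b|)\<close>. The gain wins if
  \<open>\<beta> s r^2 < \<alpha> |q - b| |m - b|\<close>, which follows from the balance of
  attractions at the critical radius.\<close>

lemma V_radial_less:
  assumes q: "q \<noteq> a" "norm (q - a) \<le> critical_radius" and s: "0 < s" "s < 1"
  shows "V q < V (a + s *\<^sub>R (q - a))"
proof -
  define r where "r = norm (q - a)"
  define m where "m = a + s *\<^sub>R (q - a)"
  let ?l = critical_radius
  have r: "0 < r" "r \<le> ?l" "r < 1" using q critical_radius_less_1 by (auto simp: r_def)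
  have mr: "norm (m - a) = s * r" using s by (simp add: m_def r_def)
  have "s * r < r" using s r by simp
  then have b: "1 - r \<le> norm (q - b)" "1 - s * r \<le> norm (m - b)" "0 < 1 - r" "0 < 1 - s * r"
    using norm_diff_b_ge[of q] norm_diff_b_ge[of m] mr r(3) by (simp_all flip: r_def)
  have "m - q = - ((1 - s) *\<^sub>R (q - a))" by (simp add: m_def algebra_simps)
  then have "norm (m - q) = (1 - s) * r" using s by (simp add: r_def)
  then have d: "norm (m - b) - norm (q - b) \<le> (1 - s) * r"
    using norm_triangle_ineq2[of "m - b" "q - b"] by simp
  have "\<beta> * (s * r\<^sup>2) < \<beta> * ?l\<^sup>2"
  proof -
    have "s * r\<^sup>2 < 1 * r\<^sup>2" using s r by (intro mult_strict_right_mono) auto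
    also have "\<dots> \<le> ?l\<^sup>2" using r by (simp add: power_mono)
    finally show ?thesis using \<beta>_pos by simp
  qed
  also have "\<dots> = \<alpha> * (1 - ?l)\<^sup>2" by (simp add: critical_radius_balance)
  also have "\<dots> \<le> \<alpha> * ((1 - r) * (1 - s * r))"
    unfolding power2_eq_square
    using \<alpha>_pos r less_imp_le[OF less_le_trans[OF \<open>s * r < r\<close> r(2)]] critical_radius_less_1
    by (intro mult_left_mono mult_mono) simp_all
  also have "\<dots> \<le> \<alpha> * (norm (q - b) * norm (m - b))"
    using \<alpha>_pos b by (intro mult_left_mono mult_mono) auto
  finally have key: "\<beta> * (s * r\<^sup>2) < \<alpha> * (norm (q - b) * norm (m - b))" .
  have nb: "0 < norm (q - b)" "0 < norm (m - b)" using b by linarith+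
  have "\<beta> / norm (q - b) - \<beta> / norm (m - b)
      = \<beta> * (norm (m - b) - norm (q - b)) / (norm (q - b) * norm (m - b))"
    using nb by (simp add: field_simps)
  also have "\<dots> \<le> \<beta> * ((1 - s) * r) / (norm (q - b) * norm (m - b))"
    using d \<beta>_pos nb by (intro divide_right_mono mult_left_mono) auto
  also have "\<dots> < \<alpha> * (1 - s) / (s * r)"
  proof -
    have "(1 - s) * (\<beta> * (s * r\<^sup>2)) < (1 - s) * (\<alpha> * (norm (q - b) * norm (m - b)))"
      using key s by simp
    then show ?thesis using nb s r by (simp add: divide_simps power2_eq_square mult_ac)
  qed
  also have "\<dots> = \<alpha> / (s * r) - \<alpha> / r" using s r by (simp add: field_simps)
  finally show ?thesis unfolding V_def m_def[symmetric] mr by (simp add: r_def)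
qed

lemma W_radial_less:
  assumes q: "q \<noteq> a" "norm (q - a) \<le> critical_radius" and s: "0 \<le> s" "s < 1"
  shows "W (a + s *\<^sub>R (q - a)) < W q"
proof (cases "s = 0")
  case False
  define m where "m = a + s *\<^sub>R (q - a)"
  have "s * norm (q - a) \<le> norm (q - a)" using s by (simp add: mult_left_le_one_le)
  then have "s * norm (q - a) \<le> critical_radius" using q(2) by linarith
  then have m: "m \<noteq> a" "norm (m - a) \<le> critical_radius"
    using False q s by (simp_all add: m_def)
  show ?thesis
    using V_radial_less[OF q, of s] False s m V_pos[OF q(1)] V_pos[OF m(1)] q
    unfolding m_def[symmetric]
    by (simp add: W_eq_inverse_V in_disc_neq_b frac_less2)
qed (use W_pos q in simp)

lemma W_radial_le:
  assumes q: "norm (q - a) \<le> critical_radius" and s: "0 \<le> s" "s \<le> 1"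
  shows "W (a + s *\<^sub>R (q - a)) \<le> W q"
  using W_radial_less[of q s] assms by (cases "q = a"; cases "s = 1") auto

text \<open>The circle is a barrier: no level curve above the critical value touches it. This is
  what separates the component at \<open>a\<close> from the rest of the surface.\<close>

lemma W_critical_circle:
  assumes "norm (q - a) = critical_radius" and "critical_value < k"
  shows "1 < W q * k"
proof -
  have q: "q \<noteq> a" using assms critical_radius_pos by auto
  have "V q < k" using V_critical_circle assms by fastforce
  then show ?thesis using q assms V_pos[OF q] by (simp add: W_eq_inverse_V in_disc_neq_b)
qed

section \<open>The energy surface and its component at the center\<close>

definition surface :: "real \<Rightarrow> ((real^2) \<times> (real^2)) set" where
  "surface c = {(q, p). q \<noteq> a \<and> q \<noteq> b \<and> (norm p)\<^sup>2 / 2 - V q = c}"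

text \<open>Written with \<open>W\<close>, the set is visibly closed; \<open>W a = 0\<close> excludes the center automatically.\<close>
definition inner_surface :: "real \<Rightarrow> ((real^2) \<times> (real^2)) set" where
  "inner_surface c = {(q, p). norm (q - a) \<le> critical_radius \<and> W q * ((norm p)\<^sup>2 / 2 - c) = 1}"

lemma closed_inner_surface: "closed (inner_surface c)"
proof -
  have W: "continuous_on UNIV (\<lambda>x::(real^2)\<times>(real^2). W (fst x))"
    by (intro continuous_on_compose2[OF continuous_on_W[of UNIV]] continuous_intros) auto
  show ?thesis
    unfolding inner_surface_def case_prod_unfold
    by (intro closed_Collect_conj closed_Collect_le closed_Collect_eq continuous_intros W) auto
qed

text \<open>The closed and the open disc cut out the same part of the surface, because of the
  barrier circle.\<close>

lemma inner_surface_eq: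
  assumes c: "c < - critical_value"
  shows "inner_surface c = {(q, p) \<in> surface c. norm (q - a) < critical_radius}"
proof (intro subset_antisym subsetI; clarify)
  fix q p assume A: "(q, p) \<in> inner_surface c"
  then have q: "norm (q - a) \<le> critical_radius" "W q * ((norm p)\<^sup>2 / 2 - c) = 1"
    by (auto simp: inner_surface_def)
  then have qa: "q \<noteq> a" by auto
  have qb: "q \<noteq> b" using q in_disc_neq_b by blast
  have "critical_value < (norm p)\<^sup>2 / 2 - c" using c by (smt (verit) zero_le_power2 divide_nonneg_pos)
  then have "norm (q - a) \<noteq> critical_radius" using W_critical_circle[of q] q(2) by force
  moreover have "(norm p)\<^sup>2 / 2 - V q = c"
    using q(2) V_pos[OF qa] by (simp add: W_eq_inverse_V qa qb field_simps)
  ultimately show "(q, p) \<in> surface c \<and> norm (q - a) < critical_radius"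
    using qa qb q by (simp add: surface_def)
next
  fix q p assume "(q, p) \<in> surface c" "norm (q - a) < critical_radius"
  then show "(q, p) \<in> inner_surface c"
    using V_pos[of q] by (auto simp: surface_def inner_surface_def W_eq_inverse_V)
qed

text \<open>Slide \<open>q\<close> radially into \<open>a\<close> and keep the direction of the
  momentum. \<open>V\<close> increases on the way, so the kinetic energy \<open>c + V\<close> stays
  nonnegative and the path stays on the surface.\<close>

lemma component_through_inner_point:
  assumes c: "c < - critical_value" and qp: "(q, p) \<in> surface c" "norm (q - a) < critical_radius"
  obtains C where "C \<in> components (surface c)" "(q, p) \<in> C" "a \<in> closure (fst ` C)"
proof -
  define C where "C = connected_component_set (surface c) (q, p)"
  \<comment> \<open>At \<open>p = 0\<close> any direction will do, but one is needed: the momentum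
    becomes nonzero as soon as the path leaves \<open>q\<close>.\<close>
  obtain u where u: "norm u = 1" "p = norm p *\<^sub>R u"
  proof (cases "p = 0")
    case True
    then show ?thesis using that[of "axis 1 1"] by simp
  next
    case False
    then show ?thesis using that[of "p /\<^sub>R norm p"] by simp
  qed
  have q: "q \<noteq> a" "q \<noteq> b" "(norm p)\<^sup>2 / 2 - V q = c" using qp by (auto simp: surface_def)
  define m where "m s = a + s *\<^sub>R (q - a)" for s
  \<comment> \<open>\<open>1 / W\<close> replaces \<open>V\<close> so that continuity follows from
    that of \<open>W\<close>.\<close>
  define g where "g s = (m s, sqrt (2 * (c + 1 / W (m s))) *\<^sub>R u)" for s
  have m: "m s \<noteq> a" "m s \<noteq> b" "norm (m s - a) < critical_radius" "V q \<le> V (m s)"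
    if "s \<in> {0<..1}" for s
  proof -
    have "s * norm (q - a) \<le> norm (q - a)" using that by (simp add: mult_left_le_one_le)
    with qp(2) show 1: "norm (m s - a) < critical_radius" using that by (simp add: m_def)
    then show "m s \<noteq> b" using in_disc_neq_b by simp
    show "m s \<noteq> a" using that q by (simp add: m_def)
    show "V q \<le> V (m s)"
      using V_radial_less[OF q(1), of s] qp(2) that by (cases "s = 1") (auto simp: m_def)
  qed
  have sub: "g ` {0<..1} \<subseteq> surface c"
  proof (rule image_subsetI)
    fix s :: real assume l: "s \<in> {0<..1}"
    have "0 \<le> c + V (m s)" using m(4)[OF l] q(3) by (smt (verit) zero_le_power2 divide_nonneg_pos)
    then show "g s \<in> surface c"
      using m[OF l] u(1) by (simp add: g_def surface_def W_eq_inverse_V add_divide_distrib)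
  qed
  have W: "continuous_on {0<..1} (\<lambda>s. W (m s))"
    unfolding m_def
    by (intro continuous_on_compose2[OF continuous_on_W[of UNIV]] continuous_intros) auto
  have "W (m s) \<noteq> 0" if "s \<in> {0<..1}" for s using m[OF that] W_pos[of "m s"] by simp
  with W have "continuous_on {0<..1} g"
    unfolding g_def m_def by (intro continuous_intros) (auto simp: m_def)
  then have "connected (g ` {0<..1})" by (intro connected_continuous_image) auto
  moreover have g1: "g 1 = (q, p)"
    using q u by (simp add: g_def m_def W_eq_inverse_V) (simp add: field_simps flip: q(3))
  moreover have "g 1 \<in> g ` {0<..1}" by simp
  ultimately have "g ` {0<..1} \<subseteq> C"
    unfolding C_def using sub by (intro connected_component_maximal) auto
  then have "m ` {0<..1} \<subseteq> fst ` C" by (force simp: g_def)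
  then have "closure (m ` {0<..1}) \<subseteq> closure (fst ` C)" by (rule closure_mono)
  moreover have "a \<in> closure (m ` {0<..1})"
  proof -
    have "continuous_on UNIV m" unfolding m_def by (intro continuous_intros)
    then have "m ` closure {0<..1} \<subseteq> closure (m ` {0<..1})"
      by (intro image_closure_subset[OF continuous_on_subset[OF _ subset_UNIV] closed_closure
          closure_subset])
    moreover have "m 0 = a" by (simp add: m_def)
    moreover have "0 \<in> closure {0<..(1::real)}" by simp
    ultimately show ?thesis by blast
  qed
  ultimately have "a \<in> closure (fst ` C)" by blast
  moreover have "C \<in> components (surface c)" "(q, p) \<in> C"
    using qp(1) by (auto simp: C_def components_def)
  ultimately show ?thesis by (rule that[rotated 2])
qed

text \<open>The distance to \<open>a\<close> has a connected image on the component. It takes values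
  below the critical radius but never that value itself, so it stays below.\<close>

lemma component_subset_inner:
  assumes c: "c < - critical_value" and C: "C \<in> components (surface c)" "a \<in> closure (fst ` C)"
  shows "C \<subseteq> inner_surface c"
proof -
  have sub: "C \<subseteq> surface c" using C(1) by (rule in_components_subset)
  let ?f = "\<lambda>x::(real^2)\<times>(real^2). norm (fst x - a)"
  obtain x where x: "x \<in> C" "?f x < critical_radius"
    using C(2) critical_radius_pos unfolding closure_approachable
    by (force simp: dist_norm)
  have conn: "connected (?f ` C)"
    using C(1) by (intro connected_continuous_image continuous_intros in_components_connected)
  have ne: "?f y \<noteq> critical_radius" if y: "y \<in> C" for y
  proof
    assume eq: "?f y = critical_radius"
    obtain q p where y': "y = (q, p)" by (cases y)
    with y sub have "(norm p)\<^sup>2 / 2 - V q = c" by (auto simp: surface_def)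
    then have "V q \<ge> - c" by (smt (verit) zero_le_power2 divide_nonneg_pos)
    with V_critical_circle[of q] eq y' c show False by simp
  qed
  have "?f y < critical_radius" if y: "y \<in> C" for y
  proof (rule ccontr)
    assume "\<not> ?f y < critical_radius"
    then have "critical_radius \<in> ?f ` C"
      using connectedD_interval[OF conn, of "?f x" "?f y"] x y by auto
    then obtain z where "z \<in> C" "critical_radius = ?f z" by (rule imageE)
    with ne[of z] show False by simp
  qed
  then show ?thesis using sub unfolding inner_surface_eq[OF c] by fastforce
qed

lemma component_at_a_eq_inner_surface:
  assumes c: "c < - critical_value"
  shows "\<Union>{C \<in> components (surface c). a \<in> closure (fst ` C)} = inner_surface c"
proof
  show "\<Union>{C \<in> components (surface c). a \<in> closure (fst ` C)} \<subseteq> inner_surface c"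
    using component_subset_inner[OF c] by blast
  show "inner_surface c \<subseteq> \<Union>{C \<in> components (surface c). a \<in> closure (fst ` C)}"
  proof clarify
    fix q p assume "(q, p) \<in> inner_surface c"
    then have "(q, p) \<in> surface c" "norm (q - a) < critical_radius"
      unfolding inner_surface_eq[OF c] by auto
    from component_through_inner_point[OF c this] obtain C where
      "C \<in> components (surface c)" "(q, p) \<in> C" "a \<in> closure (fst ` C)" .
    then show "(q, p) \<in> \<Union>{C \<in> components (surface c). a \<in> closure (fst ` C)}" by blast
  qed
qed

end

section \<open>Fibers of the regularized component\<close>

lemma linear_stereo_covector: "linear (stereo_covector p)"
  by (rule linearI) (simp_all add: stereo_covector_def algebra_simps inner_add_right)

text \<open>Stereographic projection is conformal, so its cotangent lift scales all lengths at
  \<open>p\<close> by one factor, the inverse of the conformal factor.\<close>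

lemma norm_stereo_covector: "norm (stereo_covector p x) = (1 + (norm p)\<^sup>2) / 2 * norm x"
proof -
  define m where "m = (1 + (norm p)\<^sup>2) / 2"
  have m: "0 < m" "p \<bullet> p = 2 * m - 1" by (auto simp: m_def power2_norm_eq_inner add_pos_nonneg add_divide_distrib)
  have "stereo_covector p x \<bullet> stereo_covector p x
      = m\<^sup>2 * (x \<bullet> x) - 2 * m * (p \<bullet> x)\<^sup>2 + (p \<bullet> x)\<^sup>2 * (p \<bullet> p) + (p \<bullet> x)\<^sup>2"
    unfolding stereo_covector_def m_def[symmetric]
    by (simp add: inner_prod_def inner_diff_left inner_diff_right inner_commute[of x p]
        power2_eq_square algebra_simps)
  also have "\<dots> = m\<^sup>2 * (x \<bullet> x)" unfolding m(2) by (simp add: algebra_simps)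
  also have "\<dots> = (m * norm x)\<^sup>2" by (simp add: power_mult_distrib power2_norm_eq_inner)
  finally have "(norm (stereo_covector p x))\<^sup>2 = (m * norm x)\<^sup>2" by (simp add: power2_norm_eq_inner)
  then show ?thesis using m(1) unfolding m_def[symmetric] by (simp add: power2_eq_iff_nonneg)
qed

text \<open>On the cotangent plane at \<open>inv_stereo p\<close> this is the pullback of a covector
  under \<open>inv_stereo\<close>. The formula extends it linearly to the whole space and is
  continuous in \<open>p\<close> as well, as limits of fibers require.\<close>

definition stereo_covector_inv :: "real^2 \<Rightarrow> (real^2) \<times> real \<Rightarrow> real^2" where
  "stereo_covector_inv p \<eta> = (2 / (1 + (norm p)\<^sup>2)) *\<^sub>R (fst \<eta> + snd \<eta> *\<^sub>R p)"

lemma linear_stereo_covector_inv: "linear (stereo_covector_inv p)"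
  by (rule linearI)
    (simp_all add: stereo_covector_inv_def scaleR_add_left scaleR_add_right mult.commute)

lemma stereo_covector_inv_left: "stereo_covector_inv p (stereo_covector p x) = x"
proof -
  have "1 + (norm p)\<^sup>2 \<noteq> 0" by (smt (verit) zero_le_power2)
  then have "2 / (1 + (norm p)\<^sup>2) * ((1 + (norm p)\<^sup>2) / 2) = 1" by (simp add: field_simps)
  then show ?thesis
    unfolding stereo_covector_inv_def stereo_covector_def
    by (simp only: fst_conv snd_conv diff_add_cancel scaleR_scaleR scaleR_one)
qed

lemma stereo_covector_inv_right:
  assumes "\<eta> \<in> cotangent_space (inv_stereo p)"
  shows "stereo_covector p (stereo_covector_inv p \<eta>) = \<eta>"
proof -
  define m where "m = (1 + (norm p)\<^sup>2) / 2"
  have m: "0 < m" "p \<bullet> p = 2 * m - 1" "(norm p)\<^sup>2 = 2 * m - 1"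
    by (auto simp: m_def power2_norm_eq_inner add_pos_nonneg add_divide_distrib)
  obtain v h where \<eta>: "\<eta> = (v, h)" by (cases \<eta>)
  have "(1 / m) * (p \<bullet> v) + (m - 1) / m * h = 0"
    using assms m(1) unfolding cotangent_space_def inv_stereo_def \<eta> m(3)
    by (simp add: inner_prod_def field_simps)
  then have pv: "p \<bullet> v = (1 - m) * h" using m(1) by (simp add: field_simps)
  have x: "stereo_covector_inv p \<eta> = (1 / m) *\<^sub>R (v + h *\<^sub>R p)"
    using m(1) unfolding stereo_covector_inv_def \<eta> m(3) by (simp add: field_simps)
  have "p \<bullet> stereo_covector_inv p \<eta> = h"
    unfolding x using m(1) by (simp add: inner_add_right pv m(2) field_simps)
  then show ?thesis
    using m(1) unfolding stereo_covector_def m_def[symmetric] x by (simp add: \<eta>)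
qed

lemma range_stereo_covector: "range (stereo_covector p) = cotangent_space (inv_stereo p)"
proof (intro subset_antisym subsetI)
  fix \<eta> assume "\<eta> \<in> cotangent_space (inv_stereo p)"
  from stereo_covector_inv_right[OF this] show "\<eta> \<in> range (stereo_covector p)" by (metis rangeI)
qed (auto intro: stereo_covector_in_cotangent_space)

lemma one_minus_snd_inv_stereo: "1 - snd (inv_stereo p) = 2 / (1 + (norm p)\<^sup>2)"
proof -
  have "1 + (norm p)\<^sup>2 > 0" by (simp add: add_pos_nonneg)
  then show ?thesis by (simp add: inv_stereo_def field_simps)
qed

lemma snd_inv_stereo_neq_1: "snd (inv_stereo p) \<noteq> 1"
proof -
  have "1 + (norm p)\<^sup>2 > 0" by (simp add: add_pos_nonneg)
  then show ?thesis using one_minus_snd_inv_stereo[of p] by auto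
qed

text \<open>Continuity is asked for at one point because it will be applied to a map built from
  \<open>stereo\<close>, which breaks down at the north pole.\<close>

lemma isCont_closure_image:
  fixes f :: "'a::metric_space \<Rightarrow> 'b::metric_space"
  assumes "isCont f x" "x \<in> closure S"
  shows "f x \<in> closure (f ` S)"
proof -
  from assms(2) obtain s where "\<And>n. s n \<in> S" "s \<longlonglongrightarrow> x"
    unfolding closure_sequential by auto
  with isCont_tendsto_compose[OF assms(1) this(2)] show ?thesis
    unfolding closure_sequential by (intro exI[of _ "\<lambda>n. f (s n)"]) auto
qed

definition stereo :: "(real^2) \<times> real \<Rightarrow> real^2" where
  "stereo \<xi> = (1 / (1 - snd \<xi>)) *\<^sub>R fst \<xi>"

lemma stereo_inv_stereo: "stereo (inv_stereo p) = p"
proof -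
  have "1 + (norm p)\<^sup>2 \<noteq> 0" by (smt (verit) zero_le_power2)
  then have "1 / (2 / (1 + (norm p)\<^sup>2)) * (2 / (1 + (norm p)\<^sup>2)) = 1" by simp
  moreover have "stereo (inv_stereo p) = (1 / (2 / (1 + (norm p)\<^sup>2))) *\<^sub>R (2 / (1 + (norm p)\<^sup>2)) *\<^sub>R p"
    unfolding stereo_def one_minus_snd_inv_stereo unfolding inv_stereo_def fst_conv ..
  ultimately show ?thesis by (simp only: scaleR_scaleR scaleR_one)
qed

lemma inv_stereo_stereo:
  assumes "\<xi> \<in> sphere 0 1" "\<xi> \<noteq> (0, 1)"
  shows "inv_stereo (stereo \<xi>) = \<xi>"
proof -
  obtain x z where \<xi>: "\<xi> = (x, z)" by (cases \<xi>)
  have "(norm \<xi>)\<^sup>2 = 1" using assms by simp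
  then have s: "(norm x)\<^sup>2 + z\<^sup>2 = 1" by (simp add: \<xi> norm_prod_def)
  have z: "z \<noteq> 1" using s assms(2) by (auto simp: \<xi>)
  have n: "(norm x)\<^sup>2 = (1 - z) * (1 + z)" using s by (simp add: power2_eq_square algebra_simps)
  have np: "(norm (stereo \<xi>))\<^sup>2 = (1 + z) / (1 - z)"
    using z by (simp add: stereo_def \<xi> power_divide n) (simp add: power2_eq_square)
  have e: "1 + (1 + z) / (1 - z) = 2 / (1 - z)" "(1 + z) / (1 - z) - 1 = 2 * z / (1 - z)"
    using z by (simp_all add: field_simps)
  show ?thesis unfolding inv_stereo_def np e using z by (simp add: stereo_def \<xi>)
qed

context two_centers
begin

definition inner_regularized :: "real \<Rightarrow> (((real^2) \<times> real) \<times> ((real^2) \<times> real)) set" where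
  "inner_regularized c = cotangent_sphere \<inter> closure (moser_map a ` inner_surface c)"

text \<open>Over a finite momentum the closure adds nothing: \<open>\<Phi>\<close> inverts the Moser
  map and is continuous near this fiber, and it brings limit points back into the closed set
  \<open>inner_surface c\<close>.\<close>

lemma fiber_inv_stereo:
  "{\<eta>. (inv_stereo p, \<eta>) \<in> inner_regularized c} =
     stereo_covector p ` {x. (a + x, p) \<in> inner_surface c}"
proof (intro subset_antisym subsetI)
  fix \<eta> assume "\<eta> \<in> stereo_covector p ` {x. (a + x, p) \<in> inner_surface c}"
  then obtain x where x: "(a + x, p) \<in> inner_surface c" "\<eta> = stereo_covector p x" by auto
  then have "(inv_stereo p, \<eta>) = moser_map a (a + x, p)" by (simp add: moser_map_def)
  with x have "(inv_stereo p, \<eta>) \<in> closure (moser_map a ` inner_surface c)"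
    by (metis closure_subset image_eqI subsetD)
  with x show "\<eta> \<in> {\<eta>. (inv_stereo p, \<eta>) \<in> inner_regularized c}"
    using stereo_covector_in_cotangent_space inv_stereo_in_sphere
    by (auto simp: inner_regularized_def cotangent_sphere_def simp del: mem_sphere_0)
next
  fix \<eta> assume "\<eta> \<in> {\<eta>. (inv_stereo p, \<eta>) \<in> inner_regularized c}"
  then have \<eta>: "\<eta> \<in> cotangent_space (inv_stereo p)"
    and cl: "(inv_stereo p, \<eta>) \<in> closure (moser_map a ` inner_surface c)"
    by (auto simp: inner_regularized_def cotangent_sphere_def)
  define \<Phi> where "\<Phi> = (\<lambda>y::((real^2) \<times> real) \<times> ((real^2) \<times> real).
    (a + stereo_covector_inv (stereo (fst y)) (snd y), stereo (fst y)))"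
  have "isCont \<Phi> (inv_stereo p, \<eta>)"
  proof -
    have "1 - snd (inv_stereo p) \<noteq> 0" using snd_inv_stereo_neq_1[of p] by simp
    moreover have "1 + (norm (stereo (inv_stereo p)))\<^sup>2 \<noteq> 0"
      by (smt (verit) zero_le_power2)
    ultimately show ?thesis
      unfolding \<Phi>_def stereo_covector_inv_def stereo_def by (intro continuous_intros) auto
  qed
  moreover have "\<Phi> (moser_map a y) = y" for y
    by (cases y) (simp add: \<Phi>_def moser_map_def stereo_inv_stereo stereo_covector_inv_left)
  then have "\<Phi> ` moser_map a ` inner_surface c = inner_surface c" by (simp add: image_image)
  ultimately have "\<Phi> (inv_stereo p, \<eta>) \<in> closure (inner_surface c)"
    using isCont_closure_image[OF _ cl] by metis
  then have "(a + stereo_covector_inv p \<eta>, p) \<in> inner_surface c"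
    using closed_inner_surface by (simp add: \<Phi>_def stereo_inv_stereo)
  moreover have "\<eta> = stereo_covector p (stereo_covector_inv p \<eta>)"
    using stereo_covector_inv_right[OF \<eta>] by simp
  ultimately show "\<eta> \<in> stereo_covector p ` {x. (a + x, p) \<in> inner_surface c}" by blast
qed

text \<open>The equation \<open>W q * (|p|\<^sup>2 / 2 - c) = 1\<close> written in terms of the covector \<open>\<eta>\<close> and of
  \<open>\<tau> = 1 - z\<close>, where \<open>z\<close> is the height on the sphere; unlike the original, it has a limit for
  \<open>\<tau> \<rightarrow> 0\<close>.\<close>
lemma inner_surface_blowup:
  assumes "(q, p) \<in> inner_surface c"
  defines "\<tau> \<equiv> 1 - snd (inv_stereo p)" and "n \<equiv> norm (stereo_covector p (q - a))"
  shows "norm (q - a) = \<tau> * n"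
    and "n * norm (q - b) * (1 - \<tau> * (1 / 2 + c)) = \<alpha> * norm (q - b) + \<beta> * (\<tau> * n)"
proof -
  have u: "1 + (norm p)\<^sup>2 > 0" by (simp add: add_pos_nonneg)
  have \<tau>: "\<tau> = 2 / (1 + (norm p)\<^sup>2)" "0 < \<tau>"
    using u by (simp_all add: \<tau>_def one_minus_snd_inv_stereo)
  show r: "norm (q - a) = \<tau> * n"
    using u by (simp add: \<tau>(1) n_def norm_stereo_covector)
  have p: "(norm p)\<^sup>2 / 2 = 1 / \<tau> - 1 / 2" using u by (simp add: \<tau>(1) field_simps)
  have "norm (q - a) * norm (q - b) * ((norm p)\<^sup>2 / 2 - c) = \<alpha> * norm (q - b) + \<beta> * norm (q - a)"
    using assms(1) W_denominator_pos[of q] by (simp add: inner_surface_def W_def field_simps)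
  then have "(\<tau> * n) * norm (q - b) * (1 / \<tau> - 1 / 2 - c) = \<alpha> * norm (q - b) + \<beta> * (\<tau> * n)"
    by (simp add: r p)
  moreover have "(\<tau> * n) * norm (q - b) * (1 / \<tau> - 1 / 2 - c) = n * norm (q - b) * (1 - \<tau> * (1 / 2 + c))"
    using \<tau>(2) by (simp add: field_simps)
  ultimately show "n * norm (q - b) * (1 - \<tau> * (1 / 2 + c)) = \<alpha> * norm (q - b) + \<beta> * (\<tau> * n)"
    by simp
qed

section \<open>The fiber over the point at infinity\<close>

lemma tendsto_norm_b:
  assumes "(\<lambda>i. norm (q i - a)) \<longlonglongrightarrow> 0"
  shows "(\<lambda>i. norm (q i - b)) \<longlonglongrightarrow> 1"
proof (rule tendsto_sandwich)
  show "\<forall>\<^sub>F i in sequentially. 1 - norm (q i - a) \<le> norm (q i - b)"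
    by (intro always_eventually allI norm_diff_b_ge)
  show "\<forall>\<^sub>F i in sequentially. norm (q i - b) \<le> 1 + norm (q i - a)"
    by (intro always_eventually allI norm_diff_b_le)
  show "(\<lambda>i. 1 - norm (q i - a)) \<longlonglongrightarrow> 1"
    using tendsto_diff[OF tendsto_const assms, of 1] by simp
  show "(\<lambda>i. 1 + norm (q i - a)) \<longlonglongrightarrow> 1"
    using tendsto_add[OF tendsto_const assms, of 1] by simp
qed

text \<open>Approaching the pole means \<open>\<tau> \<longlonglongrightarrow> 0\<close>. Since
  \<open>n\<close> converges, \<open>q\<close> tends to \<open>a\<close> and \<open>|q - b|\<close>
  to 1, and the blown-up energy equation becomes \<open>|\<eta>| = \<alpha>\<close> in the
  limit.\<close>

lemma fiber_north_subset:
  assumes "((0, 1), \<eta>) \<in> closure (moser_map a ` inner_surface c)"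
  shows "norm \<eta> = \<alpha>"
proof -
  obtain f where f: "\<And>i. f i \<in> moser_map a ` inner_surface c" "f \<longlonglongrightarrow> ((0, 1), \<eta>)"
    using assms unfolding closure_sequential by auto
  from f(1) have "\<forall>i. \<exists>qp. qp \<in> inner_surface c \<and> f i = moser_map a qp" by blast
  then obtain g where g: "\<And>i. g i \<in> inner_surface c" "\<And>i. f i = moser_map a (g i)" by metis
  define q p where "q i = fst (g i)" and "p i = snd (g i)" for i
  have qp: "(q i, p i) \<in> inner_surface c" for i using g(1)[of i] by (simp add: q_def p_def)
  have fi: "f i = (inv_stereo (p i), stereo_covector (p i) (q i - a))" for i
    unfolding g(2) by (simp add: moser_map_def q_def p_def case_prod_unfold)
  define \<tau> n where "\<tau> i = 1 - snd (inv_stereo (p i))"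
    and "n i = norm (stereo_covector (p i) (q i - a))" for i
  note blow = inner_surface_blowup[OF qp, folded \<tau>_def n_def]
  have "(\<lambda>i. 1 - snd (fst (f i))) \<longlonglongrightarrow> 1 - snd (fst ((0::real^2, 1::real), \<eta>))"
    by (intro tendsto_intros f)
  then have \<tau>: "\<tau> \<longlonglongrightarrow> 0" by (simp add: fi \<tau>_def[abs_def])
  have "(\<lambda>i. norm (snd (f i))) \<longlonglongrightarrow> norm (snd ((0::real^2, 1::real), \<eta>))"
    by (intro tendsto_intros f)
  then have n: "n \<longlonglongrightarrow> norm \<eta>" by (simp add: fi n_def[abs_def])
  have "(\<lambda>i. norm (q i - a)) \<longlonglongrightarrow> 0"
    unfolding blow(1) using tendsto_mult[OF \<tau> n] by simp
  then have b: "(\<lambda>i. norm (q i - b)) \<longlonglongrightarrow> 1" by (rule tendsto_norm_b)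
  have "(\<lambda>i. n i * norm (q i - b) * (1 - \<tau> i * (1 / 2 + c))) \<longlonglongrightarrow> norm \<eta> * 1 * (1 - 0 * (1 / 2 + c))"
    by (intro tendsto_intros n b \<tau>)
  moreover have "(\<lambda>i. \<alpha> * norm (q i - b) + \<beta> * (\<tau> i * n i)) \<longlonglongrightarrow> \<alpha> * 1 + \<beta> * (0 * norm \<eta>)"
    by (intro tendsto_intros n b \<tau>)
  ultimately show ?thesis unfolding blow(2) using LIMSEQ_unique by fastforce
qed

lemma inner_surface_on_ray:
  assumes c: "c < - critical_value" and u: "norm u = 1"
  obtains s where "0 < s" "(a + s *\<^sub>R u, p) \<in> inner_surface c"
proof -
  define k where "k = (norm p)\<^sup>2 / 2 - c"
  have k: "critical_value < k" using c by (simp add: k_def) (smt (verit) zero_le_power2 divide_nonneg_pos)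
  have "continuous_on {0..critical_radius} (\<lambda>s. W (a + s *\<^sub>R u) * k)"
    by (intro continuous_intros continuous_on_compose2[OF continuous_on_W[of UNIV]]) auto
  moreover have "1 < W (a + critical_radius *\<^sub>R u) * k"
    using W_critical_circle[OF _ k, of "a + critical_radius *\<^sub>R u"] u critical_radius_pos by simp
  ultimately obtain s where s: "0 \<le> s" "s \<le> critical_radius" "W (a + s *\<^sub>R u) * k = 1"
    using IVT'[of "\<lambda>s. W (a + s *\<^sub>R u) * k" 0 1 critical_radius] critical_radius_pos by auto
  then have "s \<noteq> 0" by auto
  with s u show ?thesis by (intro that[of s]) (auto simp: inner_surface_def k_def)
qed

text \<open>Let the momentum go to infinity orthogonally to \<open>v\<close>, with the position on
  the ray from \<open>a\<close> in direction \<open>v\<close>. Then \<open>p\<close> is orthogonal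
  to the position, so the covector is a multiple \<open>n\<close> of the unit vector
  \<open>u\<close> with height 0, and it remains to show
  \<open>n \<longlonglongrightarrow> \<alpha>\<close>.\<close>

lemma fiber_north_superset:
  assumes c: "c < - critical_value" and v: "norm v = \<alpha>"
  shows "((0, 1), (v, 0)) \<in> closure (moser_map a ` inner_surface c)"
proof -
  define u where "u = (1 / \<alpha>) *\<^sub>R v"
  have u: "norm u = 1" "\<alpha> *\<^sub>R u = v" using v \<alpha>_pos by (simp_all add: u_def)
  \<comment> \<open>The quarter turn of \<open>u\<close>, the direction of the momenta.\<close>
  define w :: "real^2" where "w = vector [- u $ 2, u $ 1]"
  have wu: "w \<bullet> u = 0" by (simp add: w_def inner_vec_def sum_2)
  have "w \<bullet> w = u \<bullet> u" by (simp add: w_def inner_vec_def sum_2)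
  then have w: "norm w = 1" using u by (simp add: norm_eq_sqrt_inner)
  define p where "p i = real i *\<^sub>R w" for i
  have np: "norm (p i) = real i" for i by (simp add: p_def w)
  have "\<forall>i. \<exists>s>0. (a + s *\<^sub>R u, p i) \<in> inner_surface c"
    using inner_surface_on_ray[OF c u(1)] by metis
  then obtain s where s: "\<And>i. 0 < s i" "\<And>i. (a + s i *\<^sub>R u, p i) \<in> inner_surface c" by metis
  define \<tau> n where "\<tau> i = 1 - snd (inv_stereo (p i))"
    and "n i = norm (stereo_covector (p i) (a + s i *\<^sub>R u - a))" for i
  note blow = inner_surface_blowup[OF s(2), folded \<tau>_def n_def]
  have \<tau>eq: "\<tau> i = 2 / (1 + (real i)\<^sup>2)" for i by (simp add: \<tau>_def one_minus_snd_inv_stereo np)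
  have \<tau>: "\<tau> \<longlonglongrightarrow> 0" unfolding \<tau>eq by real_asymp
  have st: "s i = \<tau> i * n i" for i using blow(1)[of i] s(1)[of i] u by simp
  have cov: "stereo_covector (p i) (s i *\<^sub>R u) = (n i *\<^sub>R u, 0)" for i
  proof -
    have "1 + (real i)\<^sup>2 > 0" by (simp add: add_pos_nonneg)
    then have "(1 + (real i)\<^sup>2) / 2 * s i = n i" unfolding st \<tau>eq by simp
    then show ?thesis unfolding stereo_covector_def np by (simp add: p_def wu)
  qed
  define \<rho> where "\<rho> i = norm (a + s i *\<^sub>R u - b)" for i
  have \<tau>_nonneg: "0 \<le> \<tau> i" for i by (simp add: \<tau>eq)
  have fac: "1 \<le> 1 - \<tau> i * (1 / 2 + c)" for i
    using mult_nonneg_nonpos[OF \<tau>_nonneg[of i], of "1 / 2 + c"] c critical_value_ge_1 by linarith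
  have rad: "s i \<le> critical_radius" for i
    using s(1)[of i] s(2)[of i] u by (simp add: inner_surface_def)
  have \<rho>: "1 - critical_radius \<le> \<rho> i" "0 < \<rho> i" for i
  proof -
    have "norm (a + s i *\<^sub>R u - a) = s i" using s(1)[of i] u(1) by simp
    then show 1: "1 - critical_radius \<le> \<rho> i"
      using norm_diff_b_ge[of "a + s i *\<^sub>R u"] rad[of i] unfolding \<rho>_def by linarith
    show "0 < \<rho> i" using 1 critical_radius_less_1 by linarith
  qed
  have n_eq: "n i = (\<alpha> + \<beta> * s i / \<rho> i) / (1 - \<tau> i * (1 / 2 + c))" for i
  proof -
    have "n i * (1 - \<tau> i * (1 / 2 + c)) = \<alpha> + \<beta> * s i / \<rho> i"
    proof -
      have "n i * \<rho> i * (1 - \<tau> i * (1 / 2 + c)) = \<alpha> * \<rho> i + \<beta> * s i"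
        using blow(2)[of i] by (simp only: st[of i] \<rho>_def)
      then have "(n i * (1 - \<tau> i * (1 / 2 + c))) * \<rho> i = \<alpha> * \<rho> i + \<beta> * s i"
        by (simp only: mult_ac)
      then have "n i * (1 - \<tau> i * (1 / 2 + c)) = (\<alpha> * \<rho> i + \<beta> * s i) / \<rho> i"
        using \<rho>(2)[of i] by (intro eq_divide_imp) simp_all
      then show ?thesis using \<rho>(2)[of i] by (simp add: add_divide_distrib)
    qed
    then show ?thesis using fac[of i] by (simp add: eq_divide_eq)
  qed
  \<comment> \<open>A bound for \<open>n\<close> comes first: the right side of \<open>n_eq\<close>
    contains \<open>s = \<tau> n\<close>, which must be known to tend to 0 before the limit of
    \<open>n\<close> can be read off.\<close>
  define B where "B = \<alpha> + \<beta> * critical_radius / (1 - critical_radius)"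
  have nB: "n i \<le> B" for i
  proof -
    have "\<beta> * s i / \<rho> i \<le> \<beta> * critical_radius / (1 - critical_radius)"
      using \<rho>[of i] rad[of i] s(1)[of i] \<beta>_pos critical_radius_pos critical_radius_less_1
      by (intro frac_le mult_left_mono mult_nonneg_nonneg) auto
    moreover have "0 \<le> \<beta> * s i / \<rho> i" using \<rho>(2)[of i] s(1)[of i] \<beta>_pos by simp
    ultimately have "n i \<le> (\<alpha> + \<beta> * critical_radius / (1 - critical_radius)) / 1"
      unfolding n_eq using fac[of i] \<alpha>_pos by (intro frac_le) auto
    then show ?thesis by (simp add: B_def)
  qed
  have s0: "s \<longlonglongrightarrow> 0"
  proof (rule tendsto_sandwich)
    show "\<forall>\<^sub>F i in sequentially. 0 \<le> s i" using s(1) by (simp add: less_imp_le)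
    show "\<forall>\<^sub>F i in sequentially. s i \<le> \<tau> i * B"
      using nB \<tau>_nonneg by (simp add: st mult_left_mono)
    show "(\<lambda>i. \<tau> i * B) \<longlonglongrightarrow> 0" using tendsto_mult_right[OF \<tau>, of B] by simp
  qed simp
  have "norm (a + s i *\<^sub>R u - a) = s i" for i using s(1)[of i] u(1) by simp
  then have "\<rho> \<longlonglongrightarrow> 1"
    unfolding \<rho>_def using s0 by (intro tendsto_norm_b) presburger
  have "(\<lambda>i. (\<alpha> + \<beta> * s i / \<rho> i) / (1 - \<tau> i * (1 / 2 + c)))
      \<longlonglongrightarrow> (\<alpha> + \<beta> * 0 / 1) / (1 - 0 * (1 / 2 + c))"
    by (intro tendsto_intros s0 \<tau> \<open>\<rho> \<longlonglongrightarrow> 1\<close>) simp_all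
  moreover have "(\<lambda>i. (\<alpha> + \<beta> * s i / \<rho> i) / (1 - \<tau> i * (1 / 2 + c))) = n"
    by (intro ext) (rule n_eq[symmetric])
  ultimately have n: "n \<longlonglongrightarrow> \<alpha>" by simp
  have "inv_stereo (p i) = ((2 / (1 + (real i)\<^sup>2) * real i) *\<^sub>R w, 1 - \<tau> i)" for i
  proof (rule prod_eqI)
    show "fst (inv_stereo (p i)) = fst ((2 / (1 + (real i)\<^sup>2) * real i) *\<^sub>R w, 1 - \<tau> i)"
      unfolding inv_stereo_def np by (simp add: p_def)
  qed (simp add: \<tau>_def)
  then have "moser_map a (a + s i *\<^sub>R u, p i)
      = (((2 / (1 + (real i)\<^sup>2) * real i) *\<^sub>R w, 1 - \<tau> i), (n i *\<^sub>R u, 0))" for i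
    by (simp add: moser_map_def cov)
  moreover have "(\<lambda>i. 2 / (1 + (real i)\<^sup>2) * real i) \<longlonglongrightarrow> 0" by real_asymp
  then have "(\<lambda>i. (((2 / (1 + (real i)\<^sup>2) * real i) *\<^sub>R w, 1 - \<tau> i), (n i *\<^sub>R u, 0::real)))
      \<longlonglongrightarrow> ((0 *\<^sub>R w, 1 - 0), (\<alpha> *\<^sub>R u, 0))"
    by (intro tendsto_intros n \<tau>)
  ultimately have "(\<lambda>i. moser_map a (a + s i *\<^sub>R u, p i)) \<longlonglongrightarrow> ((0, 1), (v, 0))"
    by (simp add: u(2))
  then show ?thesis using s(2) unfolding closure_sequential
    by (intro exI[of _ "\<lambda>i. moser_map a (a + s i *\<^sub>R u, p i)"]) auto
qed

end

section \<open>Unequal masses\<close>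

text \<open>Along a ray of slope \<open>m\<close> from the saddle, the normalized squared distances
  to the centers have the form under the roots, with \<open>c = 1 + m^2\<close>. The quadratic
  coefficient \<open>(3 - c) / 2\<close> vanishes for \<open>m^2 = 2\<close>, and there the cubic
  coefficient decides.\<close>

lemma inv_sqrt_expansion:
  fixes c :: real
  shows "((\<lambda>s. (1 / sqrt (1 - 2 * s + c * s\<^sup>2) - 1 - s) / s\<^sup>2) \<longlongrightarrow> (3 - c) / 2) (at_right 0)"
    and "((\<lambda>s. (1 / sqrt (1 + 2 * s + c * s\<^sup>2) - 1 + s) / s\<^sup>2) \<longlongrightarrow> (3 - c) / 2) (at_right 0)"
    and "((\<lambda>s::real. (1 / sqrt (1 - 2 * s + 3 * s\<^sup>2) - 1 - s) / s ^ 3) \<longlongrightarrow> - 2) (at_right 0)"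
    and "((\<lambda>s::real. (1 / sqrt (1 + 2 * s + 3 * s\<^sup>2) - 1 + s) / s ^ 3) \<longlongrightarrow> 2) (at_right 0)"
  by real_asymp+

text \<open>A boundary point strictly between two others would lie in the domain, which is disjoint
  from its boundary curve \<open>F\<close>.\<close>

lemma not_bounds_strictly_convex_domain:
  assumes "x \<in> F" "y \<in> F" "z \<in> F" "y \<in> open_segment x z"
  shows "\<not> bounds_strictly_convex_domain P F"
proof
  assume "bounds_strictly_convex_domain P F"
  then obtain D where "strictly_convex_domain P D" "F = closure D - D"
    by (auto simp: bounds_strictly_convex_domain_def)
  moreover from this assms have "x \<noteq> z" "x \<in> closure D" "z \<in> closure D" "y \<notin> D"
    by (auto simp: open_segment_idem)
  ultimately show False
    using assms(4) unfolding strictly_convex_domain_def by blast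
qed

context two_centers
begin

text \<open>Coordinates in the orthonormal basis of \<open>b - a\<close> and its quarter turn. Being
  relative to \<open>b - a\<close>, they serve both choices of the near center.\<close>

definition frame :: "real \<Rightarrow> real \<Rightarrow> real^2" where
  "frame x y = x *\<^sub>R (b - a) + y *\<^sub>R vector [- (b - a) $ 2, (b - a) $ 1]"

lemma unit_axis: "((b - a) $ 1)\<^sup>2 + ((b - a) $ 2)\<^sup>2 = 1"
proof -
  have "(norm (b - a))\<^sup>2 = ((b - a) $ 1)\<^sup>2 + ((b - a) $ 2)\<^sup>2"
    unfolding power2_norm_eq_inner by (simp add: inner_vec_def sum_2 power2_eq_square)
  then show ?thesis using dist_centers by simp
qed

lemma norm_frame: "norm (frame x y) = sqrt (x\<^sup>2 + y\<^sup>2)"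
proof -
  define f1 f2 where "f1 = (b - a) $ 1" and "f2 = (b - a) $ 2"
  have f: "f1\<^sup>2 + f2\<^sup>2 = 1" using unit_axis by (simp add: f1_def f2_def)
  have "frame x y \<bullet> frame x y = (x * f1 - y * f2)\<^sup>2 + (x * f2 + y * f1)\<^sup>2"
    unfolding inner_vec_def sum_2 frame_def vector_add_component vector_scaleR_component
    unfolding f1_def[symmetric] f2_def[symmetric] by (simp add: power2_eq_square)
  also have "\<dots> = (x\<^sup>2 + y\<^sup>2) * (f1\<^sup>2 + f2\<^sup>2)" by (simp add: power2_eq_square algebra_simps)
  finally show ?thesis using f by (simp add: norm_eq_sqrt_inner)
qed

lemma frame_minus_axis: "a + frame x y - b = frame (x - 1) y"
  by (simp add: frame_def algebra_simps)

lemma frame_diff: "frame x y - frame x' y' = frame (x - x') (y - y')"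
  and frame_add: "frame x y + frame x' y' = frame (x + x') (y + y')"
  and frame_scaleR: "s *\<^sub>R frame x y = frame (s * x) (s * y)"
  by (simp_all add: frame_def algebra_simps)

lemma norm_frame_a: "norm (a + frame x y - a) = sqrt (x\<^sup>2 + y\<^sup>2)"
  by (simp add: norm_frame)

lemma norm_frame_b: "norm (a + frame x y - b) = sqrt ((x - 1)\<^sup>2 + y\<^sup>2)"
  by (simp add: frame_minus_axis norm_frame)

lemma continuous_on_frame [continuous_intros]:
  "continuous_on S f \<Longrightarrow> continuous_on S g \<Longrightarrow> continuous_on S (\<lambda>t. frame (f t) (g t))"
  unfolding frame_def by (intro continuous_intros)

lemma isCont_W_compose:
  "isCont f t \<Longrightarrow> isCont (\<lambda>t. W (f t)) t"
  using continuous_on_W[of UNIV] by (auto simp: continuous_on_eq_continuous_at intro: isCont_o2)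

text \<open>\<open>S + t (-1, m)\<close> in coordinates, where \<open>S\<close> is the saddle and the axis points from \<open>a\<close> to \<open>b\<close>.\<close>
definition ray :: "real \<Rightarrow> real \<Rightarrow> real^2" where
  "ray m t = a + frame (critical_radius - t) (m * t)"

text \<open>The terms \<open>- s\<close> and \<open>+ s'\<close> can be inserted because the balance
  of attractions makes their contributions cancel. They turn the two brackets into remainders of
  first-order Taylor expansions.\<close>

lemma V_ray:
  assumes t: "0 < t"
  defines "s \<equiv> t / critical_radius" and "s' \<equiv> t / (1 - critical_radius)"
  shows "V (ray m t) - critical_value =
    \<alpha> / critical_radius * (1 / sqrt (1 - 2 * s + (1 + m\<^sup>2) * s\<^sup>2) - 1 - s) +
    \<beta> / (1 - critical_radius) * (1 / sqrt (1 + 2 * s' + (1 + m\<^sup>2) * s'\<^sup>2) - 1 + s')"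
proof -
  let ?l = critical_radius
  define l' where "l' = 1 - ?l"
  have l: "0 < ?l" "0 < l'" using critical_radius_pos critical_radius_less_1 by (auto simp: l'_def)
  have t_eq: "t = ?l * s" "t = l' * s'" using l by (simp_all add: s_def s'_def flip: l'_def)
  have "(?l - t)\<^sup>2 + (m * t)\<^sup>2 = ?l\<^sup>2 * (1 - 2 * s + (1 + m\<^sup>2) * s\<^sup>2)"
    unfolding t_eq(1) by (simp add: power2_eq_square algebra_simps)
  then have "norm (ray m t - a) = ?l * sqrt (1 - 2 * s + (1 + m\<^sup>2) * s\<^sup>2)"
    using l unfolding ray_def norm_frame_a by (simp add: real_sqrt_mult)
  moreover have "(?l - t - 1)\<^sup>2 + (m * t)\<^sup>2 = (l' + t)\<^sup>2 + (m * t)\<^sup>2"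
    unfolding l'_def by (simp add: power2_eq_square algebra_simps)
  moreover have "\<dots> = l'\<^sup>2 * (1 + 2 * s' + (1 + m\<^sup>2) * s'\<^sup>2)"
    unfolding t_eq(2) by (simp add: power2_eq_square algebra_simps)
  ultimately have n: "norm (ray m t - a) = ?l * sqrt (1 - 2 * s + (1 + m\<^sup>2) * s\<^sup>2)"
    "norm (ray m t - b) = l' * sqrt (1 + 2 * s' + (1 + m\<^sup>2) * s'\<^sup>2)"
    using l unfolding ray_def norm_frame_b by (simp_all add: real_sqrt_mult)
  have "\<alpha> / ?l * s = \<alpha> * t / ?l\<^sup>2" by (simp add: s_def power2_eq_square)
  also have "\<dots> = \<beta> * t / l'\<^sup>2"
    using critical_radius_balance l by (simp add: divide_simps l'_def)
  also have "\<dots> = \<beta> / l' * s'" by (simp add: s'_def l'_def power2_eq_square)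
  finally have bal: "\<alpha> / ?l * s = \<beta> / l' * s'" .
  show ?thesis
    unfolding V_def n critical_value_eq' l'_def[symmetric]
    using bal by (simp add: right_diff_distrib distrib_left)
qed

lemma filterlim_divide_at_right_0:
  "0 < (d::real) \<Longrightarrow> filterlim (\<lambda>t. t / d) (at_right 0) (at_right 0)"
  by (rule filterlim_times_pos[of _ _ _ "1 / d", simplified]) (auto simp: filterlim_ident)

text \<open>Both quadratic coefficients are positive multiples of \<open>2 - m^2\<close>, so on rays
  steeper than \<open>sqrt 2\<close> the leading term of \<open>V\<close> is negative.\<close>

lemma eventually_V_ray_less:
  assumes "2 < m\<^sup>2"
  shows "\<forall>\<^sub>F t in at_right 0. V (ray m t) < critical_value"
proof -
  let ?l = critical_radius
  let ?l' = "1 - critical_radius"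
  have l: "0 < ?l" "0 < ?l'" using critical_radius_pos critical_radius_less_1 by auto
  let ?L = "\<alpha> / ?l * (((3 - (1 + m\<^sup>2)) / 2) * (1 / ?l\<^sup>2)) + \<beta> / ?l' * (((3 - (1 + m\<^sup>2)) / 2) * (1 / ?l'\<^sup>2))"
  note A = filterlim_compose[OF inv_sqrt_expansion(1)[of "1 + m\<^sup>2"] filterlim_divide_at_right_0[OF l(1)]]
  note B = filterlim_compose[OF inv_sqrt_expansion(2)[of "1 + m\<^sup>2"] filterlim_divide_at_right_0[OF l(2)]]
  have "((\<lambda>t. (V (ray m t) - critical_value) / t\<^sup>2) \<longlongrightarrow> ?L) (at_right 0)"
  proof (rule Lim_transform_eventually)
    show "((\<lambda>t. \<alpha> / ?l * ((1 / sqrt (1 - 2 * (t / ?l) + (1 + m\<^sup>2) * (t / ?l)\<^sup>2) - 1 - t / ?l) / (t / ?l)\<^sup>2 * (1 / ?l\<^sup>2))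
      + \<beta> / ?l' * ((1 / sqrt (1 + 2 * (t / ?l') + (1 + m\<^sup>2) * (t / ?l')\<^sup>2) - 1 + t / ?l') / (t / ?l')\<^sup>2 * (1 / ?l'\<^sup>2))) \<longlongrightarrow> ?L) (at_right 0)"
      by (intro tendsto_intros A B)
    have e: "X / (t / d)\<^sup>2 * (1 / d\<^sup>2) = X / t\<^sup>2" if "0 < d" for X t d :: real
      using that by (simp add: power_divide)
    have h: "(x * X + y * Y) / z = x * (X / z) + y * (Y / z)" for x X y Y z :: real
      by (simp add: add_divide_distrib)
    show "\<forall>\<^sub>F t in at_right 0. \<alpha> / ?l * ((1 / sqrt (1 - 2 * (t / ?l) + (1 + m\<^sup>2) * (t / ?l)\<^sup>2) - 1 - t / ?l) / (t / ?l)\<^sup>2 * (1 / ?l\<^sup>2))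
      + \<beta> / ?l' * ((1 / sqrt (1 + 2 * (t / ?l') + (1 + m\<^sup>2) * (t / ?l')\<^sup>2) - 1 + t / ?l') / (t / ?l')\<^sup>2 * (1 / ?l'\<^sup>2))
      = (V (ray m t) - critical_value) / t\<^sup>2"
      unfolding eventually_at_right_field e[OF l(1)] e[OF l(2)]
      by (intro exI[of _ 1] conjI allI impI) (simp_all only: V_ray h zero_less_one)
  qed
  moreover have "?L < 0"
    using assms l \<alpha>_pos \<beta>_pos by (intro add_neg_neg mult_pos_neg mult_neg_pos) auto
  ultimately have "\<forall>\<^sub>F t in at_right 0. (V (ray m t) - critical_value) / t\<^sup>2 < 0"
    by (rule order_tendstoD)
  then show ?thesis
    by (auto simp: divide_less_0_iff elim!: eventually_mono)
qed

text \<open>The level set crosses itself at the saddle with slopes \<open>\<plusminus>\<surd>2\<close>. In this direction the quadratic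
  term of \<open>V\<close> vanishes, and the cubic term is positive because the saddle is farther from \<open>a\<close>
  than from \<open>b\<close>.\<close>
lemma eventually_V_ray_greater:
  assumes "\<beta> < \<alpha>"
  shows "\<forall>\<^sub>F t in at_right 0. critical_value < V (ray (sqrt 2) t)"
proof -
  let ?l = critical_radius
  let ?l' = "1 - critical_radius"
  have l: "0 < ?l" "0 < ?l'" using critical_radius_pos critical_radius_less_1 by auto
  let ?L = "\<alpha> / ?l * (- 2 * (1 / ?l ^ 3)) + \<beta> / ?l' * (2 * (1 / ?l' ^ 3))"
  note A = filterlim_compose[OF inv_sqrt_expansion(3) filterlim_divide_at_right_0[OF l(1)]]
  note B = filterlim_compose[OF inv_sqrt_expansion(4) filterlim_divide_at_right_0[OF l(2)]]
  have "((\<lambda>t. (V (ray (sqrt 2) t) - critical_value) / t ^ 3) \<longlongrightarrow> ?L) (at_right 0)"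
  proof (rule Lim_transform_eventually)
    show "((\<lambda>t. \<alpha> / ?l * ((1 / sqrt (1 - 2 * (t / ?l) + 3 * (t / ?l)\<^sup>2) - 1 - t / ?l) / (t / ?l) ^ 3 * (1 / ?l ^ 3))
      + \<beta> / ?l' * ((1 / sqrt (1 + 2 * (t / ?l') + 3 * (t / ?l')\<^sup>2) - 1 + t / ?l') / (t / ?l') ^ 3 * (1 / ?l' ^ 3))) \<longlongrightarrow> ?L) (at_right 0)"
      by (intro tendsto_intros A B)
    have e: "X / (t / d) ^ 3 * (1 / d ^ 3) = X / t ^ 3" if "0 < d" for X t d :: real
      using that by (simp add: power_divide)
    have h: "(x * X + y * Y) / z = x * (X / z) + y * (Y / z)" for x X y Y z :: real
      by (simp add: add_divide_distrib)
    have 3: "1 + (sqrt 2)\<^sup>2 = (3::real)" by simp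
    show "\<forall>\<^sub>F t in at_right 0. \<alpha> / ?l * ((1 / sqrt (1 - 2 * (t / ?l) + 3 * (t / ?l)\<^sup>2) - 1 - t / ?l) / (t / ?l) ^ 3 * (1 / ?l ^ 3))
      + \<beta> / ?l' * ((1 / sqrt (1 + 2 * (t / ?l') + 3 * (t / ?l')\<^sup>2) - 1 + t / ?l') / (t / ?l') ^ 3 * (1 / ?l' ^ 3))
      = (V (ray (sqrt 2) t) - critical_value) / t ^ 3"
      unfolding eventually_at_right_field e[OF l(1)] e[OF l(2)]
      by (intro exI[of _ 1] conjI allI impI) (simp_all only: V_ray h 3 zero_less_one)
  qed
  \<comment> \<open>Balance gives \<open>\<alpha> / ?l^2 = \<beta> / ?l'^2\<close>. After factoring
    this out, the sign of the cubic coefficient is that of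
    \<open>1 / ?l'^2 - 1 / ?l^2\<close>.\<close>
  moreover have "0 < ?L"
  proof -
    have "sqrt \<beta> < sqrt \<alpha>" using assms by simp
    then have "?l' < ?l"
      unfolding one_minus_critical_radius unfolding critical_radius_def
      using \<alpha>_pos \<beta>_pos by (intro divide_strict_right_mono) (auto simp: add_pos_pos)
    then have "\<beta> * (1 / ?l\<^sup>2) < \<beta> * (1 / ?l'\<^sup>2)"
      using l \<beta>_pos by (intro mult_strict_left_mono) (auto intro!: frac_less2 power_strict_mono)
    have bal: "\<alpha> / ?l\<^sup>2 = \<beta> / ?l'\<^sup>2" using critical_radius_balance l by (simp add: field_simps)
    have "?L = 2 * (\<beta> / ?l'\<^sup>2 * (1 / ?l'\<^sup>2) - \<alpha> / ?l\<^sup>2 * (1 / ?l\<^sup>2))"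
      by (simp add: power2_eq_square power3_eq_cube mult_ac)
    also have "\<dots> = 2 * (\<beta> / ?l'\<^sup>2) * (1 / ?l'\<^sup>2 - 1 / ?l\<^sup>2)" unfolding bal by (simp add: algebra_simps)
    also have "\<dots> > 0"
      using \<open>?l' < ?l\<close> l \<beta>_pos by (intro mult_pos_pos) (auto intro!: frac_less2 power_strict_mono)
    finally show ?thesis .
  qed
  ultimately have "\<forall>\<^sub>F t in at_right 0. 0 < (V (ray (sqrt 2) t) - critical_value) / t ^ 3"
    by (rule order_tendstoD)
  moreover have "\<forall>\<^sub>F t::real in at_right 0. 0 < t" by (simp add: eventually_at_right_less)
  ultimately show ?thesis
    by eventually_elim (simp add: zero_less_divide_iff)
qed

end

lemma isCont_eventually_less_right:
  fixes f :: "real \<Rightarrow> real"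
  assumes "isCont f x" "f x < u"
  shows "\<forall>\<^sub>F y in at_right x. f y < u"
  using assms order_tendstoD(2)[of f "f x" "at_right x" u]
  by (simp add: isCont_def filterlim_at_split)

section \<open>Three collinear points in the fiber over zero momentum\<close>

context two_centers
begin

lemma W_times_less_1:
  assumes "critical_value < V q" "q \<noteq> b"
  shows "W q * critical_value < 1"
proof (cases "q = a")
  case False
  then show ?thesis using assms V_pos[OF False] by (simp add: W_eq_inverse_V)
qed simp

lemma W_times_greater_1:
  assumes "V q < critical_value" "q \<noteq> a" "q \<noteq> b"
  shows "1 < W q * critical_value"
  using assms V_pos[OF assms(2)] by (simp add: W_eq_inverse_V)

text \<open>\<open>B\<close> lies on a ray slightly steeper than \<open>\<surd>2\<close> and \<open>A\<close> on the axis next to the saddle; close to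
  the saddle the steeper ray runs outside of the sublevel set.\<close>
lemma nonconvex_at_critical_value:
  assumes "\<beta> < \<alpha>"
  obtains A B s where "norm (A - a) \<le> critical_radius" "norm (B - a) \<le> critical_radius"
    "0 < s" "s < 1" "W A * critical_value < 1" "W B * critical_value < 1"
    "1 < W (A + s *\<^sub>R (B - A)) * critical_value"
proof -
  let ?l = critical_radius
  have l: "0 < ?l" "?l < 1" by (rule critical_radius_pos critical_radius_less_1)+
  have "\<forall>\<^sub>F t in at_right 0. 0 < t \<and> t < 2 * ?l / 3 \<and> critical_value < V (ray (sqrt 2) t)"
    using eventually_V_ray_greater[OF assms] l
    by (intro eventually_conj eventually_at_right_less order_tendstoD(2)[OF tendsto_ident_at]) auto
  then obtain t where t: "0 < t" "t < 2 * ?l / 3" "critical_value < V (ray (sqrt 2) t)"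
    using eventually_happens'[OF trivial_limit_at_right_real] by blast
  have "norm (ray (sqrt 2) t - a) < ?l"
  proof -
    \<comment> \<open>For positive \<open>t\<close>, the bound \<open>t < 2 * ?l / 3\<close> says
      exactly that the ray of slope \<open>sqrt 2\<close> is inside the disc.\<close>
    have "t * (3 * t - 2 * ?l) < 0" using t by (intro mult_pos_neg) auto
    then have "(?l - t)\<^sup>2 + (sqrt 2 * t)\<^sup>2 < ?l\<^sup>2" by (simp add: power2_eq_square algebra_simps)
    then show ?thesis unfolding ray_def norm_frame_a
      using l real_sqrt_less_mono by fastforce
  qed
  moreover from this have "W (ray (sqrt 2) t) * critical_value < 1"
    using t(3) l in_disc_neq_b by (intro W_times_less_1) auto
  moreover have "continuous_on UNIV (\<lambda>m. ray m t)"
    unfolding ray_def by (intro continuous_intros)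
  then have c: "isCont (\<lambda>m. ray m t) m" for m by (simp add: continuous_on_eq_continuous_at)
  ultimately have "\<forall>\<^sub>F m in at_right (sqrt 2). sqrt 2 < m \<and> norm (ray m t - a) < ?l \<and> W (ray m t) * critical_value < 1"
    by (intro eventually_conj eventually_at_right_less
        isCont_eventually_less_right[where f = "\<lambda>m. norm (ray m t - a)"]
        isCont_eventually_less_right[where f = "\<lambda>m. W (ray m t) * critical_value"]
        continuous_intros isCont_W_compose c)
  \<comment> \<open>With \<open>t\<close> fixed, the far point tolerates a slightly larger slope,
    while the part of the steeper ray next to the saddle drops below the critical value.\<close>
  then obtain m where m: "sqrt 2 < m" "norm (ray m t - a) < ?l" "W (ray m t) * critical_value < 1"
    using eventually_happens'[OF trivial_limit_at_right_real] by blast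
  have m2: "2 < m\<^sup>2" using power_strict_mono[OF m(1), of 2] by simp
  have "0 < m" using m(1) by (meson less_trans real_sqrt_gt_0_iff zero_less_numeral)
  have "\<forall>\<^sub>F s in at_right 0. 0 < s \<and> s < t \<and> V (ray m s) < critical_value"
    using eventually_V_ray_less[OF m2] t(1)
    by (intro eventually_conj eventually_at_right_less order_tendstoD(2)[OF tendsto_ident_at]) auto
  then obtain s where s: "0 < s" "s < t" "V (ray m s) < critical_value"
    using eventually_happens'[OF trivial_limit_at_right_real] by blast
  have "norm (ray m s - a) \<noteq> 0" "norm (ray m s - b) \<noteq> 0"
    using \<open>0 < m\<close> s(1) unfolding ray_def norm_frame_a norm_frame_b by (auto simp: add_nonneg_eq_0_iff)
  then have W_s: "1 < W (ray m s) * critical_value"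
    using s(3) by (intro W_times_greater_1) auto
  \<comment> \<open>The saddle itself lies on the critical level. Moving it inward by
    \<open>d\<close> makes the inequality at this end strict; \<open>C d\<close> is the middle
    point, which for \<open>d = 0\<close> is \<open>ray m s\<close>.\<close>
  define A where "A d = a + frame (?l - d) 0" for d
  define C where "C d = A d + (s / t) *\<^sub>R (ray m t - A d)" for d
  have "C 0 = ray m s"
  proof -
    have "ray m t - A 0 = frame (- t) (m * t)" by (simp add: ray_def A_def frame_diff)
    then show ?thesis using t(1) by (simp add: C_def A_def ray_def frame_scaleR add.assoc frame_add mult.commute)
  qed
  moreover have "isCont (\<lambda>d. W (C d) * critical_value) 0"
  proof -
    have "continuous_on UNIV C" unfolding C_def A_def by (intro continuous_intros)
    then show ?thesis
      by (intro continuous_intros isCont_W_compose) (simp add: continuous_on_eq_continuous_at)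
  qed
  then have "isCont (\<lambda>d. - (W (C d) * critical_value)) 0" by (rule continuous_minus)
  ultimately have "\<forall>\<^sub>F d in at_right 0. 0 < d \<and> d < ?l \<and> - (W (C d) * critical_value) < - 1"
    using W_s l
    by (intro eventually_conj eventually_at_right_less order_tendstoD(2)[OF tendsto_ident_at]
        isCont_eventually_less_right[where f = "\<lambda>d. - (W (C d) * critical_value)"]) auto
  then obtain d where d': "0 < d" "d < ?l" "- (W (C d) * critical_value) < - 1"
    using eventually_happens'[OF trivial_limit_at_right_real] by blast
  then have d: "0 < d" "d < ?l" "1 < W (C d) * critical_value" by simp_all
  show ?thesis
  proof (rule that[of "A d" "ray m t" "s / t"])
    have S: "norm (A 0 - a) = ?l" using l unfolding A_def norm_frame_a by simp
    then have "A 0 \<noteq> a" "A 0 \<noteq> b" using l in_disc_neq_b by auto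
    have "norm (A 0 - b) = 1 - ?l" using l unfolding A_def norm_frame_b by simp
    then have "V (A 0) = critical_value" unfolding V_def S critical_value_eq' by simp
    then have "W (A 0) * critical_value = 1"
      using \<open>A 0 \<noteq> a\<close> \<open>A 0 \<noteq> b\<close> V_pos[OF \<open>A 0 \<noteq> a\<close>] by (simp add: W_eq_inverse_V)
    moreover have "A d = a + (1 - d / ?l) *\<^sub>R (A 0 - a)"
      using l by (simp add: A_def frame_scaleR left_diff_distrib)
    then have "W (A d) < W (A 0)"
      using W_radial_less[OF \<open>A 0 \<noteq> a\<close>, of "1 - d / ?l"] S d by simp
    ultimately show "W (A d) * critical_value < 1"
      using critical_value_ge_1 by (smt (verit) mult_strict_right_mono)
    show "norm (A d - a) \<le> ?l" using d l unfolding A_def norm_frame_a by simp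
  qed (use s t m d in \<open>auto simp: C_def\<close>)
qed

text \<open>Past \<open>B\<close> the line leaves the disc, on whose boundary \<open>W q * k > 1\<close>; this produces the third
  of the three crossings.\<close>
lemma collinear_points_of_inner_surface:
  assumes k: "critical_value < k"
    and AB: "norm (A - a) \<le> critical_radius" "norm (B - a) \<le> critical_radius"
    and s: "0 < s" "s < 1"
    and W: "W A * k < 1" "W B * k < 1" "1 < W (A + s *\<^sub>R (B - A)) * k"
  obtains x y z where "(x, 0) \<in> inner_surface (- k)" "(y, 0) \<in> inner_surface (- k)"
    "(z, 0) \<in> inner_surface (- k)" "y \<in> open_segment x z"
proof -
  let ?l = critical_radius
  define g where "g r = A + r *\<^sub>R (B - A)" for r
  define w where "w r = W (g r) * k" for r
  have "A \<noteq> B" using W by auto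
  have g: "continuous_on S g" for S unfolding g_def by (intro continuous_intros)
  have w: "continuous_on S w" for S unfolding w_def
    by (intro continuous_intros continuous_on_compose2[OF continuous_on_W[of UNIV] g]) auto
  \<comment> \<open>So far along the line that the triangle inequality puts \<open>g R\<close>
    outside the open disc.\<close>
  define R where "R = 1 + 2 * ?l / norm (B - A)"
  have "1 \<le> R" using critical_radius_pos by (simp add: R_def)
  have "?l \<le> norm (g R - a)"
  proof -
    have "norm (R *\<^sub>R (B - A)) = norm (B - A) + 2 * ?l"
      using \<open>1 \<le> R\<close> \<open>A \<noteq> B\<close> by (simp add: R_def distrib_right)
    moreover have "norm (R *\<^sub>R (B - A)) \<le> norm (g R - a) + norm (A - a)"
      using norm_triangle_ineq4[of "g R - a" "A - a"] by (simp add: g_def)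
    ultimately show ?thesis using AB norm_ge_zero[of "B - A"] by linarith
  qed
  then obtain r3 where r3: "1 \<le> r3" "norm (g r3 - a) = ?l"
    using IVT'[of "\<lambda>r. norm (g r - a)" 1 ?l R] \<open>1 \<le> R\<close> AB(2) continuous_on_norm[OF continuous_on_diff[OF g continuous_on_const]]
    by (auto simp: g_def)
  have disc: "norm (g r - a) \<le> ?l" if "0 \<le> r" "r \<le> r3" for r
  proof -
    have "g r = (1 - r / r3) *\<^sub>R g 0 + (r / r3) *\<^sub>R g r3"
      using r3(1) by (simp add: g_def algebra_simps)
    moreover have "g 0 \<in> cball a ?l" "g r3 \<in> cball a ?l"
      using AB(1) r3(2) by (simp_all add: g_def dist_norm norm_minus_commute)
    ultimately have "g r \<in> cball a ?l"
      using that r3(1) convexD_alt[OF convex_cball, of "g 0" a ?l "g r3" "r / r3"] by simp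
    then show ?thesis by (simp add: dist_norm norm_minus_commute)
  qed
  have w3: "1 < w r3" using W_critical_circle[OF r3(2) k] by (simp add: w_def)
  \<comment> \<open>At the parameters \<open>0\<close>, \<open>s\<close>, \<open>1\<close>,
    \<open>r3\<close> the function \<open>w\<close> is alternately below and above 1, which forces
    three crossings.\<close>
  have w0: "w 0 < 1" "1 < w s" "w 1 < 1" using W by (simp_all add: w_def g_def)
  obtain r where r: "0 \<le> r" "r \<le> s" "w r = 1"
    using IVT'[of w 0 1 s] w0 s w by auto
  obtain r' where r': "s \<le> r'" "r' \<le> 1" "w r' = 1"
    using IVT2'[of w 1 1 s] w0 s w by auto
  obtain r'' where r'': "1 \<le> r''" "r'' \<le> r3" "w r'' = 1"
    using IVT'[of w 1 1 r3] w0 w3 r3 w by auto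
  have lt: "r < r'" "r' < r''"
    using r r' r'' w0 by (metis less_irrefl order.order_iff_strict order.strict_trans1 order.strict_trans2)+
  have mem: "(g t, 0) \<in> inner_surface (- k)" if "0 \<le> t" "t \<le> r3" "w t = 1" for t
    using that disc[OF that(1,2)] by (simp add: inner_surface_def w_def)
  have "g r' \<in> open_segment (g r) (g r'')"
    unfolding in_segment
  proof (intro conjI exI[of _ "(r' - r) / (r'' - r)"])
    show "g r \<noteq> g r''" using lt \<open>A \<noteq> B\<close> by (simp add: g_def)
    have "(1 - (r' - r) / (r'' - r)) * r + (r' - r) / (r'' - r) * r'' = r'"
    proof -
      have "(r' - r) / (r'' - r) * (r'' - r) = r' - r" using lt by simp
      then show ?thesis by (simp only: left_diff_distrib right_diff_distrib)
    qed
    then show "g r' = (1 - (r' - r) / (r'' - r)) *\<^sub>R g r + ((r' - r) / (r'' - r)) *\<^sub>R g r''"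
      unfolding g_def scaleR_add_right scaleR_scaleR
      by (metis (no_types, lifting) add.assoc add.left_commute diff_add_cancel scaleR_add_left scaleR_one)
  qed (use lt in auto)
  then show ?thesis using mem r r' r'' r3 s lt by (intro that[of "g r" "g r'" "g r''"]) auto
qed

text \<open>The fiber over \<open>p = 0\<close> is the one to look at: without kinetic energy the
  level \<open>- c\<close> is as close to the critical value as it can be. The linear chart of the
  fiber preserves the order of collinear points.\<close>

lemma not_fiberwise_convex_of_collinear:
  assumes "(x, 0) \<in> inner_surface c" "(y, 0) \<in> inner_surface c" "(z, 0) \<in> inner_surface c"
    and "y \<in> open_segment x z"
  shows "\<not> fiberwise_convex (inner_regularized c)"
proof
  assume "fiberwise_convex (inner_regularized c)"
  then have "bounds_strictly_convex_domain (cotangent_space (inv_stereo 0))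
      {\<eta>. (inv_stereo 0, \<eta>) \<in> inner_regularized c}"
    using inv_stereo_in_sphere unfolding fiberwise_convex_def by blast
  moreover have "stereo_covector 0 (q - a) \<in> {\<eta>. (inv_stereo 0, \<eta>) \<in> inner_regularized c}"
    if "(q, 0) \<in> inner_surface c" for q
    unfolding fiber_inv_stereo using that by (intro imageI) simp
  moreover have "stereo_covector 0 (y - a) \<in>
      open_segment (stereo_covector 0 (x - a)) (stereo_covector 0 (z - a))"
  proof -
    have "inj (stereo_covector 0)" by (metis injI stereo_covector_inv_left)
    then have "open_segment (stereo_covector 0 (x - a)) (stereo_covector 0 (z - a))
        = stereo_covector 0 ` open_segment (x - a) (z - a)"
      by (rule open_segment_linear_image[OF linear_stereo_covector])
    moreover have "y - a \<in> open_segment (x - a) (z - a)"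
      using assms(4) open_segment_translation_eq[of "- a" y x z] by (simp add: add.commute)
    ultimately show ?thesis by blast
  qed
  ultimately show False using not_bounds_strictly_convex_domain assms(1-3) by blast
qed

text \<open>Of the three strict inequalities at the critical level, the two upper ones persist for
  slightly larger \<open>k\<close> by continuity. The lower one only improves, since
  \<open>W\<close> is nonnegative.\<close>

lemma not_fiberwise_convex_near_critical_value:
  assumes "\<beta> < \<alpha>"
  obtains \<epsilon> where "0 < \<epsilon>"
    "\<forall>c \<in> {- critical_value - \<epsilon> <..< - critical_value}. \<not> fiberwise_convex (inner_regularized c)"
proof -
  obtain A B s where AB: "norm (A - a) \<le> critical_radius" "norm (B - a) \<le> critical_radius"
    "0 < s" "s < 1" "W A * critical_value < 1" "W B * critical_value < 1"
    "1 < W (A + s *\<^sub>R (B - A)) * critical_value"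
    using nonconvex_at_critical_value[OF assms] .
  have "\<forall>\<^sub>F k in at_right critical_value. W A * k < 1 \<and> W B * k < 1"
    using AB by (intro eventually_conj isCont_eventually_less_right continuous_intros) auto
  then obtain k where k: "critical_value < k"
    "\<And>y. critical_value < y \<Longrightarrow> y < k \<Longrightarrow> W A * y < 1 \<and> W B * y < 1"
    unfolding eventually_at_right_field by auto
  show ?thesis
  proof (intro that[of "k - critical_value"] ballI)
    fix c assume "c \<in> {- critical_value - (k - critical_value) <..< - critical_value}"
    then have c: "- critical_value - (k - critical_value) < c" "c < - critical_value" by auto
    have "1 < W (A + s *\<^sub>R (B - A)) * - c"
      using AB(7) mult_left_mono[OF less_imp_le W_nonneg, of critical_value "- c"] c(2)
      by (smt (verit))
    then obtain x y z where "(x, 0) \<in> inner_surface c" "(y, 0) \<in> inner_surface c"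
        "(z, 0) \<in> inner_surface c" "y \<in> open_segment x z"
      using collinear_points_of_inner_surface[of "- c" A B s] AB(1-4) k(2)[of "- c"] c by auto
    then show "\<not> fiberwise_convex (inner_regularized c)" by (rule not_fiberwise_convex_of_collinear)
  qed (use k in simp)
qed

end

section \<open>Equal masses: convexity\<close>

text \<open>With \<open>X = (u + v)\<^sup>2\<close>, \<open>P = u v\<close> and \<open>Y = 2 P (1 + w)\<close>, the law of cosines reads \<open>Y = X - P\<^sup>2\<close>.
  The bound \<open>X > 16\<close> is used only to make the inequality homogeneous; then the difference of the two
  sides is a multiple of \<open>(X - 4 P)\<^sup>2 (X\<^sup>2 + 2 P X + 6 P\<^sup>2)\<close>.\<close>
lemma equal_mass_inequality:
  fixes u v w :: real
  assumes uv: "0 < v" "v < u" "4 < u + v" and w: "\<bar>w\<bar> \<le> 1"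
    and cosines: "u\<^sup>2 * v\<^sup>2 = u\<^sup>2 + v\<^sup>2 - 2 * w * (u * v)"
  shows "3 * (u * v) ^ 3 * (u + v) * (1 - w\<^sup>2) < (u ^ 3 + v ^ 3) * (u ^ 4 + v ^ 4 + 2 * (u * v)\<^sup>2 * w)"
proof -
  define X P Y where "X = (u + v)\<^sup>2" and "P = u * v" and "Y = 2 * P * (1 + w)"
  have P: "0 < P" using uv by (simp add: P_def)
  have Y: "0 \<le> Y" using P w by (simp add: Y_def)
  have X16: "16 < X" using uv power_strict_mono[of 4 "u + v" 2] by (simp add: X_def)
  have "0 < (u - v)\<^sup>2" using uv by simp
  then have X4: "4 * P < X" by (simp add: X_def P_def power2_eq_square algebra_simps)
  have YX: "Y = X - P\<^sup>2" using cosines by (simp add: Y_def X_def P_def power2_eq_square algebra_simps)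
  have "16 * P\<^sup>2 \<le> X * P\<^sup>2" using X16 by (intro mult_right_mono) auto
  then have XY: "X * Y \<le> X\<^sup>2 - 16 * P\<^sup>2" unfolding YX by (simp add: power2_eq_square algebra_simps)
  have main: "P * Y * (6 * P - X) < (X - 3 * P) * (X * (X - 4 * P))"
  proof (cases "6 * P \<le> X")
    case True
    then have "P * Y * (6 * P - X) \<le> 0" using P Y by (intro mult_nonneg_nonpos) auto
    also have "0 < (X - 3 * P) * (X * (X - 4 * P))" using X4 P X16 by (intro mult_pos_pos) auto
    finally show ?thesis .
  next
    case False
    \<comment> \<open>The factor \<open>X\<close> brings in the product \<open>X * Y\<close>, for
      which \<open>XY\<close> gives a homogeneous bound without \<open>Y\<close>.\<close>
    have "X * (P * Y * (6 * P - X)) = P * (6 * P - X) * (X * Y)" by (simp add: algebra_simps)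
    also have "\<dots> \<le> P * (6 * P - X) * (X\<^sup>2 - 16 * P\<^sup>2)"
      using XY P False by (intro mult_left_mono mult_nonneg_nonneg) auto
    also have "\<dots> < X * ((X - 3 * P) * (X * (X - 4 * P)))"
    proof -
      have "X * ((X - 3 * P) * (X * (X - 4 * P))) - P * (6 * P - X) * (X\<^sup>2 - 16 * P\<^sup>2)
          = (X - 4 * P)\<^sup>2 * (X\<^sup>2 + 2 * P * X + 6 * P\<^sup>2)"
        by (simp add: power2_eq_square algebra_simps)
      moreover have "0 < (X - 4 * P)\<^sup>2 * (X\<^sup>2 + 2 * P * X + 6 * P\<^sup>2)"
        using X4 P X16 by (intro mult_pos_pos add_pos_pos) auto
      ultimately show ?thesis by linarith
    qed
    finally show ?thesis using X16 by simp
  qed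
  \<comment> \<open>\<open>Y\<close> absorbs the factor \<open>1 + w\<close>; the other factor
    \<open>1 - w\<close> is bounded crudely by 2.\<close>
  have "3 * P ^ 3 * (1 - w\<^sup>2) = 3 / 2 * P\<^sup>2 * Y * (1 - w)"
    by (simp add: Y_def power2_eq_square power3_eq_cube algebra_simps)
  also have "\<dots> \<le> 3 / 2 * P\<^sup>2 * Y * 2"
    using w P Y by (intro mult_left_mono) auto
  also have "\<dots> < (X - 3 * P) * (X * (X - 4 * P) + P * Y)"
    using main by (simp add: power2_eq_square algebra_simps)
  finally have "(u + v) * (3 * P ^ 3 * (1 - w\<^sup>2)) < (u + v) * ((X - 3 * P) * (X * (X - 4 * P) + P * Y))"
    using uv by simp
  moreover have "u ^ 4 + v ^ 4 + 2 * (u * v)\<^sup>2 * w = X * (X - 4 * P) + P * Y"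
    by (simp add: X_def P_def Y_def eval_nat_numeral algebra_simps)
  moreover have "u ^ 3 + v ^ 3 = (u + v) * (X - 3 * P)"
    by (simp add: X_def P_def eval_nat_numeral algebra_simps)
  ultimately show ?thesis by (simp add: P_def mult_ac)
qed

text \<open>Here \<sigma> measures the tangent vector and \<open>N\<close> is its squared length.
  Multiplied by \<open>1 - w^2\<close>, the claim is \<open>equal_mass_inequality\<close> times
  \<open>\<sigma>^2 (u v)^2\<close>. On the axis of the centers \<open>1 - w^2 = 0\<close>, but this
  forces \<open>\<sigma> = 0\<close>, where the claim is immediate.\<close>

lemma equal_mass_tangent_inequality:
  fixes u v w \<sigma> N :: real
  assumes uv: "0 < v" "v < u" "4 < u + v" and w: "\<bar>w\<bar> \<le> 1"
    and cosines: "u\<^sup>2 * v\<^sup>2 = u\<^sup>2 + v\<^sup>2 - 2 * w * (u * v)"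
    and N: "0 < N" "N * (1 - w\<^sup>2) = \<sigma>\<^sup>2 * (u * v)\<^sup>2 * (u ^ 4 + v ^ 4 + 2 * (u * v)\<^sup>2 * w)"
  shows "3 * \<sigma>\<^sup>2 * (u * v) ^ 5 * (u + v) < N * (u ^ 3 + v ^ 3)"
proof (cases "\<sigma> = 0")
  case True
  then show ?thesis using uv N by (simp add: add_pos_pos)
next
  case False
  let ?s = "u ^ 4 + v ^ 4 + 2 * (u * v)\<^sup>2 * w"
  note key = equal_mass_inequality[OF uv w cosines]
  have pos: "0 < \<sigma>\<^sup>2 * (u * v)\<^sup>2" using False uv by simp
  have w2: "0 \<le> 1 - w\<^sup>2" using w by (simp add: abs_square_le_1)
  have "1 - w\<^sup>2 \<noteq> 0"
  proof
    assume 0: "1 - w\<^sup>2 = 0"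
    then have "\<sigma>\<^sup>2 * (u * v)\<^sup>2 * ?s = 0" using N(2) by simp
    then have "?s = 0" using pos by (metis less_irrefl mult_eq_0_iff)
    then show False using key 0 by simp
  qed
  with w2 have "0 < 1 - w\<^sup>2" by simp
  moreover have "(3 * \<sigma>\<^sup>2 * (u * v) ^ 5 * (u + v)) * (1 - w\<^sup>2) < (N * (u ^ 3 + v ^ 3)) * (1 - w\<^sup>2)"
  proof -
    have "(3 * \<sigma>\<^sup>2 * (u * v) ^ 5 * (u + v)) * (1 - w\<^sup>2)
        = \<sigma>\<^sup>2 * (u * v)\<^sup>2 * (3 * (u * v) ^ 3 * (u + v) * (1 - w\<^sup>2))"
      by (simp add: eval_nat_numeral mult_ac)
    also have "\<dots> < \<sigma>\<^sup>2 * (u * v)\<^sup>2 * ((u ^ 3 + v ^ 3) * ?s)"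
      using mult_strict_left_mono[OF key pos] .
    also have "\<dots> = (N * (1 - w\<^sup>2)) * (u ^ 3 + v ^ 3)" unfolding N(2) by (simp only: mult_ac)
    also have "\<dots> = (N * (u ^ 3 + v ^ 3)) * (1 - w\<^sup>2)" by (simp only: mult_ac)
    finally show ?thesis .
  qed
  ultimately show ?thesis by (simp add: mult_less_cancel_right)
qed

text \<open>Three vectors of the plane are dependent, so their Gram determinant vanishes; this is
  its expansion.\<close>

lemma gram_determinant_plane:
  fixes x y d :: "real^2"
  shows "(d \<bullet> d) * ((x \<bullet> x) * (y \<bullet> y) - (x \<bullet> y)\<^sup>2) =
    (x \<bullet> d)\<^sup>2 * (y \<bullet> y) - 2 * (x \<bullet> d) * (y \<bullet> d) * (x \<bullet> y) + (y \<bullet> d)\<^sup>2 * (x \<bullet> x)"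
proof -
  have inner2: "u \<bullet> v = u $ 1 * v $ 1 + u $ 2 * v $ 2" for u v :: "real^2"
    by (simp add: inner_vec_def sum_2)
  show ?thesis unfolding inner2 by algebra
qed

section \<open>Derivatives of the potential along curves\<close>

lemma has_real_derivative_norm_compose:
  fixes g :: "real \<Rightarrow> 'a::real_inner"
  assumes "(g has_vector_derivative g') (at t)" "g t \<noteq> 0"
  shows "((\<lambda>t. norm (g t)) has_real_derivative (g t \<bullet> g') / norm (g t)) (at t)"
proof -
  have "((\<lambda>t. g t \<bullet> g t) has_real_derivative g t \<bullet> g' + g' \<bullet> g t) (at t)"
    using bounded_bilinear.has_vector_derivative[OF bounded_bilinear_inner assms(1) assms(1)]
    by (simp add: has_real_derivative_iff_has_vector_derivative)
  moreover have "0 < g t \<bullet> g t" using assms(2) by simp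
  ultimately have "((\<lambda>t. sqrt (g t \<bullet> g t)) has_real_derivative inverse (sqrt (g t \<bullet> g t)) / 2 * (g t \<bullet> g' + g' \<bullet> g t)) (at t)"
    by (intro DERIV_chain2[where f = sqrt] DERIV_real_sqrt)
  moreover have "inverse (sqrt (g t \<bullet> g t)) / 2 * (g t \<bullet> g' + g' \<bullet> g t) = (g t \<bullet> g') / sqrt (g t \<bullet> g t)"
    by (simp add: inner_commute[of g' "g t"] inverse_eq_divide)
  ultimately show ?thesis unfolding norm_eq_sqrt_inner by simp
qed

lemma has_real_derivative_inverse_norm:
  fixes g :: "real \<Rightarrow> 'a::real_inner"
  assumes "(g has_vector_derivative g') (at t)" "g t \<noteq> 0"
  shows "((\<lambda>t. 1 / norm (g t)) has_real_derivative - (g t \<bullet> g') / norm (g t) ^ 3) (at t)"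
  using DERIV_divide[OF DERIV_const[of 1] has_real_derivative_norm_compose[OF assms]] assms(2)
  by (simp add: power3_eq_cube divide_divide_eq_left mult.assoc)

lemma has_real_derivative_inner_over_norm_cubed:
  fixes g g1 :: "real \<Rightarrow> 'a::real_inner"
  assumes g: "(g has_vector_derivative g1 t) (at t)" "(g1 has_vector_derivative g2) (at t)" "g t \<noteq> 0"
  shows "((\<lambda>t. (g t \<bullet> g1 t) / norm (g t) ^ 3) has_real_derivative
    ((norm (g1 t))\<^sup>2 + g t \<bullet> g2) / norm (g t) ^ 3 - 3 * (g t \<bullet> g1 t)\<^sup>2 / norm (g t) ^ 5) (at t)"
proof -
  have i: "((\<lambda>t. g t \<bullet> g1 t) has_real_derivative g t \<bullet> g2 + g1 t \<bullet> g1 t) (at t)"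
    using bounded_bilinear.has_vector_derivative[OF bounded_bilinear_inner g(1,2)]
    by (simp add: has_real_derivative_iff_has_vector_derivative)
  define n A B where "n = norm (g t)" and "A = g t \<bullet> g1 t" and "B = g t \<bullet> g2 + g1 t \<bullet> g1 t"
  have n: "n \<noteq> 0" using g(3) by (simp add: n_def)
  have "((\<lambda>t. (g t \<bullet> g1 t) / norm (g t) ^ 3) has_real_derivative
      (B * n ^ 3 - A * (3 * n\<^sup>2 * (A / n))) / (n ^ 3 * n ^ 3)) (at t)"
    using DERIV_divide[OF i DERIV_power[OF has_real_derivative_norm_compose[OF g(1,3)], of 3]] g(3)
    by (simp add: n_def A_def B_def mult_ac)
  also have "(B * n ^ 3 - A * (3 * n\<^sup>2 * (A / n))) / (n ^ 3 * n ^ 3) = B / n ^ 3 - 3 * A\<^sup>2 / n ^ 5"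
    using n by (simp add: field_simps eval_nat_numeral)
  finally show ?thesis by (simp add: n_def A_def B_def power2_norm_eq_inner add.commute)
qed

lemma second_derivative_nonneg_at_local_min:
  fixes f f' :: "real \<Rightarrow> real"
  assumes \<delta>: "0 < \<delta>" and min: "\<And>s. \<bar>s - s0\<bar> < \<delta> \<Longrightarrow> f s0 \<le> f s"
    and d: "\<And>s. \<bar>s - s0\<bar> < \<delta> \<Longrightarrow> (f has_real_derivative f' s) (at s)"
    and d2: "(f' has_real_derivative D) (at s0)"
  shows "f' s0 = 0" "0 \<le> D"
proof -
  show 0: "f' s0 = 0"
    using DERIV_local_min[OF d, of s0 \<delta>] \<delta> min by (auto simp: abs_minus_commute)
  show "0 \<le> D"
  proof (rule ccontr)
    assume "\<not> 0 \<le> D"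
    then obtain e where e: "0 < e" "\<And>h. 0 < h \<Longrightarrow> h < e \<Longrightarrow> f' (s0 + h) < f' s0"
      using DERIV_neg_dec_right[OF d2] by auto
    define h where "h = min e \<delta> / 2"
    have h: "0 < h" "h < e" "h < \<delta>" using e \<delta> by (auto simp: h_def)
    have "\<And>x. s0 \<le> x \<Longrightarrow> x \<le> s0 + h \<Longrightarrow> (f has_real_derivative f' x) (at x)"
      using h by (intro d) auto
    then obtain z where z: "s0 < z" "z < s0 + h" "f (s0 + h) - f s0 = (s0 + h - s0) * f' z"
      using MVT2[of s0 "s0 + h" f f'] h by auto
    have "f' z < 0" using e(2)[of "z - s0"] z h 0 by auto
    then have "f (s0 + h) < f s0" using z(3) h by (simp add: mult_pos_neg algebra_simps)
    then show False using min[of "s0 + h"] h by auto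
  qed
qed

context two_centers
begin

definition grad_V :: "real^2 \<Rightarrow> real^2 \<Rightarrow> real" where
  "grad_V q d = - \<alpha> * ((q - a) \<bullet> d / norm (q - a) ^ 3) - \<beta> * ((q - b) \<bullet> d / norm (q - b) ^ 3)"

definition hess_V :: "real^2 \<Rightarrow> real^2 \<Rightarrow> real" where
  "hess_V q d =
     \<alpha> * (3 * ((q - a) \<bullet> d)\<^sup>2 / norm (q - a) ^ 5 - (norm d)\<^sup>2 / norm (q - a) ^ 3) +
     \<beta> * (3 * ((q - b) \<bullet> d)\<^sup>2 / norm (q - b) ^ 5 - (norm d)\<^sup>2 / norm (q - b) ^ 3)"

lemma grad_V_scaleR: "grad_V q (k *\<^sub>R d) = k * grad_V q d"
  by (simp add: grad_V_def algebra_simps)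

lemma grad_V_zero [simp]: "grad_V q 0 = 0"
  by (simp add: grad_V_def)

lemma has_real_derivative_V:
  assumes "(\<gamma> has_vector_derivative \<gamma>') (at t)" "\<gamma> t \<noteq> a" "\<gamma> t \<noteq> b"
  shows "((\<lambda>t. V (\<gamma> t)) has_real_derivative grad_V (\<gamma> t) \<gamma>') (at t)"
proof -
  have g: "((\<lambda>t. \<gamma> t - x) has_vector_derivative \<gamma>') (at t)" for x
    using has_vector_derivative_diff[OF assms(1) has_vector_derivative_const] by simp
  have "((\<lambda>t. \<alpha> * (1 / norm (\<gamma> t - a)) + \<beta> * (1 / norm (\<gamma> t - b))) has_real_derivative
      \<alpha> * (- ((\<gamma> t - a) \<bullet> \<gamma>') / norm (\<gamma> t - a) ^ 3) + \<beta> * (- ((\<gamma> t - b) \<bullet> \<gamma>') / norm (\<gamma> t - b) ^ 3)) (at t)"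
    using assms(2,3) by (intro DERIV_add DERIV_cmult has_real_derivative_inverse_norm g) auto
  then show ?thesis by (simp add: V_def grad_V_def)
qed

text \<open>Second-order chain rule, used for segments, where the acceleration is zero, and for
  level curves, where the left side is constant.\<close>

lemma has_real_derivative_grad_V:
  assumes "(\<gamma> has_vector_derivative \<gamma>1 t) (at t)" "(\<gamma>1 has_vector_derivative \<gamma>2) (at t)"
    "\<gamma> t \<noteq> a" "\<gamma> t \<noteq> b"
  shows "((\<lambda>t. grad_V (\<gamma> t) (\<gamma>1 t)) has_real_derivative hess_V (\<gamma> t) (\<gamma>1 t) + grad_V (\<gamma> t) \<gamma>2) (at t)"
proof -
  have g: "((\<lambda>t. \<gamma> t - x) has_vector_derivative \<gamma>1 t) (at t)" for x
    using has_vector_derivative_diff[OF assms(1) has_vector_derivative_const] by simp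
  let ?d = "\<lambda>x. ((norm (\<gamma>1 t))\<^sup>2 + (\<gamma> t - x) \<bullet> \<gamma>2) / norm (\<gamma> t - x) ^ 3
    - 3 * ((\<gamma> t - x) \<bullet> \<gamma>1 t)\<^sup>2 / norm (\<gamma> t - x) ^ 5"
  have "((\<lambda>t. grad_V (\<gamma> t) (\<gamma>1 t)) has_real_derivative - \<alpha> * ?d a - \<beta> * ?d b) (at t)"
    unfolding grad_V_def using assms(3,4)
    by (intro DERIV_diff DERIV_cmult has_real_derivative_inner_over_norm_cubed g assms) auto
  moreover have "- \<alpha> * ?d a - \<beta> * ?d b = hess_V (\<gamma> t) (\<gamma>1 t) + grad_V (\<gamma> t) \<gamma>2"
    unfolding hess_V_def grad_V_def by (simp add: add_divide_distrib right_diff_distrib distrib_left)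
  ultimately show ?thesis by simp
qed

end

locale equal_masses = two_centers +
  assumes equal: "\<alpha> = \<beta>"
begin

lemma half: "\<alpha> = 1 / 2" "\<beta> = 1 / 2"
  using equal mass by auto

lemma critical_radius_half: "critical_radius = 1 / 2"
  unfolding critical_radius_def unfolding equal[symmetric] using \<alpha>_pos by simp

lemma critical_value_2: "critical_value = 2"
  unfolding critical_value_eq unfolding equal[symmetric] using half by simp

text \<open>In the inverse distances \<open>u\<close> and \<open>v\<close>, the hypothesis
  \<open>critical_value < V q\<close> is \<open>4 < u + v\<close>, and the disc gives
  \<open>v < u\<close>. Tangency fixes the ratio of the two inner products with \<open>d\<close>,
  planarity then determines \<open>|d|^2\<close>, and the sign of the Hessian becomes
  \<open>equal_mass_tangent_inequality\<close>.\<close>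

lemma hess_V_neg:
  assumes q: "q \<noteq> a" "norm (q - a) \<le> critical_radius" "critical_value < V q"
    and d: "d \<noteq> 0" "grad_V q d = 0"
  shows "hess_V q d < 0"
proof -
  define r1 r2 p1 p2 where "r1 = norm (q - a)" and "r2 = norm (q - b)"
    and "p1 = (q - a) \<bullet> d" and "p2 = (q - b) \<bullet> d"
  define u v w where "u = 1 / r1" and "v = 1 / r2" and "w = ((q - a) \<bullet> (q - b)) / (r1 * r2)"
  define N where "N = d \<bullet> d"
  have "norm (q - a) \<noteq> critical_radius" using V_critical_circle q(3) by force
  then have r1: "0 < r1" "r1 < 1 / 2" using q by (auto simp: r1_def critical_radius_half)
  then have r12: "r1 < r2" using norm_diff_b_ge[of q] by (simp add: r1_def r2_def)
  have r2: "0 < r2" using r1 r12 by simp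
  have uv: "0 < v" "v < u" "u \<noteq> 0" "v \<noteq> 0" "0 < u"
    using r1 r2 r12 by (auto simp: u_def v_def frac_less2)
  have sum: "4 < u + v"
    using q(3) unfolding critical_value_2 V_def r1_def[symmetric] r2_def[symmetric] unfolding half
    by (simp add: u_def v_def)
  have ip: "(q - a) \<bullet> (q - b) = w / (u * v)" using r1 r2 by (simp add: w_def u_def v_def)
  have w: "\<bar>w\<bar> \<le> 1"
    using Cauchy_Schwarz_ineq2[of "q - a" "q - b"] r1 r2
    by (simp add: w_def abs_mult r1_def r2_def divide_le_eq)
  have sq: "(q - a) \<bullet> (q - a) = 1 / u\<^sup>2" "(q - b) \<bullet> (q - b) = 1 / v\<^sup>2"
    by (simp_all add: u_def v_def r1_def r2_def power2_norm_eq_inner power_divide)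
  have "((q - a) - (q - b)) \<bullet> ((q - a) - (q - b)) = 1"
    using dist_centers by (simp add: norm_eq_sqrt_inner)
  then have "(q - a) \<bullet> (q - a) + (q - b) \<bullet> (q - b) - 2 * ((q - a) \<bullet> (q - b)) = 1"
    by (simp add: inner_diff_left inner_diff_right inner_commute)
  then have cosines: "u\<^sup>2 * v\<^sup>2 = u\<^sup>2 + v\<^sup>2 - 2 * w * (u * v)"
    unfolding sq ip
  proof -
    assume *: "1 / u\<^sup>2 + 1 / v\<^sup>2 - 2 * (w / (u * v)) = 1"
    have "(1 / u\<^sup>2 + 1 / v\<^sup>2 - 2 * (w / (u * v))) * (u\<^sup>2 * v\<^sup>2) = u\<^sup>2 + v\<^sup>2 - 2 * w * (u * v)"
      using uv by (simp add: field_simps power2_eq_square)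
    then show ?thesis unfolding * by simp
  qed
  have g: "p1 * u ^ 3 + p2 * v ^ 3 = 0"
    using d(2) unfolding grad_V_def p1_def[symmetric] p2_def[symmetric] r1_def[symmetric] r2_def[symmetric]
    unfolding half
    by (simp add: u_def v_def power_divide field_simps)
  \<comment> \<open>The tangency relation \<open>g\<close> is one linear equation for
    \<open>p1\<close> and \<open>p2\<close>; \<sigma> parametrizes its solutions.\<close>
  define \<sigma> where "\<sigma> = p1 / v ^ 3"
  have p: "p1 = \<sigma> * v ^ 3" "p2 = - \<sigma> * u ^ 3"
    using g uv by (simp_all add: \<sigma>_def field_simps)
  have "N * (1 / u\<^sup>2 * (1 / v\<^sup>2) - (w / (u * v))\<^sup>2) =
      p1\<^sup>2 * (1 / v\<^sup>2) - 2 * p1 * p2 * (w / (u * v)) + p2\<^sup>2 * (1 / u\<^sup>2)"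
    using gram_determinant_plane[of d "q - a" "q - b"] unfolding sq ip N_def p1_def p2_def .
  moreover have "N * (1 / u\<^sup>2 * (1 / v\<^sup>2) - (w / (u * v))\<^sup>2) = N * (1 - w\<^sup>2) / (u * v)\<^sup>2"
    using uv by (simp add: field_simps power_mult_distrib)
  moreover have "p1\<^sup>2 * (1 / v\<^sup>2) - 2 * p1 * p2 * (w / (u * v)) + p2\<^sup>2 * (1 / u\<^sup>2)
      = \<sigma>\<^sup>2 * (u ^ 4 + v ^ 4 + 2 * (u * v)\<^sup>2 * w)"
    unfolding p using uv by (simp add: field_simps eval_nat_numeral)
  ultimately have "N * (1 - w\<^sup>2) = \<sigma>\<^sup>2 * (u * v)\<^sup>2 * (u ^ 4 + v ^ 4 + 2 * (u * v)\<^sup>2 * w)"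
    using uv by (simp add: divide_eq_eq mult_ac)
  from equal_mass_tangent_inequality[OF uv(1,2) sum w cosines _ this]
  have "3 * \<sigma>\<^sup>2 * (u * v) ^ 5 * (u + v) < N * (u ^ 3 + v ^ 3)" using d(1) by (simp add: N_def)
  moreover have "3 * \<sigma>\<^sup>2 * (u * v) ^ 5 * (u + v) = 3 * p1\<^sup>2 * u ^ 5 + 3 * p2\<^sup>2 * v ^ 5"
    unfolding p by (simp add: eval_nat_numeral algebra_simps)
  ultimately have "3 * p1\<^sup>2 * u ^ 5 + 3 * p2\<^sup>2 * v ^ 5 < N * (u ^ 3 + v ^ 3)" by simp
  moreover have "hess_V q d = (1 / 2) * (3 * p1\<^sup>2 * u ^ 5 + 3 * p2\<^sup>2 * v ^ 5 - N * (u ^ 3 + v ^ 3))"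
    unfolding hess_V_def power2_norm_eq_inner p1_def[symmetric] p2_def[symmetric] r1_def[symmetric]
      r2_def[symmetric] N_def[symmetric] u_def v_def
    unfolding half
    by (simp add: power_divide algebra_simps)
  ultimately show ?thesis by simp
qed

end

section \<open>Superlevel sets of the potential are strictly convex\<close>

context two_centers
begin

text \<open>For \<open>k\<close> above the critical value this is the set \<open>V > k\<close>
  inside the disc, together with \<open>a\<close>. Writing it with \<open>W\<close> includes the
  center without a special case.\<close>

definition sublevel :: "real \<Rightarrow> (real^2) set" where
  "sublevel k = {q. norm (q - a) < critical_radius \<and> W q * k < 1}"

definition level :: "real \<Rightarrow> (real^2) set" where
  "level k = {q. norm (q - a) \<le> critical_radius \<and> W q * k = 1}"

lemma sublevelI:
  assumes "critical_value < k" "norm (q - a) \<le> critical_radius" "W q * k < 1"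
  shows "q \<in> sublevel k"
  using assms W_critical_circle[of q k] by (fastforce simp: sublevel_def)

lemma W_zero_iff: "norm (q - a) \<le> critical_radius \<Longrightarrow> W q = 0 \<longleftrightarrow> q = a"
  using W_pos[of q] by (cases "q = a") auto

lemma open_sublevel: "open (sublevel k)"
  unfolding sublevel_def
  by (intro open_Collect_conj open_Collect_less continuous_intros continuous_on_W)

lemma bounded_sublevel: "bounded (sublevel k)"
proof (rule bounded_subset)
  show "sublevel k \<subseteq> cball a critical_radius"
    by (auto simp: sublevel_def dist_norm norm_minus_commute)
qed simp

text \<open>A point with \<open>W q * k = 1\<close> is a limit of inner points: scaling it towards
  \<open>a\<close> strictly decreases \<open>W\<close>.\<close>

lemma closure_sublevel:
  assumes k: "critical_value < k"
  shows "closure (sublevel k) = {q. norm (q - a) \<le> critical_radius \<and> W q * k \<le> 1}" (is "_ = ?C")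
proof
  have "closed ?C"
    by (intro closed_Collect_conj closed_Collect_le continuous_intros continuous_on_W)
  then show "closure (sublevel k) \<subseteq> ?C"
    by (intro closure_minimal) (auto simp: sublevel_def)
  show "?C \<subseteq> closure (sublevel k)"
  proof
    fix q assume q: "q \<in> ?C"
    define m where "m s = a + s *\<^sub>R (q - a)" for s
    have k0: "0 < k" using k critical_value_ge_1 by simp
    have "m s \<in> sublevel k" if s: "s \<in> {0<..<1}" for s
    proof (rule sublevelI[OF k])
      have "s * norm (q - a) \<le> norm (q - a)" using s by (simp add: mult_left_le_one_le)
      then show "norm (m s - a) \<le> critical_radius" using q s by (simp add: m_def)
      show "W (m s) * k < 1"
      proof (cases "q = a")
        case False
        then have "W (m s) * k < W q * k"
          unfolding m_def using q s k0 by (intro mult_strict_right_mono W_radial_less) auto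
        then show ?thesis using q by simp
      qed (simp add: m_def)
    qed
    then have "m ` {0<..<1} \<subseteq> sublevel k" by blast
    then have "closure (m ` {0<..<1}) \<subseteq> closure (sublevel k)" by (rule closure_mono)
    moreover have "m ` closure {0<..<1} \<subseteq> closure (m ` {0<..<1})"
      by (rule continuous_image_closure_subset[of UNIV]) (auto simp: m_def intro!: continuous_intros)
    moreover have "1 \<in> closure {0<..<1::real}" by simp
    moreover have "m 1 = q" by (simp add: m_def)
    ultimately show "q \<in> closure (sublevel k)" by blast
  qed
qed

lemma level_eq_boundary:
  assumes "critical_value < k"
  shows "level k = closure (sublevel k) - sublevel k"
  unfolding closure_sublevel[OF assms] level_def
  using sublevelI[OF assms] by (fastforce simp: sublevel_def)

lemma inner_surface_level: "(q, p) \<in> inner_surface c \<longleftrightarrow> q \<in> level ((norm p)\<^sup>2 / 2 - c)"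
  by (simp add: inner_surface_def level_def)

end

context equal_masses
begin

text \<open>Such a point is a local minimum of \<open>V\<close> on the segment, so the first
  derivative is zero and the second nonnegative, against \<open>hess_V_neg\<close>. The point is not
  \<open>a\<close>, where \<open>V\<close> is not differentiable, since a maximum \<open>0\<close>
  of \<open>W\<close> would put both ends at \<open>a\<close>.\<close>

lemma no_interior_max_of_W:
  assumes X: "norm (X - a) \<le> critical_radius" "norm (Y - a) \<le> critical_radius" "X \<noteq> Y"
    and s: "0 < s0" "s0 < 1"
  defines "g \<equiv> \<lambda>s. X + s *\<^sub>R (Y - X)"
  assumes max: "\<And>s. 0 \<le> s \<Longrightarrow> s \<le> 1 \<Longrightarrow> W (g s) \<le> W (g s0)"
    and W: "W (g s0) * critical_value < 1"
  shows False
proof -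
  have disc: "norm (g s - a) \<le> critical_radius" if "0 \<le> s" "s \<le> 1" for s
  proof -
    have "(1 - s) *\<^sub>R X + s *\<^sub>R Y \<in> cball a critical_radius"
      using X that by (intro convexD_alt[OF convex_cball]) (auto simp: dist_norm norm_minus_commute)
    moreover have "(1 - s) *\<^sub>R X + s *\<^sub>R Y = g s" by (simp add: g_def algebra_simps)
    ultimately show ?thesis by (simp add: dist_norm norm_minus_commute)
  qed
  let ?z = "g s0"
  have za: "?z \<noteq> a"
  proof
    assume "?z = a"
    then have "W (g s) = 0" if "0 \<le> s" "s \<le> 1" for s
      using max[OF that] W_nonneg[of "g s"] by simp
    then have "g 0 = a" "g 1 = a" using W_zero_iff disc by (metis order.refl zero_le_one)+
    then show False using X(3) by (simp add: g_def)
  qed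
  have gd: "(g has_vector_derivative (Y - X)) (at s)" for s
    unfolding g_def by (auto intro!: derivative_eq_intros)
  have "\<forall>\<^sub>F s in nhds s0. g s \<noteq> a \<and> 0 < s \<and> s < 1"
  proof -
    have "isCont g s0" using gd has_vector_derivative_continuous by blast
    then have "\<forall>\<^sub>F s in nhds s0. g s \<noteq> a"
      using za by (simp add: isCont_def tendsto_nhds_iff tendsto_imp_eventually_ne)
    then show ?thesis using s
      by (intro eventually_conj) (auto simp: eventually_nhds intro: exI[of _ "{0<..<1}"] open_greaterThanLessThan
          exI[of _ "{0<..}"] exI[of _ "{..<1}"])
  qed
  then obtain \<delta> where \<delta>: "0 < \<delta>" "\<And>s. \<bar>s - s0\<bar> < \<delta> \<Longrightarrow> g s \<noteq> a \<and> 0 < s \<and> s < 1"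
    unfolding eventually_nhds_metric dist_real_def by auto
  have V: "V (g s) = 1 / W (g s)" "g s \<noteq> b" "0 < W (g s)" if "\<bar>s - s0\<bar> < \<delta>" for s
    using \<delta>(2)[OF that] disc[of s] in_disc_neq_b[of "g s"] W_eq_inverse_V[of "g s"] W_pos[of "g s"] by auto
  have min: "V ?z \<le> V (g s)" if "\<bar>s - s0\<bar> < \<delta>" for s
  proof -
    have "W (g s) \<le> W ?z" using max[of s] \<delta>(2)[OF that] by simp
    then show ?thesis using V(1,3)[OF that] V(1,3)[of s0] \<delta>(1) by (simp add: frac_le)
  qed
  have d1: "((\<lambda>s. V (g s)) has_real_derivative grad_V (g s) (Y - X)) (at s)" if "\<bar>s - s0\<bar> < \<delta>" for s
    using \<delta>(2)[OF that] V(2)[OF that] by (intro has_real_derivative_V gd) auto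
  have d2: "((\<lambda>s. grad_V (g s) (Y - X)) has_real_derivative hess_V ?z (Y - X)) (at s0)"
    using has_real_derivative_grad_V[of g "\<lambda>_. Y - X" s0 0] gd za V(2)[of s0] \<delta>(1) by simp
  have "grad_V ?z (Y - X) = 0" "0 \<le> hess_V ?z (Y - X)"
    using second_derivative_nonneg_at_local_min[OF \<delta>(1) min d1 d2] by auto
  moreover have "critical_value < V ?z"
    using W V(1,3)[of s0] \<delta>(1) by (simp add: less_divide_eq mult.commute)
  ultimately show False
    using hess_V_neg[OF za disc, of "Y - X"] s X(3) by auto
qed

text \<open>Shrink the segment from \<open>x\<close> to \<open>y\<close> towards \<open>a\<close> and consider the smallest factor \<open>r\<close> at which it
  reaches the level \<open>k'\<close>: the contact point is an interior maximum of \<open>W\<close> on the segment.\<close>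
lemma segment_below_level:
  assumes k: "critical_value < k'" "k' < k"
    and x: "norm (x - a) \<le> critical_radius" "W x * k \<le> 1"
    and y: "norm (y - a) \<le> critical_radius" "W y * k \<le> 1"
    and "x \<noteq> y" and s: "0 \<le> s" "s \<le> 1"
  shows "W (x + s *\<^sub>R (y - x)) * k' < 1"
proof (rule ccontr)
  assume contr: "\<not> W (x + s *\<^sub>R (y - x)) * k' < 1"
  define P where "P r s = a + r *\<^sub>R (x - a + s *\<^sub>R (y - x))" for r s
  have k0: "0 < k'" using k critical_value_ge_1 by simp
  define \<Omega> where "\<Omega> = {z \<in> {0..1} \<times> {0..1}. 1 \<le> W (P (fst z) (snd z)) * k'}"
  have cont: "continuous_on S (\<lambda>z::real\<times>real. W (P (fst z) (snd z)) * k')" for S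
    unfolding P_def
    by (intro continuous_intros continuous_on_compose2[OF continuous_on_W[of UNIV]]) auto
  have "\<Omega> = ({0..1} \<times> {0..1}) \<inter> {z. 1 \<le> W (P (fst z) (snd z)) * k'}" by (auto simp: \<Omega>_def)
  moreover have "closed {z. 1 \<le> W (P (fst z) (snd z)) * k'}"
    by (intro closed_Collect_le cont continuous_intros)
  ultimately have "compact \<Omega>" by (simp add: compact_Times compact_Int_closed)
  moreover have "(1, s) \<in> \<Omega>" using s contr by (simp add: \<Omega>_def P_def)
  then have "\<Omega> \<noteq> {}" by blast
  ultimately obtain z where z: "z \<in> \<Omega>" "\<And>z'. z' \<in> \<Omega> \<Longrightarrow> fst z \<le> fst z'"
    using continuous_attains_inf[OF _ _ continuous_on_fst[OF continuous_on_id], of \<Omega>] by blast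
  obtain r t where rt: "z = (r, t)" by (cases z)
  have r: "0 \<le> r" "r \<le> 1" and t: "0 \<le> t" "t \<le> 1" and ge: "1 \<le> W (P r t) * k'"
    using z(1) by (auto simp: \<Omega>_def rt)
  have "r \<noteq> 0" using ge by (auto simp: P_def)
  with r have r0: "0 < r" by simp
  have below: "W (P r' s') * k' < 1" if "0 \<le> r'" "r' < r" "0 \<le> s'" "s' \<le> 1" for r' s'
    using z(2)[of "(r', s')"] that r(2) by (fastforce simp: \<Omega>_def rt)
  have le: "W (P r s') * k' \<le> 1" if s': "0 \<le> s'" "s' \<le> 1" for s'
  proof (rule tendsto_upperbound)
    have "continuous_on UNIV (\<lambda>r. W (P r s') * k')"
      unfolding P_def
      by (intro continuous_intros continuous_on_compose2[OF continuous_on_W[of UNIV]]) auto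
    then show "((\<lambda>r. W (P r s') * k') \<longlongrightarrow> W (P r s') * k') (at_left r)"
      by (simp add: continuous_on_eq_continuous_at isCont_def filterlim_at_split)
    show "\<forall>\<^sub>F r' in at_left r. W (P r' s') * k' \<le> 1"
      unfolding eventually_at_left_field using below[OF _ _ s'] r0
      by (intro exI[of _ 0]) (auto intro: less_imp_le)
  qed simp
  with ge t have eq: "W (P r t) * k' = 1" by (intro order.antisym) auto
  \<comment> \<open>This is the reason for taking \<open>k' < k\<close>: endpoints on the level
    \<open>k\<close> itself are strictly below the level \<open>k'\<close>, so the contact point is
    interior to the segment.\<close>
  have end_lt: "W (a + r *\<^sub>R (q - a)) * k' < 1" if q: "norm (q - a) \<le> critical_radius" "W q * k \<le> 1" for q
  proof (cases "q = a")
    case False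
    then have "W q * k' < 1"
      using W_pos[OF False q(1)] k(2) q(2) by (smt (verit) mult_strict_left_mono)
    then show ?thesis using W_radial_le[OF q(1) r] k0 by (smt (verit) mult_right_mono)
  qed simp
  have P01: "P r 0 = a + r *\<^sub>R (x - a)" "P r 1 = a + r *\<^sub>R (y - a)" by (simp_all add: P_def)
  have "t \<noteq> 0" "t \<noteq> 1" using eq end_lt[OF x] end_lt[OF y] P01 by force+
  with t have t: "0 < t" "t < 1" by auto
  have Pg: "P r s' = P r 0 + s' *\<^sub>R (P r 1 - P r 0)" for s' by (simp add: P_def algebra_simps)
  have disc: "norm (a + r *\<^sub>R (q - a) - a) \<le> critical_radius" if "norm (q - a) \<le> critical_radius" for q
    using that mult_left_le_one_le[OF norm_ge_zero[of "q - a"] r] r(1) by simp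
  show False
  proof (rule no_interior_max_of_W[of "P r 0" "P r 1" t, folded Pg])
    show "norm (P r 0 - a) \<le> critical_radius" "norm (P r 1 - a) \<le> critical_radius"
      using disc x(1) y(1) unfolding P01 by blast+
    show "P r 0 \<noteq> P r 1" using r0 \<open>x \<noteq> y\<close> by (simp add: P01)
    show "W (P r s') \<le> W (P r t)" if "0 \<le> s'" "s' \<le> 1" for s'
    proof -
      have "W (P r s') * k' \<le> W (P r t) * k'" using le[OF that] eq by simp
      then show ?thesis using k0 by simp
    qed
    have "0 < W (P r t)" using eq k0 by (metis zero_less_mult_pos2 zero_less_one)
    then have "W (P r t) * critical_value < W (P r t) * k'" using k(1) by simp
    then show "W (P r t) * critical_value < 1" using eq by simp
  qed (use t in auto)
qed

text \<open>If \<open>W * k > 1\<close> somewhere on the segment, some \<open>k'\<close> slightly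
  below \<open>k\<close> contradicts \<open>segment_below_level\<close>. So
  \<open>W * k \<le> 1\<close> throughout, and equality at an interior point would be an interior
  maximum of \<open>W\<close>.\<close>

lemma open_segment_subset_sublevel:
  assumes k: "critical_value < k" and xy: "x \<in> closure (sublevel k)" "y \<in> closure (sublevel k)" "x \<noteq> y"
  shows "open_segment x y \<subseteq> sublevel k"
proof
  have x: "norm (x - a) \<le> critical_radius" "W x * k \<le> 1"
    and y: "norm (y - a) \<le> critical_radius" "W y * k \<le> 1"
    using xy closure_sublevel[OF k] by auto
  define g where "g s = x + s *\<^sub>R (y - x)" for s
  have k0: "0 < k" using k critical_value_ge_1 by simp
  have le: "W (g s) * k \<le> 1" if s: "0 \<le> s" "s \<le> 1" for s
  proof (rule ccontr)
    assume "\<not> W (g s) * k \<le> 1"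
    then have Wk: "1 < W (g s) * k" by simp
    then have W: "0 < W (g s)" using k0 by (metis less_trans zero_less_mult_pos2 zero_less_one)
    then have "1 / W (g s) < k" using Wk by (simp add: divide_less_eq mult.commute)
    with k obtain k' where k': "max critical_value (1 / W (g s)) < k'" "k' < k"
      using dense[of "max critical_value (1 / W (g s))" k] by auto
    then have "1 < W (g s) * k'" using W by (simp add: divide_less_eq mult.commute)
    then show False using segment_below_level[OF _ k'(2) x y xy(3) s] k'(1) by (simp add: g_def)
  qed
  fix z assume "z \<in> open_segment x y"
  then obtain s where s: "0 < s" "s < 1" "z = (1 - s) *\<^sub>R x + s *\<^sub>R y" by (auto simp: in_segment)
  then have z: "z = g s" by (simp add: g_def algebra_simps)
  have "W z * k < 1"
  proof (rule ccontr)
    assume "\<not> W z * k < 1"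
    with le[of s] s z have eq: "W (g s) * k = 1" by simp
    have "W (g t) \<le> W (g s)" if "0 \<le> t" "t \<le> 1" for t
    proof -
      have "W (g t) * k \<le> W (g s) * k" using le[OF that] eq by simp
      then show ?thesis using k0 by simp
    qed
    moreover have "0 < W (g s)" using eq k0 by (metis zero_less_mult_pos2 zero_less_one)
    then have "W (g s) * critical_value < W (g s) * k" using k by simp
    then have "W (g s) * critical_value < 1" using eq by simp
    ultimately show False
      using no_interior_max_of_W[OF x(1) y(1) xy(3) s(1,2)] unfolding g_def by blast
  qed
  moreover have "z \<in> cball a critical_radius"
    unfolding s(3) using x(1) y(1) s(1,2)
    by (intro convexD_alt[OF convex_cball]) (auto simp: dist_norm norm_minus_commute)
  then have "norm (z - a) \<le> critical_radius" by (simp add: dist_norm norm_minus_commute)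
  ultimately show "z \<in> sublevel k" by (intro sublevelI[OF k])
qed

lemma strictly_convex_sublevel:
  assumes k: "critical_value < k"
  shows "strictly_convex_domain UNIV (sublevel k)"
proof -
  have "a \<in> sublevel k" using critical_radius_pos by (simp add: sublevel_def)
  then show ?thesis
    using open_sublevel bounded_sublevel open_segment_subset_sublevel[OF k]
    by (auto simp: strictly_convex_domain_def)
qed

end

section \<open>Curves in polar coordinates\<close>

lemma bounds_strictly_convex_domain_translation:
  fixes F :: "'a::euclidean_space set"
  assumes "bounds_strictly_convex_domain UNIV F"
  shows "bounds_strictly_convex_domain UNIV ((+) v ` F)"
proof -
  obtain D where D: "strictly_convex_domain UNIV D" "F = closure D - D"
    using assms by (auto simp: bounds_strictly_convex_domain_def)
  have "strictly_convex_domain UNIV ((+) v ` D)"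
    unfolding strictly_convex_domain_def closure_translation
  proof (intro conjI ballI impI)
    show "(+) v ` D \<noteq> {}" "bounded ((+) v ` D)" "openin (top_of_set UNIV) ((+) v ` D)"
      using D(1) by (auto simp: strictly_convex_domain_def bounded_translation open_translation)
    fix x y assume "x \<in> (+) v ` closure D" "y \<in> (+) v ` closure D" "x \<noteq> y"
    then obtain x' y' where "x = v + x'" "y = v + y'" "x' \<in> closure D" "y' \<in> closure D" "x' \<noteq> y'"
      by auto
    then show "open_segment x y \<subseteq> (+) v ` D"
      using D(1) by (simp add: open_segment_translation image_mono strictly_convex_domain_def)
  qed
  moreover have "(+) v ` F = closure ((+) v ` D) - (+) v ` D"
    unfolding D(2) closure_translation by (simp add: image_set_diff)
  moreover obtain \<gamma> where g: "regular_closed_curve \<gamma>" "range \<gamma> = F" "\<And>t. curvature \<gamma> t \<noteq> 0"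
    using assms by (auto simp: bounds_strictly_convex_domain_def)
  note d = regular_closed_curve_derivatives[OF g(1)]
  have r: "regular_closed_curve (\<lambda>t. v + \<gamma> t)" "velocity (\<lambda>t. v + \<gamma> t) = velocity \<gamma>"
    "acceleration (\<lambda>t. v + \<gamma> t) = acceleration \<gamma>"
  proof -
    have d1: "((\<lambda>t. v + \<gamma> t) has_vector_derivative velocity \<gamma> t) (at t)" for t
      using has_vector_derivative_add[OF has_vector_derivative_const d(1)] by simp
    have "v + \<gamma> (t + 1) = v + \<gamma> t" for t using g(1) by (simp add: regular_closed_curve_def)
    moreover have "inj_on (\<lambda>t. v + \<gamma> t) {0..<1}"
      using g(1) by (simp add: regular_closed_curve_def inj_on_def)
    moreover have "velocity \<gamma> t \<noteq> 0" for t using g(1) by (simp add: regular_closed_curve_def)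
    ultimately show "regular_closed_curve (\<lambda>t. v + \<gamma> t)" "velocity (\<lambda>t. v + \<gamma> t) = velocity \<gamma>"
      "acceleration (\<lambda>t. v + \<gamma> t) = acceleration \<gamma>"
      by (rule regular_closed_curveI[OF d1 d(2,3)])+
  qed
  moreover have "curvature (\<lambda>t. v + \<gamma> t) t \<noteq> 0" for t
    using g(3)[of t] unfolding curvature_nonzero_iff r .
  moreover have "range (\<lambda>t. v + \<gamma> t) = (+) v ` F" using g(2) by auto
  ultimately show ?thesis unfolding bounds_strictly_convex_domain_def by blast
qed

context two_centers
begin

lemma frame_surj: obtains x y where "v = frame x y"
proof -
  define f1 f2 where "f1 = (b - a) $ 1" and "f2 = (b - a) $ 2"
  have f: "f1\<^sup>2 + f2\<^sup>2 = 1" using unit_axis by (simp add: f1_def f2_def)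
  let ?x = "v $ 1 * f1 + v $ 2 * f2" and ?y = "v $ 2 * f1 - v $ 1 * f2"
  have "frame ?x ?y $ 1 = v $ 1 * (f1\<^sup>2 + f2\<^sup>2)" "frame ?x ?y $ 2 = v $ 2 * (f1\<^sup>2 + f2\<^sup>2)"
    unfolding frame_def vector_add_component vector_scaleR_component
    unfolding f1_def[symmetric] f2_def[symmetric]
    by (simp_all add: power2_eq_square algebra_simps)
  then have "v = frame ?x ?y" by (simp add: f vec_eq_iff forall_2)
  then show ?thesis by (rule that)
qed

lemma frame_eq_iff: "frame x y = frame x' y' \<longleftrightarrow> x = x' \<and> y = y'"
proof -
  have "frame x y = frame x' y' \<longleftrightarrow> norm (frame (x - x') (y - y')) = 0"
    by (simp add: frame_diff[symmetric])
  then show ?thesis by (simp add: norm_frame)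
qed

lemma frame_0 [simp]: "frame 0 0 = 0"
  by (simp add: frame_def)

lemma has_vector_derivative_frame:
  assumes "(x has_real_derivative x') (at t)" "(y has_real_derivative y') (at t)"
  shows "((\<lambda>t. frame (x t) (y t)) has_vector_derivative frame x' y') (at t)"
proof -
  note d = assms[unfolded has_real_derivative_iff_has_vector_derivative]
  show ?thesis unfolding frame_def
    by (intro has_vector_derivative_add
        bounded_linear.has_vector_derivative[OF bounded_linear_scaleR_left] d)
qed

definition polar :: "(real \<Rightarrow> real) \<Rightarrow> real \<Rightarrow> real^2" where
  "polar r t = frame (r (2 * pi * t) * cos (2 * pi * t)) (r (2 * pi * t) * sin (2 * pi * t))"

lemma norm_polar: "0 \<le> r (2 * pi * t) \<Longrightarrow> norm (polar r t) = r (2 * pi * t)"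
proof -
  assume "0 \<le> r (2 * pi * t)"
  moreover have "(r (2 * pi * t) * cos (2 * pi * t))\<^sup>2 + (r (2 * pi * t) * sin (2 * pi * t))\<^sup>2 = (r (2 * pi * t))\<^sup>2"
    by (simp add: power_mult_distrib flip: distrib_left)
  ultimately show ?thesis by (simp add: polar_def norm_frame)
qed

text \<open>Injectivity: the norm recovers the radius, after which cosine and sine fix the angle up
  to full turns. Regularity: the squared speed is \<open>(2 * pi)^2 * (r1^2 + r^2)\<close>.\<close>

lemma regular_closed_curve_polar:
  assumes r: "\<And>\<theta>. (r has_real_derivative r1 \<theta>) (at \<theta>)" "\<And>\<theta>. (r1 has_real_derivative r2 \<theta>) (at \<theta>)"
    and c2: "continuous_on UNIV r2"
    and pos: "\<And>\<theta>. 0 < r \<theta>" and per: "\<And>\<theta>. r (\<theta> + 2 * pi) = r \<theta>"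
  shows "regular_closed_curve (\<lambda>t. v + polar r t)"
    and "velocity (\<lambda>t. v + polar r t) = (\<lambda>t. (2 * pi) *\<^sub>R
      frame (r1 (2 * pi * t) * cos (2 * pi * t) - r (2 * pi * t) * sin (2 * pi * t))
        (r1 (2 * pi * t) * sin (2 * pi * t) + r (2 * pi * t) * cos (2 * pi * t)))"
    and "acceleration (\<lambda>t. v + polar r t) = (\<lambda>t. (2 * pi)\<^sup>2 *\<^sub>R
      frame ((r2 (2 * pi * t) - r (2 * pi * t)) * cos (2 * pi * t) - 2 * r1 (2 * pi * t) * sin (2 * pi * t))
        ((r2 (2 * pi * t) - r (2 * pi * t)) * sin (2 * pi * t) + 2 * r1 (2 * pi * t) * cos (2 * pi * t)))"
proof -
  define \<gamma>1 where "\<gamma>1 t = (2 * pi) *\<^sub>R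
      frame (r1 (2 * pi * t) * cos (2 * pi * t) - r (2 * pi * t) * sin (2 * pi * t))
        (r1 (2 * pi * t) * sin (2 * pi * t) + r (2 * pi * t) * cos (2 * pi * t))" for t
  define \<gamma>2 where "\<gamma>2 t = (2 * pi)\<^sup>2 *\<^sub>R
      frame ((r2 (2 * pi * t) - r (2 * pi * t)) * cos (2 * pi * t) - 2 * r1 (2 * pi * t) * sin (2 * pi * t))
        ((r2 (2 * pi * t) - r (2 * pi * t)) * sin (2 * pi * t) + 2 * r1 (2 * pi * t) * cos (2 * pi * t))" for t
  have lin: "((\<lambda>t. 2 * pi * t) has_real_derivative 2 * pi) (at t)" for t
    by (auto intro!: derivative_eq_intros)
  note rd = DERIV_chain2[OF r(1) lin] DERIV_chain2[OF r(2) lin]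
  have d1: "((\<lambda>t. v + polar r t) has_vector_derivative \<gamma>1 t) (at t)" for t
  proof -
    have "((\<lambda>t. polar r t) has_vector_derivative \<gamma>1 t) (at t)"
      unfolding polar_def \<gamma>1_def frame_scaleR
      by (rule has_vector_derivative_frame; (rule derivative_eq_intros rd refl | simp add: algebra_simps)+)
    from has_vector_derivative_add[OF has_vector_derivative_const this] show ?thesis by simp
  qed
  moreover have d2: "(\<gamma>1 has_vector_derivative \<gamma>2 t) (at t)" for t
    unfolding \<gamma>1_def \<gamma>2_def frame_scaleR
    by (rule has_vector_derivative_frame;
        (rule derivative_eq_intros rd refl | simp add: algebra_simps power2_eq_square)+)
  moreover have "continuous_on UNIV \<gamma>2"
  proof -
    have c: "continuous_on UNIV r" "continuous_on UNIV r1"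
      using DERIV_isCont[OF r(1)] DERIV_isCont[OF r(2)] by (auto simp: continuous_on_eq_continuous_at)
    show ?thesis unfolding \<gamma>2_def
      by (intro continuous_intros continuous_on_compose2[OF c2] continuous_on_compose2[OF c(1)]
          continuous_on_compose2[OF c(2)]) auto
  qed
  moreover have "v + polar r (t + 1) = v + polar r t" for t
    using per[of "2 * pi * t"] by (simp add: polar_def distrib_left)
  moreover have "inj_on (\<lambda>t. v + polar r t) {0..<1}"
  proof (rule inj_onI)
    fix s t :: real assume s: "s \<in> {0..<1}" and t: "t \<in> {0..<1}" and "v + polar r s = v + polar r t"
    then have eq: "polar r s = polar r t" by simp
    then have "r (2 * pi * s) = r (2 * pi * t)"
      using norm_polar[of r s] norm_polar[of r t] pos by (simp add: less_imp_le)
    then have "sin (2 * pi * s) = sin (2 * pi * t) \<and> cos (2 * pi * s) = cos (2 * pi * t)"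
      using eq pos[of "2 * pi * t"] by (simp add: polar_def frame_eq_iff)
    then obtain n :: int where "2 * pi * s = 2 * pi * t + 2 * pi * n"
      unfolding sin_cos_eq_iff by blast
    then have "2 * pi * s = 2 * pi * (t + n)" by (simp add: distrib_left)
    then have n: "s = t + n" by simp
    then have "n = 0" using s t by simp
    with n show "s = t" by simp
  qed
  moreover have "\<gamma>1 t \<noteq> 0" for t
  proof -
    define A B C S where "A = r1 (2 * pi * t)" and "B = r (2 * pi * t)"
      and "C = cos (2 * pi * t)" and "S = sin (2 * pi * t)"
    have "S\<^sup>2 + C\<^sup>2 = 1" by (simp add: S_def C_def)
    moreover have "(A * C - B * S)\<^sup>2 + (A * S + B * C)\<^sup>2 = (A\<^sup>2 + B\<^sup>2) * (S\<^sup>2 + C\<^sup>2)"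
      by (simp add: power2_eq_square algebra_simps)
    ultimately have "(A * C - B * S)\<^sup>2 + (A * S + B * C)\<^sup>2 = A\<^sup>2 + B\<^sup>2" by simp
    moreover have "0 < A\<^sup>2 + B\<^sup>2" using pos[of "2 * pi * t"] by (simp add: B_def add_nonneg_pos)
    ultimately have "norm (frame (A * C - B * S) (A * S + B * C)) \<noteq> 0"
      unfolding norm_frame by (metis less_irrefl real_sqrt_eq_zero_cancel_iff)
    then show ?thesis by (simp add: \<gamma>1_def A_def B_def C_def S_def)
  qed
  ultimately have "regular_closed_curve (\<lambda>t. v + polar r t)" "velocity (\<lambda>t. v + polar r t) = \<gamma>1"
    "acceleration (\<lambda>t. v + polar r t) = \<gamma>2"
    by (rule regular_closed_curveI)+
  then show "regular_closed_curve (\<lambda>t. v + polar r t)"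
    and "velocity (\<lambda>t. v + polar r t) = (\<lambda>t. (2 * pi) *\<^sub>R
      frame (r1 (2 * pi * t) * cos (2 * pi * t) - r (2 * pi * t) * sin (2 * pi * t))
        (r1 (2 * pi * t) * sin (2 * pi * t) + r (2 * pi * t) * cos (2 * pi * t)))"
    and "acceleration (\<lambda>t. v + polar r t) = (\<lambda>t. (2 * pi)\<^sup>2 *\<^sub>R
      frame ((r2 (2 * pi * t) - r (2 * pi * t)) * cos (2 * pi * t) - 2 * r1 (2 * pi * t) * sin (2 * pi * t))
        ((r2 (2 * pi * t) - r (2 * pi * t)) * sin (2 * pi * t) + 2 * r1 (2 * pi * t) * cos (2 * pi * t)))"
    by (auto simp: \<gamma>1_def \<gamma>2_def fun_eq_iff)
qed

lemma frame_polar_coordinates: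
  assumes "w \<noteq> 0"
  obtains \<theta> where "w = frame (norm w * cos \<theta>) (norm w * sin \<theta>)"
proof -
  obtain x y where w: "w = frame x y" by (rule frame_surj)
  let ?n = "norm w"
  have n: "?n\<^sup>2 = x\<^sup>2 + y\<^sup>2" by (simp add: w norm_frame)
  have "(x / ?n)\<^sup>2 + (y / ?n)\<^sup>2 = 1"
    unfolding power_divide add_divide_distrib[symmetric] n[symmetric] using assms by simp
  then obtain \<theta> where "x / ?n = cos \<theta>" "y / ?n = sin \<theta>" by (rule sincos_total_2pi)
  then have "x = ?n * cos \<theta>" "y = ?n * sin \<theta>" using assms by (simp_all add: field_simps)
  then show ?thesis using w that by metis
qed

lemma range_polar:
  assumes pos: "\<And>\<theta>. 0 < r \<theta>"
  shows "range (\<lambda>t. v + polar r t) = {v + frame (r \<theta> * cos \<theta>) (r \<theta> * sin \<theta>) |\<theta>. True}"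
proof (intro subset_antisym subsetI)
  fix x assume "x \<in> {v + frame (r \<theta> * cos \<theta>) (r \<theta> * sin \<theta>) |\<theta>. True}"
  then obtain \<theta> where "x = v + frame (r \<theta> * cos \<theta>) (r \<theta> * sin \<theta>)" by blast
  then have "x = v + polar r (\<theta> / (2 * pi))" by (simp add: polar_def)
  then show "x \<in> range (\<lambda>t. v + polar r t)" by blast
qed (auto simp: polar_def)

text \<open>Will be applied to the fiber over the north pole. The curvature is nonzero because the
  acceleration of the circle is radial and its velocity tangential.\<close>

lemma bounds_strictly_convex_domain_sphere:
  assumes "0 < s"
  shows "bounds_strictly_convex_domain UNIV (sphere (0::real^2) s)"
proof -
  have "open_segment x y \<subseteq> ball 0 s" if "x \<in> cball 0 s" "y \<in> cball 0 s" for x y :: "real^2"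
  proof
    fix z assume "z \<in> open_segment x y"
    from dist_decreases_open_segment[OF this, of 0] that show "z \<in> ball 0 s" by auto
  qed
  then have "strictly_convex_domain UNIV (ball (0::real^2) s)"
    using assms by (simp add: strictly_convex_domain_def)
  moreover have "sphere (0::real^2) s = closure (ball 0 s) - ball 0 s"
    using assms by auto
  moreover note c = regular_closed_curve_polar[of "\<lambda>_. s" "\<lambda>_. 0" "\<lambda>_. 0" 0, OF _ _ _ assms refl]
  have "regular_closed_curve (\<lambda>t. 0 + polar (\<lambda>_. s) t)"
    by (rule c(1)) auto
  moreover have "curvature (\<lambda>t. 0 + polar (\<lambda>_. s) t) t \<noteq> 0" for t
  proof -
    let ?\<gamma> = "\<lambda>t. 0 + polar (\<lambda>_. s) t"
    define C S where "C = cos (2 * pi * t)" and "S = sin (2 * pi * t)"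
    have CS: "C\<^sup>2 + S\<^sup>2 = 1" by (simp add: C_def S_def)
    have v: "velocity ?\<gamma> t = (2 * pi) *\<^sub>R frame (- (s * S)) (s * C)"
      by (subst c(2)) (auto simp: C_def S_def)
    have w: "acceleration ?\<gamma> t = (2 * pi)\<^sup>2 *\<^sub>R frame (- (s * C)) (- (s * S))"
      by (subst c(3)) (auto simp: C_def S_def)
    have "acceleration ?\<gamma> t \<noteq> m *\<^sub>R velocity ?\<gamma> t" for m
    proof
      assume "acceleration ?\<gamma> t = m *\<^sub>R velocity ?\<gamma> t"
      then have e: "(2 * pi)\<^sup>2 * (- (s * C)) = m * (2 * pi * (- (s * S)))"
        "(2 * pi)\<^sup>2 * (- (s * S)) = m * (2 * pi * (s * C))"
        unfolding v w frame_scaleR frame_eq_iff by blast+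
      have "(2 * pi)\<^sup>2 * s * (C\<^sup>2 + S\<^sup>2) =
          - ((2 * pi)\<^sup>2 * (- (s * C)) * C + (2 * pi)\<^sup>2 * (- (s * S)) * S)"
        by (simp add: power2_eq_square algebra_simps)
      also have "\<dots> = 0" unfolding e by (simp add: algebra_simps)
      finally show False using CS assms by simp
    qed
    moreover have "velocity ?\<gamma> t \<noteq> 0"
    proof
      assume "velocity ?\<gamma> t = 0"
      then have "frame (- (s * S)) (s * C) = frame 0 0" unfolding v by simp
      then show False using CS assms unfolding frame_eq_iff by simp
    qed
    ultimately show ?thesis unfolding curvature_nonzero_iff by blast
  qed
  moreover have "range (\<lambda>t. 0 + polar (\<lambda>_. s) t) = sphere 0 s"
  proof (intro subset_antisym subsetI)
    fix x assume "x \<in> range (\<lambda>t. 0 + polar (\<lambda>_. s) t)"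
    then show "x \<in> sphere 0 s" using assms by (auto simp: norm_polar)
  next
    fix x :: "real^2" assume x: "x \<in> sphere 0 s"
    then have "x \<noteq> 0" using assms by auto
    then obtain \<theta> where "x = frame (norm x * cos \<theta>) (norm x * sin \<theta>)" by (rule frame_polar_coordinates)
    then show "x \<in> range (\<lambda>t. 0 + polar (\<lambda>_. s) t)"
      unfolding range_polar[OF assms] using x by auto
  qed
  ultimately show ?thesis unfolding bounds_strictly_convex_domain_def by blast
qed

end

section \<open>Equal masses: the level curves\<close>

text \<open>On the level curve \<open>1 / r + 1 / \<rho> = \<kappa>\<close>, where \<open>r\<close> and \<open>\<rho>\<close> are the distances to the two centers,
  the law of cosines gives the cosine of the polar angle as an explicit function of \<open>r\<close>.\<close>
definition radial_cos :: "real \<Rightarrow> real \<Rightarrow> real" where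
  "radial_cos \<kappa> r = (r + 1 / r - r / (\<kappa> * r - 1)\<^sup>2) / 2"

definition radial_cos' :: "real \<Rightarrow> real \<Rightarrow> real" where
  "radial_cos' \<kappa> r = (1 - 1 / r\<^sup>2 + (\<kappa> * r + 1) / (\<kappa> * r - 1) ^ 3) / 2"

definition radial_cos'' :: "real \<Rightarrow> real \<Rightarrow> real" where
  "radial_cos'' \<kappa> r = 1 / r ^ 3 - \<kappa> * (\<kappa> * r + 2) / (\<kappa> * r - 1) ^ 4"

lemma has_real_derivative_radial_cos:
  assumes "r \<noteq> 0" "\<kappa> * r - 1 \<noteq> 0"
  shows "(radial_cos \<kappa> has_real_derivative radial_cos' \<kappa> r) (at r)"
proof -
  let ?e = "\<kappa> * r - 1"
  have "((\<lambda>r. (r + 1 / r - r / (\<kappa> * r - 1)\<^sup>2) / 2) has_real_derivative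
      (1 - 1 / r\<^sup>2 - (?e\<^sup>2 - r * (2 * ?e * \<kappa>)) / (?e\<^sup>2 * ?e\<^sup>2)) / 2) (at r)"
    using assms by (auto intro!: derivative_eq_intros simp: power2_eq_square)
  moreover have "(?e\<^sup>2 - r * (2 * ?e * \<kappa>)) / (?e\<^sup>2 * ?e\<^sup>2) = - ((\<kappa> * r + 1) / ?e ^ 3)"
  proof -
    have "?e\<^sup>2 - r * (2 * ?e * \<kappa>) = ?e * - (\<kappa> * r + 1)" by (simp add: power2_eq_square algebra_simps)
    moreover have "?e\<^sup>2 * ?e\<^sup>2 = ?e * ?e ^ 3" by (simp add: eval_nat_numeral)
    ultimately show ?thesis
      by (simp only: mult_divide_mult_cancel_left[OF assms(2)] minus_divide_left)
  qed
  ultimately show ?thesis by (simp add: radial_cos_def[abs_def] radial_cos'_def)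
qed

lemma has_real_derivative_radial_cos':
  assumes "r \<noteq> 0" "\<kappa> * r - 1 \<noteq> 0"
  shows "(radial_cos' \<kappa> has_real_derivative radial_cos'' \<kappa> r) (at r)"
proof -
  let ?e = "\<kappa> * r - 1"
  have "((\<lambda>r. (1 - 1 / r\<^sup>2 + (\<kappa> * r + 1) / (\<kappa> * r - 1) ^ 3) / 2) has_real_derivative
      ((2 * r) / (r\<^sup>2 * r\<^sup>2) + (\<kappa> * ?e ^ 3 - (\<kappa> * r + 1) * (3 * ?e\<^sup>2 * \<kappa>)) / (?e ^ 3 * ?e ^ 3)) / 2) (at r)"
    using assms by (auto intro!: derivative_eq_intros)
  moreover have "(\<kappa> * ?e ^ 3 - (\<kappa> * r + 1) * (3 * ?e\<^sup>2 * \<kappa>)) / (?e ^ 3 * ?e ^ 3) = - (2 * \<kappa> * (\<kappa> * r + 2)) / ?e ^ 4"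
  proof -
    have "\<kappa> * ?e ^ 3 - (\<kappa> * r + 1) * (3 * ?e\<^sup>2 * \<kappa>) = ?e\<^sup>2 * - (2 * \<kappa> * (\<kappa> * r + 2))"
      by (simp add: power2_eq_square power3_eq_cube algebra_simps)
    moreover have "?e ^ 3 * ?e ^ 3 = ?e\<^sup>2 * ?e ^ 4" by (simp add: eval_nat_numeral)
    moreover have e0: "?e\<^sup>2 \<noteq> 0" using assms(2) by simp
    ultimately show ?thesis by (simp only: mult_divide_mult_cancel_left[OF e0])
  qed
  moreover have "(2 * r) / (r\<^sup>2 * r\<^sup>2) = 2 / r ^ 3"
    using assms(1) by (simp add: eval_nat_numeral)
  ultimately show ?thesis
    by (simp add: radial_cos'_def[abs_def] radial_cos''_def diff_divide_distrib)
qed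

text \<open>\<open>r / (\<kappa> * r - 1)\<close> is the distance \<rho> to the second center given
  by \<open>1 / r + 1 / \<rho> = \<kappa>\<close>; the right sides compare its square with the law
  of cosines.\<close>

lemma radial_cos_eq_iff:
  assumes "0 < r" "1 < \<kappa> * r"
  shows "radial_cos \<kappa> r = c \<longleftrightarrow> r\<^sup>2 + 1 - 2 * r * c = (r / (\<kappa> * r - 1))\<^sup>2"
    and "c < radial_cos \<kappa> r \<longleftrightarrow> (r / (\<kappa> * r - 1))\<^sup>2 < r\<^sup>2 + 1 - 2 * r * c"
proof -
  have "2 * r * ((r + 1 / r - X) / 2) = r\<^sup>2 + 1 - r * X" for X
    using assms(1) by (simp add: power2_eq_square distrib_left right_diff_distrib)
  then have "2 * r * radial_cos \<kappa> r = r\<^sup>2 + 1 - (r / (\<kappa> * r - 1))\<^sup>2"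
    unfolding radial_cos_def by (simp add: power_divide power2_eq_square[of r])
  then have e: "r\<^sup>2 + 1 - 2 * r * c - (r / (\<kappa> * r - 1))\<^sup>2 = 2 * r * (radial_cos \<kappa> r - c)"
    by (simp add: right_diff_distrib)
  show "radial_cos \<kappa> r = c \<longleftrightarrow> r\<^sup>2 + 1 - 2 * r * c = (r / (\<kappa> * r - 1))\<^sup>2"
    using e assms(1) by (metis eq_iff_diff_eq_0 less_irrefl mult_eq_0_iff zero_neq_numeral)
  have "c < radial_cos \<kappa> r \<longleftrightarrow> 0 < 2 * r * (radial_cos \<kappa> r - c)"
    using assms(1) by (simp add: zero_less_mult_iff)
  then show "c < radial_cos \<kappa> r \<longleftrightarrow> (r / (\<kappa> * r - 1))\<^sup>2 < r\<^sup>2 + 1 - 2 * r * c"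
    unfolding e[symmetric] by linarith
qed

text \<open>Solves the level equation for the radius, given the cosine of the angle.
  \<open>J\<close> is open and reaches past the radius with value 1, because
  \<open>g (cos \<theta>)\<close> must be differentiable also where
  \<open>cos \<theta> = 1\<close>.\<close>

lemma radial_cos_inverse:
  fixes \<kappa> :: real
  assumes \<kappa>: "4 < \<kappa>"
  obtains J g where "open J" "J \<subseteq> {1 / \<kappa> <..< 1 / 2}" "\<forall>r\<in>J. 0 < radial_cos' \<kappa> r"
    "\<forall>r\<in>J. g (radial_cos \<kappa> r) = r"
    "\<forall>c. \<bar>c\<bar> \<le> 1 \<longrightarrow> g c \<in> J \<and> radial_cos \<kappa> (g c) = c"
    "\<forall>r. 1 / \<kappa> < r \<and> r < 1 / 2 \<and> radial_cos \<kappa> r \<le> 1 \<longrightarrow> r \<in> J"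
proof -
  let ?h = "radial_cos \<kappa>"
  have \<kappa>r: "0 < r \<and> 1 < \<kappa> * r" if "1 / \<kappa> < r" for r
    using that \<kappa> by (auto simp: divide_less_eq mult.commute intro: less_trans[of 0 "1 / \<kappa>"])
  \<comment> \<open>The radius on the axis towards the other center: the smaller root of
    \<open>1 / R + 1 / (1 - R) = \<kappa>\<close>, which is less than \<open>1 / 2\<close> since
    \<open>4 < \<kappa>\<close>.\<close>
  define R where "R = (1 - sqrt (1 - 4 / \<kappa>)) / 2"
  have sq: "0 < sqrt (1 - 4 / \<kappa>)" "(sqrt (1 - 4 / \<kappa>))\<^sup>2 = 1 - 4 / \<kappa>" using \<kappa> by simp_all
  have R12: "R < 1 / 2" using sq(1) by (simp add: R_def)
  have "R * (1 - R) = (1 - (sqrt (1 - 4 / \<kappa>))\<^sup>2) / 4" by (simp add: R_def power2_eq_square field_simps)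
  then have Reqn: "\<kappa> * R * (1 - R) = 1" using \<kappa> unfolding sq(2) by (simp add: field_simps)
  have phi: "\<kappa> * r\<^sup>2 - \<kappa> * r + 1 = \<kappa> * (r - R) * (r - (1 - R))" for r
    using Reqn by (simp add: power2_eq_square algebra_simps)
  have R_iff: "r \<le> R \<longleftrightarrow> \<kappa> * r - 1 \<le> r * (\<kappa> * r)" if "r < 1 / 2" for r
  proof -
    have "r * (\<kappa> * r) - (\<kappa> * r - 1) = (\<kappa> * (1 - R - r)) * (R - r)"
      using phi[of r] by (simp add: power2_eq_square algebra_simps)
    moreover have "0 < \<kappa> * (1 - R - r)" using that R12 \<kappa> by simp
    ultimately show ?thesis by (smt (verit) mult_nonneg_nonneg mult_pos_neg)
  qed
  have le1: "?h r \<le> 1 \<longleftrightarrow> r \<le> R" if r: "1 / \<kappa> < r" "r < 1 / 2" for r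
  proof -
    have e: "0 < r" "0 < \<kappa> * r - 1" using \<kappa>r[OF r(1)] by auto
    have "?h r \<le> 1 \<longleftrightarrow> (1 - r)\<^sup>2 \<le> (r / (\<kappa> * r - 1))\<^sup>2"
      using radial_cos_eq_iff(2)[of r \<kappa> 1] e by (simp add: power2_eq_square algebra_simps not_less[symmetric])
    also have "\<dots> \<longleftrightarrow> 1 - r \<le> r / (\<kappa> * r - 1)"
      using e r by (intro power_mono_iff) auto
    also have "\<dots> \<longleftrightarrow> r \<le> R"
      unfolding R_iff[OF r(2)] pos_le_divide_eq[OF e(2)] by (simp add: algebra_simps)
    finally show ?thesis .
  qed
  \<comment> \<open>With \<open>e = \<kappa> * r - 1\<close>, the condition \<open>r \<le> R\<close>
    reads \<open>e / (e + 1) \<le> r\<close>. Inserting this lower bound for \<open>r\<close>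
    reduces the claim to \<open>e^2 < 1\<close>, and \<open>r < 1 / 2\<close> gives
    \<open>e < 1\<close>.\<close>
  have pos: "0 < radial_cos' \<kappa> r" if r: "1 / \<kappa> < r" "r \<le> R" for r
  proof -
    define e where "e = \<kappa> * r - 1"
    have e: "0 < e" and r0: "0 < r" using \<kappa>r[OF r(1)] by (auto simp: e_def)
    have "e \<le> r * (e + 1)" using R_iff[of r] r R12 by (simp add: e_def)
    then have er: "e / (e + 1) \<le> r" using e by (simp add: pos_divide_le_eq)
    then have "e / (e + 1) < 1 / 2" using r(2) R12 by linarith
    then have e1: "e < 1" using e by (simp add: field_simps)
    have "(e / (e + 1))\<^sup>2 \<le> r\<^sup>2" using er e by (intro power_mono) auto
    then have "(e / (e + 1))\<^sup>2 * (1 + (e + 2) / e ^ 3) \<le> r\<^sup>2 * (1 + (e + 2) / e ^ 3)"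
      using e by (intro mult_right_mono) auto
    moreover have "1 < (e / (e + 1))\<^sup>2 * (1 + (e + 2) / e ^ 3)"
    proof -
      have "(e / (e + 1))\<^sup>2 * (1 + (e + 2) / e ^ 3) = (e ^ 3 + e + 2) / (e * (e + 1)\<^sup>2)"
      proof -
        have "1 + (e + 2) / e ^ 3 = (e ^ 3 + e + 2) / e ^ 3" using e by (simp add: add_divide_distrib)
        then have "(e / (e + 1))\<^sup>2 * (1 + (e + 2) / e ^ 3) = e\<^sup>2 * (e ^ 3 + e + 2) / ((e + 1)\<^sup>2 * e ^ 3)"
          by (simp only: power_divide times_divide_times_eq)
        also have "\<dots> = e\<^sup>2 * (e ^ 3 + e + 2) / (e\<^sup>2 * (e * (e + 1)\<^sup>2))"
          by (simp add: eval_nat_numeral mult_ac)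
        finally show ?thesis using e by simp
      qed
      moreover have "e * (e + 1)\<^sup>2 < e ^ 3 + e + 2"
      proof -
        have "e * e < 1" using e e1 mult_strict_mono[of e 1 e 1] by simp
        then show ?thesis by (simp add: eval_nat_numeral algebra_simps)
      qed
      moreover have "0 < e * (e + 1)\<^sup>2" using e by simp
      ultimately show ?thesis by simp
    qed
    ultimately have "1 < r\<^sup>2 * (1 + (e + 2) / e ^ 3)" by linarith
    then have "1 / r\<^sup>2 < 1 + (e + 2) / e ^ 3" using r0 by (simp add: divide_less_eq mult.commute)
    moreover have "\<kappa> * r + 1 = e + 2" by (simp add: e_def)
    ultimately have "0 < 1 - 1 / r\<^sup>2 + (\<kappa> * r + 1) / e ^ 3" by (simp only:)
    then show ?thesis unfolding radial_cos'_def e_def[symmetric] by simp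
  qed
  \<comment> \<open>Chosen so that the distance to the second center would have to be 2. This
    exceeds \<open>1 + r0\<close>, so no angle is possible and \<open>radial_cos\<close> is below
    \<open>- 1\<close>.\<close>
  define r0 where "r0 = 2 / (2 * \<kappa> - 1)"
  have r0: "1 / \<kappa> < r0" "r0 < 1 / 2" "r0 / (\<kappa> * r0 - 1) = 2"
    using \<kappa> by (simp_all add: r0_def divide_simps)
  have h0: "?h r0 < - 1"
  proof -
    have p: "0 < r0" "1 < \<kappa> * r0" using \<kappa>r[OF r0(1)] by auto
    have "r0\<^sup>2 + 1 - 2 * r0 * (-1) = (1 + r0)\<^sup>2" by (simp add: power2_eq_square algebra_simps)
    also have "\<dots> < (r0 / (\<kappa> * r0 - 1))\<^sup>2"
      unfolding r0(3) using p r0(2) by (intro power_strict_mono) auto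
    finally have "\<not> (-1 < ?h r0)" "?h r0 \<noteq> - 1"
      unfolding radial_cos_eq_iff[OF p] by auto
    then show ?thesis by simp
  qed
  have r0R: "r0 \<le> R" using le1[OF r0(1,2)] h0 by simp
  have R: "1 / \<kappa> < R" using r0 r0R by linarith
  have hR: "?h R = 1"
  proof -
    have p: "0 < R" "1 < \<kappa> * R" using \<kappa>r[OF R] by auto
    have "(1 - R) * (\<kappa> * R - 1) = R" using Reqn by (simp add: algebra_simps)
    moreover have "\<kappa> * R - 1 \<noteq> 0" using p by simp
    ultimately have RR: "R / (\<kappa> * R - 1) = 1 - R" by (metis nonzero_mult_div_cancel_right)
    show ?thesis unfolding radial_cos_eq_iff(1)[OF p] RR by (simp add: power2_eq_square algebra_simps)
  qed
  have deriv: "(?h has_real_derivative radial_cos' \<kappa> r) (at r)" if "1 / \<kappa> < r" for r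
    using \<kappa>r[OF that] by (intro has_real_derivative_radial_cos) auto
  have "isCont (radial_cos' \<kappa>) R"
    using \<kappa>r[OF R] by (intro DERIV_isCont[OF has_real_derivative_radial_cos']) auto
  then have "\<forall>\<^sub>F r in at_right R. 0 < radial_cos' \<kappa> r"
    using pos[OF R order.refl] order_tendstoD(1)[of "radial_cos' \<kappa>" "radial_cos' \<kappa> R" "at_right R" 0]
    by (simp add: isCont_def filterlim_at_split)
  then obtain b where b: "R < b" "\<And>r. R < r \<Longrightarrow> r < b \<Longrightarrow> 0 < radial_cos' \<kappa> r"
    unfolding eventually_at_right_field by auto
  define J where "J = {1 / \<kappa> <..< min b (1 / 2)}"
  have Jpos: "0 < radial_cos' \<kappa> r" if "r \<in> J" for r
    using that pos[of r] b(2)[of r] by (cases "r \<le> R") (auto simp: J_def)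
  have mono: "?h x < ?h y" if "x \<in> J" "y \<in> J" "x < y" for x y
  proof (rule DERIV_pos_imp_increasing[OF that(3)])
    fix z assume "x \<le> z" "z \<le> y"
    then have "z \<in> J" "1 / \<kappa> < z" using that by (auto simp: J_def)
    then show "\<exists>d. (?h has_real_derivative d) (at z) \<and> 0 < d" using deriv Jpos by blast
  qed
  then have inj: "inj_on ?h J" by (intro strict_mono_on_imp_inj_on strict_mono_onI)
  define g where "g = the_inv_into J ?h"
  have RJ: "R \<in> J" using R b(1) R12 by (auto simp: J_def)
  have g: "g (?h r) = r" if "r \<in> J" for r using inj that by (simp add: g_def the_inv_into_f_f)
  show ?thesis
  proof (rule that[of J g])
    show "open J" "J \<subseteq> {1 / \<kappa> <..< 1 / 2}" by (auto simp: J_def)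
    show "\<forall>r\<in>J. 0 < radial_cos' \<kappa> r" "\<forall>r\<in>J. g (?h r) = r" using Jpos g by blast+
    show "\<forall>r. 1 / \<kappa> < r \<and> r < 1 / 2 \<and> ?h r \<le> 1 \<longrightarrow> r \<in> J"
      using le1 b(1) by (auto simp: J_def)
    show "\<forall>c. \<bar>c\<bar> \<le> 1 \<longrightarrow> g c \<in> J \<and> ?h (g c) = c"
    proof (intro allI impI)
      fix c :: real assume c: "\<bar>c\<bar> \<le> 1"
      have "continuous_on {r0..R} ?h"
      proof (intro continuous_at_imp_continuous_on ballI)
        fix x assume "x \<in> {r0..R}"
        then have "1 / \<kappa> < x" using r0(1) by simp
        then show "isCont ?h x" by (rule DERIV_isCont[OF deriv])
      qed
      then obtain r where r: "r0 \<le> r" "r \<le> R" "?h r = c"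
        using IVT'[of ?h r0 c R] h0 hR r0R c by (auto simp: abs_le_iff)
      then have "r \<in> J" using r0(1) RJ by (auto simp: J_def)
      then show "g c \<in> J \<and> ?h (g c) = c" using g[of r] r(3) by metis
    qed
  qed
qed

context equal_masses
begin

text \<open>Since both masses are \<open>1 / 2\<close>, the equation \<open>V = k\<close> is
  \<open>1 / r + 1 / \<rho> = 2 k\<close>, hence \<kappa> is \<open>2 * k\<close>.\<close>

lemma polar_in_level_iff:
  assumes k: "2 < k" and r: "0 < r"
  shows "a + frame (r * cos \<theta>) (r * sin \<theta>) \<in> level k \<longleftrightarrow>
    1 / (2 * k) < r \<and> r < 1 / 2 \<and> radial_cos (2 * k) r = cos \<theta>"
proof -
  define q where "q = a + frame (r * cos \<theta>) (r * sin \<theta>)"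
  define \<rho> where "\<rho> = norm (q - b)"
  have "(r * cos \<theta>)\<^sup>2 + (r * sin \<theta>)\<^sup>2 = r\<^sup>2 * ((cos \<theta>)\<^sup>2 + (sin \<theta>)\<^sup>2)"
    by (simp only: power_mult_distrib distrib_left)
  then have "(r * cos \<theta>)\<^sup>2 + (r * sin \<theta>)\<^sup>2 = r\<^sup>2" by simp
  then have na: "norm (q - a) = r" using r by (simp add: q_def norm_frame)
  have "\<rho>\<^sup>2 = (r * cos \<theta> - 1)\<^sup>2 + (r * sin \<theta>)\<^sup>2" by (simp add: \<rho>_def q_def norm_frame_b)
  also have "\<dots> = r\<^sup>2 * ((cos \<theta>)\<^sup>2 + (sin \<theta>)\<^sup>2) + 1 - 2 * r * cos \<theta>"
    by algebra
  finally have \<rho>2: "\<rho>\<^sup>2 = r\<^sup>2 + 1 - 2 * r * cos \<theta>" by simp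
  have \<rho>0: "0 \<le> \<rho>" by (simp add: \<rho>_def)
  have "W q * k = 1 \<longleftrightarrow> r * \<rho> * k = 1 / 2 * \<rho> + 1 / 2 * r"
    using W_denominator_pos[of q] unfolding W_def na \<rho>_def[symmetric] unfolding half
    by (auto simp: field_simps)
  also have "\<dots> \<longleftrightarrow> \<rho> * (2 * k * r - 1) = r" by (auto simp: algebra_simps)
  finally have W: "W q * k = 1 \<longleftrightarrow> \<rho> * (2 * k * r - 1) = r" .
  have mem: "q \<in> level k \<longleftrightarrow> r \<le> 1 / 2 \<and> \<rho> * (2 * k * r - 1) = r"
    by (simp add: level_def na critical_radius_half W)
  have gt: "1 / (2 * k) < r \<longleftrightarrow> 1 < 2 * k * r" using k by (simp add: divide_less_eq mult.commute)
  show ?thesis unfolding q_def[symmetric]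
  proof
    assume q: "q \<in> level k"
    then have e: "\<rho> * (2 * k * r - 1) = r" "r \<le> 1 / 2" using mem by auto
    have "r \<noteq> 1 / 2"
      using W_critical_circle[of q k] q k by (auto simp: critical_radius_half critical_value_2 na level_def)
    moreover have e0: "1 < 2 * k * r"
      using e(1) r \<rho>0 by (smt (verit) mult_nonneg_nonpos)
    moreover have "\<rho> = r / (2 * k * r - 1)" using e(1) e0 by (simp add: eq_divide_eq)
    then have "radial_cos (2 * k) r = cos \<theta>"
      unfolding radial_cos_eq_iff(1)[OF r e0] using \<rho>2 by simp
    ultimately show "1 / (2 * k) < r \<and> r < 1 / 2 \<and> radial_cos (2 * k) r = cos \<theta>"
      using e(2) gt by simp
  next
    assume A: "1 / (2 * k) < r \<and> r < 1 / 2 \<and> radial_cos (2 * k) r = cos \<theta>"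
    then have e0: "1 < 2 * k * r" using gt by simp
    have "\<rho>\<^sup>2 = (r / (2 * k * r - 1))\<^sup>2"
      using A radial_cos_eq_iff(1)[OF r e0] \<rho>2 by simp
    then have "\<rho> = r / (2 * k * r - 1)" using \<rho>0 r e0 by (simp add: power2_eq_iff_nonneg)
    then show "q \<in> level k" using e0 A by (simp add: mem)
  qed
qed

text \<open>The radius \<open>g (cos \<theta>)\<close> is of class \<open>C^2\<close> by the inverse
  function theorem. For the curvature, \<open>V\<close> is constant on the curve, so the Hessian of
  the velocity plus the gradient applied to the acceleration is zero. If the acceleration were a
  multiple of the velocity, the gradient term would vanish by tangency, and so would the
  Hessian.\<close>

lemma level_curve:
  assumes k: "2 < k"
  obtains \<gamma> where "regular_closed_curve \<gamma>" "range \<gamma> = level k" "\<And>t. curvature \<gamma> t \<noteq> 0"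
proof -
  have k4: "4 < 2 * k" using k by simp
  obtain J g where J: "open J" "J \<subseteq> {1 / (2 * k) <..< 1 / 2}"
    "\<forall>r\<in>J. 0 < radial_cos' (2 * k) r" "\<forall>r\<in>J. g (radial_cos (2 * k) r) = r"
    and g: "\<forall>c. \<bar>c\<bar> \<le> 1 \<longrightarrow> g c \<in> J \<and> radial_cos (2 * k) (g c) = c"
    and inJ: "\<forall>r. 1 / (2 * k) < r \<and> r < 1 / 2 \<and> radial_cos (2 * k) r \<le> 1 \<longrightarrow> r \<in> J"
    by (rule radial_cos_inverse[OF k4])
  define r where "r \<theta> = g (cos \<theta>)" for \<theta>
  have r: "r \<theta> \<in> J" "radial_cos (2 * k) (r \<theta>) = cos \<theta>" for \<theta>
    using g[rule_format, of "cos \<theta>"] by (simp_all add: r_def)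
  have k0: "0 < 1 / (2 * k)" using k by simp
  have Jr: "0 < x" "2 * k * x - 1 \<noteq> 0" if "x \<in> J" for x
  proof -
    have "1 / (2 * k) < x" using that J(2) by auto
    then show "0 < x" "2 * k * x - 1 \<noteq> 0"
      using k k0 by (linarith, auto simp: divide_less_eq mult.commute)
  qed
  have pos: "0 < r \<theta>" for \<theta> using Jr(1)[OF r(1)] .
  define r1 where "r1 \<theta> = - sin \<theta> / radial_cos' (2 * k) (r \<theta>)" for \<theta>
  define r2 where "r2 \<theta> =
    (- cos \<theta> * radial_cos' (2 * k) (r \<theta>) - (- sin \<theta>) * (radial_cos'' (2 * k) (r \<theta>) * r1 \<theta>)) /
      (radial_cos' (2 * k) (r \<theta>) * radial_cos' (2 * k) (r \<theta>))" for \<theta>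
  have dg: "(g has_real_derivative inverse (radial_cos' (2 * k) (r \<theta>))) (at (cos \<theta>))" for \<theta>
  proof -
    have "(g has_derivative (\<lambda>x. inverse (radial_cos' (2 * k) (r \<theta>)) * x)) (at (radial_cos (2 * k) (r \<theta>)))"
    proof (rule has_derivative_inverse_strong[OF J(1) r(1)])
      show "continuous_on J (radial_cos (2 * k))"
      proof (intro continuous_at_imp_continuous_on ballI)
        fix x assume "x \<in> J"
        from Jr[OF this] show "isCont (radial_cos (2 * k)) x"
          by (intro DERIV_isCont[OF has_real_derivative_radial_cos]) auto
      qed
      show "g (radial_cos (2 * k) x) = x" if "x \<in> J" for x using J(4) that by blast
      show "(radial_cos (2 * k) has_derivative (\<lambda>x. radial_cos' (2 * k) (r \<theta>) * x)) (at (r \<theta>))"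
        using has_real_derivative_radial_cos[of "r \<theta>" "2 * k"] Jr[OF r(1)[of \<theta>]]
        by (auto simp: has_field_derivative_def)
      show "(\<lambda>x. radial_cos' (2 * k) (r \<theta>) * x) \<circ> (\<lambda>x. inverse (radial_cos' (2 * k) (r \<theta>)) * x) = id"
        using J(3)[rule_format, OF r(1)[of \<theta>]] by (auto simp: fun_eq_iff)
    qed
    then show ?thesis unfolding r(2) has_field_derivative_def by simp
  qed
  have d1: "(r has_real_derivative r1 \<theta>) (at \<theta>)" for \<theta>
  proof -
    have "((\<lambda>\<theta>. g (cos \<theta>)) has_real_derivative inverse (radial_cos' (2 * k) (r \<theta>)) * (- sin \<theta>)) (at \<theta>)"
      by (rule DERIV_chain2[OF dg DERIV_cos])
    then show ?thesis by (simp add: r_def[abs_def] r1_def divide_inverse mult.commute)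
  qed
  have dr': "((\<lambda>\<theta>. radial_cos' (2 * k) (r \<theta>)) has_real_derivative radial_cos'' (2 * k) (r \<theta>) * r1 \<theta>) (at \<theta>)" for \<theta>
    using Jr[OF r(1)[of \<theta>]] by (intro DERIV_chain2[OF has_real_derivative_radial_cos' d1]) auto
  have ne: "radial_cos' (2 * k) (r \<theta>) \<noteq> 0" for \<theta> using J(3)[rule_format, OF r(1)[of \<theta>]] by simp
  have d2: "(r1 has_real_derivative r2 \<theta>) (at \<theta>)" for \<theta>
  proof -
    have "((\<lambda>\<theta>. - sin \<theta> / radial_cos' (2 * k) (r \<theta>)) has_real_derivative
      (- cos \<theta> * radial_cos' (2 * k) (r \<theta>) - (- sin \<theta>) * (radial_cos'' (2 * k) (r \<theta>) * r1 \<theta>)) /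
      (radial_cos' (2 * k) (r \<theta>) * radial_cos' (2 * k) (r \<theta>))) (at \<theta>)"
      by (intro DERIV_divide DERIV_minus DERIV_sin dr' ne)
    from this[folded r1_def r2_def] show ?thesis .
  qed
  have c2: "continuous_on UNIV r2"
  proof -
    have cr: "continuous_on UNIV r" "continuous_on UNIV r1"
      "continuous_on UNIV (\<lambda>\<theta>. radial_cos' (2 * k) (r \<theta>))"
      using DERIV_isCont[OF d1] DERIV_isCont[OF d2] DERIV_isCont[OF dr']
      by (auto simp: continuous_on_eq_continuous_at)
    have "continuous_on UNIV (\<lambda>\<theta>. radial_cos'' (2 * k) (r \<theta>))"
      unfolding radial_cos''_def using pos Jr(2)[OF r(1)]
      by (intro continuous_intros cr) (auto simp: less_imp_neq[symmetric])
    then show ?thesis unfolding r2_def using ne by (intro continuous_intros cr) auto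
  qed
  let ?\<gamma> = "\<lambda>t. a + polar r t"
  note curve = regular_closed_curve_polar[OF d1 d2 c2 pos, of a]
  have per: "r (\<theta> + 2 * pi) = r \<theta>" for \<theta> by (simp add: r_def)
  have reg: "regular_closed_curve ?\<gamma>" by (rule curve(1)[OF per])
  have range: "range ?\<gamma> = level k"
    unfolding range_polar[OF pos]
  proof (intro subset_antisym subsetI)
    fix q assume "q \<in> {a + frame (r \<theta> * cos \<theta>) (r \<theta> * sin \<theta>) |\<theta>. True}"
    then obtain \<theta> where q: "q = a + frame (r \<theta> * cos \<theta>) (r \<theta> * sin \<theta>)" by blast
    show "q \<in> level k"
      unfolding q polar_in_level_iff[OF k pos] using r[of \<theta>] J(2) by auto
  next
    fix q assume q: "q \<in> level k"
    then have "q - a \<noteq> 0" by (auto simp: level_def)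
    then obtain \<theta> where \<theta>: "q - a = frame (norm (q - a) * cos \<theta>) (norm (q - a) * sin \<theta>)" "0 < norm (q - a)"
      by (metis frame_polar_coordinates zero_less_norm_iff)
    then have q': "q = a + frame (norm (q - a) * cos \<theta>) (norm (q - a) * sin \<theta>)"
      by (metis add.commute diff_add_cancel)
    then have A: "1 / (2 * k) < norm (q - a)" "norm (q - a) < 1 / 2" "radial_cos (2 * k) (norm (q - a)) = cos \<theta>"
      using polar_in_level_iff[OF k \<theta>(2), of \<theta>] q by auto
    then have "norm (q - a) \<in> J" using inJ by simp
    then have "r \<theta> = norm (q - a)" using J(4) A(3) by (metis r_def)
    then show "q \<in> {a + frame (r \<theta> * cos \<theta>) (r \<theta> * sin \<theta>) |\<theta>. True}" using q' by (metis (mono_tags, lifting) mem_Collect_eq)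
  qed
  have "curvature ?\<gamma> t \<noteq> 0" for t
    unfolding curvature_nonzero_iff
  proof (intro conjI allI notI)
    have v: "velocity ?\<gamma> t \<noteq> 0" for t using reg by (simp add: regular_closed_curve_def)
    then show "velocity ?\<gamma> t = 0 \<Longrightarrow> False" by blast
    have on: "?\<gamma> t \<in> level k" for t using range by blast
    have W: "norm (?\<gamma> t - a) \<le> critical_radius" "W (?\<gamma> t) * k = 1" for t
      using on[of t] by (auto simp: level_def)
    have ne: "?\<gamma> t \<noteq> a" "?\<gamma> t \<noteq> b" for t
      using W(2)[of t] by auto
    have V: "V (?\<gamma> t) = k" for t
      using W(2)[of t] V_pos[OF ne(1)[of t]] unfolding W_eq_inverse_V[OF ne]
      by (simp add: field_simps)
    note d = regular_closed_curve_derivatives[OF reg]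
    have "grad_V (?\<gamma> t) (velocity ?\<gamma> t) = 0" for t
    proof (rule DERIV_unique)
      show "((\<lambda>t. V (?\<gamma> t)) has_real_derivative grad_V (?\<gamma> t) (velocity ?\<gamma> t)) (at t)"
        by (rule has_real_derivative_V[OF d(1) ne])
      show "((\<lambda>t. V (?\<gamma> t)) has_real_derivative 0) (at t)" unfolding V by simp
    qed
    note grad = this
    have hess: "hess_V (?\<gamma> t) (velocity ?\<gamma> t) + grad_V (?\<gamma> t) (acceleration ?\<gamma> t) = 0"
    proof (rule DERIV_unique)
      show "((\<lambda>t. grad_V (?\<gamma> t) (velocity ?\<gamma> t)) has_real_derivative
          hess_V (?\<gamma> t) (velocity ?\<gamma> t) + grad_V (?\<gamma> t) (acceleration ?\<gamma> t)) (at t)"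
        by (rule has_real_derivative_grad_V[OF d(1,2) ne])
      show "((\<lambda>t. grad_V (?\<gamma> t) (velocity ?\<gamma> t)) has_real_derivative 0) (at t)" unfolding grad by simp
    qed
    fix m assume "acceleration ?\<gamma> t = m *\<^sub>R velocity ?\<gamma> t"
    then have "hess_V (?\<gamma> t) (velocity ?\<gamma> t) = 0" using hess grad[of t] by (simp add: grad_V_scaleR)
    moreover have "critical_value < V (?\<gamma> t)" using k by (simp add: V critical_value_2)
    ultimately show False using hess_V_neg[OF ne(1) W(1) _ v grad, of t] by simp
  qed
  with reg range show ?thesis by (rule that)
qed

lemma bounds_strictly_convex_domain_level:
  assumes "2 < k"
  shows "bounds_strictly_convex_domain UNIV (level k)"
proof -
  have k: "critical_value < k" using assms by (simp add: critical_value_2)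
  obtain \<gamma> where "regular_closed_curve \<gamma>" "range \<gamma> = level k" "\<And>t. curvature \<gamma> t \<noteq> 0"
    using level_curve[OF assms] by blast
  then show ?thesis
    unfolding bounds_strictly_convex_domain_def
    using strictly_convex_sublevel[OF k] level_eq_boundary[OF k] by blast
qed

end

section \<open>From level curves to the regularized components\<close>

lemma (in two_centers) regularized_component_eq:
  assumes "energy_surface \<mu> c = surface c" "c < - critical_value"
  shows "regularized_component \<mu> c a = inner_regularized c"
  unfolding regularized_component_def energy_component_def inner_regularized_def assms(1)
    component_at_a_eq_inner_surface[OF assms(2)] ..

lemma cotangent_space_north: "cotangent_space (0, 1) = range (\<lambda>v::real^2. (v, 0::real))"
  by (auto simp: cotangent_space_def inner_prod_def)

context equal_masses
begin

lemma fiber_north: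
  assumes "c < - 2"
  shows "{\<eta>. ((0, 1), \<eta>) \<in> inner_regularized c} = (\<lambda>v. (v, 0)) ` sphere 0 \<alpha>"
proof (intro subset_antisym subsetI)
  fix \<eta> assume "\<eta> \<in> {\<eta>. ((0, 1), \<eta>) \<in> inner_regularized c}"
  then have "\<eta> \<in> cotangent_space (0, 1)" "((0, 1), \<eta>) \<in> closure (moser_map a ` inner_surface c)"
    by (auto simp: inner_regularized_def cotangent_sphere_def)
  then obtain v where "\<eta> = (v, 0)" and "norm \<eta> = \<alpha>"
    using fiber_north_subset[of \<eta> c] unfolding cotangent_space_north by blast
  then show "\<eta> \<in> (\<lambda>v. (v, 0)) ` sphere 0 \<alpha>" by (auto simp: norm_prod_def)
next
  fix \<eta> :: "(real^2) \<times> real" assume "\<eta> \<in> (\<lambda>v. (v, 0)) ` sphere 0 \<alpha>"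
  then obtain v where v: "\<eta> = (v, 0)" "norm v = \<alpha>" by auto
  have "((0, 1), \<eta>) \<in> closure (moser_map a ` inner_surface c)"
    unfolding v(1) using assms v(2) by (intro fiber_north_superset) (auto simp: critical_value_2)
  then show "\<eta> \<in> {\<eta>. ((0, 1), \<eta>) \<in> inner_regularized c}"
    by (auto simp: inner_regularized_def cotangent_sphere_def cotangent_space_north v(1) norm_prod_def)
qed

lemma fiberwise_convex_inner_regularized:
  assumes c: "c < - 2"
  shows "fiberwise_convex (inner_regularized c)"
  unfolding fiberwise_convex_def
proof
  fix \<xi> :: "(real^2) \<times> real" assume \<xi>: "\<xi> \<in> sphere 0 1"
  show "bounds_strictly_convex_domain (cotangent_space \<xi>) {\<eta>. (\<xi>, \<eta>) \<in> inner_regularized c}"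
  proof (cases "\<xi> = (0, 1)")
    case True
    have lin: "linear (\<lambda>v::real^2. (v, 0::real))" "linear (fst :: (real^2) \<times> real \<Rightarrow> real^2)"
      by (auto intro!: linearI)
    show ?thesis
      unfolding True fiber_north[OF c] cotangent_space_north
      by (rule bounds_strictly_convex_domain_linear_image[OF lin])
        (simp_all add: bounds_strictly_convex_domain_sphere \<alpha>_pos)
  next
    case False
    define p where "p = stereo \<xi>"
    have p: "\<xi> = inv_stereo p" using inv_stereo_stereo[OF \<xi> False] by (simp add: p_def)
    \<comment> \<open>The value of \<open>V\<close> on the fiber over \<open>p\<close>. Kinetic
      energy can only raise it, so it exceeds the critical value 2 over every momentum.\<close>
    define k where "k = (norm p)\<^sup>2 / 2 - c"
    have "0 \<le> (norm p)\<^sup>2 / 2" by simp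
    then have "2 < k" using c unfolding k_def by linarith
    then have "bounds_strictly_convex_domain UNIV ((+) (- a) ` level k)"
      by (intro bounds_strictly_convex_domain_translation bounds_strictly_convex_domain_level)
    moreover have "{x. (a + x, p) \<in> inner_surface c} = (+) (- a) ` level k"
      unfolding inner_surface_level k_def[symmetric] by (force simp: image_iff)
    ultimately show ?thesis
      unfolding p fiber_inv_stereo range_stereo_covector[symmetric]
      using bounds_strictly_convex_domain_linear_image[OF linear_stereo_covector
          linear_stereo_covector_inv stereo_covector_inv_left] by metis
  qed
qed

end

lemma norm_Moon_minus_Earth: "norm (Moon - Earth) = 1" "norm (Earth - Moon) = 1"
  by (simp_all add: Moon_def Earth_def norm_eq_sqrt_inner inner_vec_def sum_2)

theorem theorem1p4:
  fixes \<mu> :: real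
  assumes "0 < \<mu>" and "\<mu> < 1"
  shows "(\<mu> < 1 / 2 \<longrightarrow>
           (\<exists>\<epsilon>>0. \<forall>c \<in> {critical_energy \<mu> - \<epsilon> <..< critical_energy \<mu>}.
              \<not> fiberwise_convex (regularized_component \<mu> c Earth))) \<and>
         (\<mu> = 1 / 2 \<longrightarrow>
           critical_energy \<mu> = - 2 \<and>
           (\<forall>c < critical_energy \<mu>.
              fiberwise_convex (regularized_component \<mu> c Earth) \<and>
              fiberwise_convex (regularized_component \<mu> c Moon)))"
proof -
  \<comment> \<open>The Moon component is the component at the near center after exchanging the
    centers together with their masses.\<close>
  interpret E: two_centers Earth Moon "1 - \<mu>" \<mu>
    by unfold_locales (use assms norm_Moon_minus_Earth in simp_all)
  interpret M: two_centers Moon Earth \<mu> "1 - \<mu>"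
    by unfold_locales (use assms norm_Moon_minus_Earth in simp_all)
  have crit: "critical_energy \<mu> = - E.critical_value" "critical_energy \<mu> = - M.critical_value"
    by (simp_all add: critical_energy_def E.critical_value_eq M.critical_value_eq mult.commute)
  have "potential \<mu> q = - E.V q" "potential \<mu> q = - M.V q" for q
    by (simp_all add: potential_def E.V_def M.V_def diff_divide_distrib)
  then have "energy_surface \<mu> c = E.surface c" "energy_surface \<mu> c = M.surface c" for c
    unfolding energy_surface_def hamiltonian_def E.surface_def M.surface_def by auto
  then have reg: "regularized_component \<mu> c Earth = E.inner_regularized c"
    "regularized_component \<mu> c Moon = M.inner_regularized c" if "c < critical_energy \<mu>" for c
    using that crit E.regularized_component_eq M.regularized_component_eq by simp_all
  show ?thesis
  proof (intro conjI impI)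
    assume "\<mu> < 1 / 2"
    then have "\<mu> < 1 - \<mu>" by simp
    then obtain \<epsilon> where "0 < \<epsilon>" "\<forall>c \<in> {- E.critical_value - \<epsilon> <..< - E.critical_value}.
        \<not> fiberwise_convex (E.inner_regularized c)"
      by (rule E.not_fiberwise_convex_near_critical_value)
    then show "\<exists>\<epsilon>>0. \<forall>c \<in> {critical_energy \<mu> - \<epsilon> <..< critical_energy \<mu>}.
        \<not> fiberwise_convex (regularized_component \<mu> c Earth)"
      using reg(1) crit(1) by (intro exI[of _ \<epsilon>]) simp
  next
    assume half: "\<mu> = 1 / 2"
    interpret E: equal_masses Earth Moon "1 - \<mu>" \<mu> by unfold_locales (simp add: half)
    interpret M: equal_masses Moon Earth \<mu> "1 - \<mu>" by unfold_locales (simp add: half)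
    show 2: "critical_energy \<mu> = - 2" using crit(1) E.critical_value_2 by simp
    show "\<forall>c < critical_energy \<mu>. fiberwise_convex (regularized_component \<mu> c Earth) \<and>
        fiberwise_convex (regularized_component \<mu> c Moon)"
      using reg 2 E.fiberwise_convex_inner_regularized M.fiberwise_convex_inner_regularized by simp
  qed
qed

end
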